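(* Let $M$ be a sparse paving matroid. Then both its $\gamma$-polynomial $\Gamma_M(x)$ and its $Z$-polynomial $Z_M(x)$ have only negative real zeros (that is, every complex zero of either polynomial is a negative real number).
   Context: Matroids are finite. A matroid is paving if every circuit has cardinality at least the rank of the matroid; it is sparse paving if both the matroid and its dual are paving. For a matroid $M$, let $L(M)$ be its lattice of flats, $\operatorname{rk}$ its rank function, $M|F$ the restriction to a flat $F$ and $M/F$ the contraction by $F$. Let $\chi_{M|F}(x)=\sum_{G\in L(M),\,G\subseteq F}\mu(\hat 0,G)\,x^{\operatorname{rk}F-\operatorname{rk}G}$ be the characteristic polynomial, with $\mu$ the Möbius function of $L(M)$ and $\hat 0$ its minimum. The Kazhdan--Lusztig polynomial $P_M(x)\in\mathbb Z[x]$ (Elias--Proudfoot--Wakefield) depends only on $L(M)$ and is the unique assignment such that: $P_M(x)=1$ if $\operatorname{rk}M=0$; $\deg P_M<\tfrac12\operatorname{rk}M$ if $\operatorname{rk}M>0$; and $x^{\operatorname{rk}M}P_M(x^{-1})=\sum_{F\in L(M)}\chi_{M|F}(x)P_{M/F}(x)$ for every $M$. The $Z$-polynomial is $Z_M(x)=\sum_{F\in L(M)}x^{\operatorname{rk}F}P_{M/F}(x)$. It is palindromic of degree $d=\operatorname{rk}M$, so there is a unique polynomial $\Gamma_M(x)$ of degree at most $\lfloor d/2\rfloor$, the $\gamma$-polynomial of $M$, such that $Z_M(x)=(1+x)^d\,\Gamma_M\!\left(\frac{x}{(1+x)^2}\right)$. *)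

theory Defs
  imports Complex_Main "HOL-Computational_Algebra.Polynomial"
begin

section \<open>Finite matroids\<close>

definition is_matroid :: "'a set \<Rightarrow> 'a set set \<Rightarrow> bool" where
  "is_matroid E I \<longleftrightarrow>
     finite E \<and> (\<forall>X\<in>I. X \<subseteq> E) \<and> {} \<in> I \<and>
     (\<forall>X\<in>I. \<forall>Y. Y \<subseteq> X \<longrightarrow> Y \<in> I) \<and>
     (\<forall>X\<in>I. \<forall>Y\<in>I. card X < card Y \<longrightarrow> (\<exists>y\<in>Y - X. insert y X \<in> I))"

lemma is_matroidD:
  assumes "is_matroid E I"
  shows "finite E"
    and "\<And>X. X \<in> I \<Longrightarrow> X \<subseteq> E"
    and "\<And>X. X \<in> I \<Longrightarrow> finite X"
    and "{} \<in> I"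
    and "\<And>X Y. X \<in> I \<Longrightarrow> Y \<subseteq> X \<Longrightarrow> Y \<in> I"
    and "\<And>X Y. X \<in> I \<Longrightarrow> Y \<in> I \<Longrightarrow> card X < card Y \<Longrightarrow> \<exists>y\<in>Y - X. insert y X \<in> I"
  using assms unfolding is_matroid_def by (auto intro: finite_subset)

typedef 'a matroid = "{(E :: 'a set, I). is_matroid E I}"
proof
  show "({}, {{}}) \<in> {(E :: 'a set, I). is_matroid E I}"
    by (auto simp: is_matroid_def)
qed

setup_lifting type_definition_matroid

lift_definition ground :: "'a matroid \<Rightarrow> 'a set" is fst .

lift_definition indeps :: "'a matroid \<Rightarrow> 'a set set" is snd .

definition basis_in :: "'a set set \<Rightarrow> 'a set \<Rightarrow> 'a set \<Rightarrow> bool" where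
  "basis_in I A B \<longleftrightarrow> B \<in> I \<and> B \<subseteq> A \<and> (\<forall>x\<in>A - B. insert x B \<notin> I)"

lemma basis_extend:
  assumes M: "is_matroid E I" and X: "X \<in> I" "X \<subseteq> A"
  obtains B where "basis_in I A B" "X \<subseteq> B"
proof -
  let ?S = "{B \<in> I. X \<subseteq> B \<and> B \<subseteq> A}"
  have "?S \<subseteq> Pow E" using is_matroidD(2)[OF M] by auto
  hence fin: "finite ?S" using is_matroidD(1)[OF M] finite_subset by blast
  moreover have "X \<in> ?S" using X by auto
  ultimately obtain B where B: "B \<in> ?S" "\<forall>C\<in>?S. B \<subseteq> C \<longrightarrow> B = C"
    using finite_has_maximal[of ?S] by blast
  have "insert x B \<notin> I" if "x \<in> A - B" for x
    using B that by auto
  with B(1) have "basis_in I A B" by (auto simp: basis_in_def)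
  with B(1) that show ?thesis by blast
qed

lemma basis_in_card:
  assumes M: "is_matroid E I" and B: "basis_in I A B" and X: "X \<in> I" "X \<subseteq> A"
  shows "card X \<le> card B"
proof (rule ccontr)
  assume "\<not> card X \<le> card B"
  then obtain y where "y \<in> X - B" "insert y B \<in> I"
    using is_matroidD(6)[OF M, of B X] B X(1) by (auto simp: basis_in_def)
  thus False using B X(2) by (auto simp: basis_in_def)
qed

lift_definition dual :: "'a matroid \<Rightarrow> 'a matroid" is
  "\<lambda>(E, I). (E, {X. X \<subseteq> E \<and> (\<exists>B. basis_in I E B \<and> B \<inter> X = {})})"
proof -
  fix M :: "'a set \<times> 'a set set"
  obtain E I where MEI: "M = (E, I)" by fastforce
  assume "M \<in> {(E, I). is_matroid E I}"
  hence M: "is_matroid E I" by (simp add: MEI)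
  let ?D = "{X. X \<subseteq> E \<and> (\<exists>B. basis_in I E B \<and> B \<inter> X = {})}"
  have "\<exists>y\<in>Y - X. insert y X \<in> ?D"
    if X: "X \<in> ?D" and Y: "Y \<in> ?D" and card: "card X < card Y" for X Y
  proof (rule ccontr)
    assume no: "\<not> (\<exists>y\<in>Y - X. insert y X \<in> ?D)"
    from X obtain A where A: "basis_in I E A" "A \<inter> X = {}" by auto
    from Y obtain B where B: "basis_in I E B" "B \<inter> Y = {}" by auto
    have BI: "B \<in> I" using B(1) by (auto simp: basis_in_def)
    hence "B - X \<in> I" using is_matroidD(5)[OF M] by blast
    moreover have "B - X \<subseteq> E - X" using is_matroidD(2)[OF M BI] by auto
    ultimately obtain C where C: "basis_in I (E - X) C" "B - X \<subseteq> C"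
      using basis_extend[OF M] by blast
    have CI: "C \<in> I" "C \<subseteq> E - X" using C(1) by (auto simp: basis_in_def)
    have AI: "A \<in> I" "A \<subseteq> E" using A(1) by (auto simp: basis_in_def)
    have cAC: "card A \<le> card C" using basis_in_card[OF M C(1) AI(1)] AI A(2) by auto
    have fins: "finite B" "finite C" "finite X" "finite Y"
      using is_matroidD(1,3)[OF M] BI CI X Y by (auto intro: finite_subset)
    have "basis_in I E C"
      unfolding basis_in_def
    proof (intro conjI ballI notI)
      fix x assume "x \<in> E - C" "insert x C \<in> I"
      moreover from this have "card (insert x C) \<le> card A"
        using basis_in_card[OF M A(1)] is_matroidD(2)[OF M] by blast
      ultimately show False using cAC fins by auto
    qed (use CI in auto)
    hence YC: "Y - X \<subseteq> C" using no X Y CI(2) by blast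
    have "card C \<le> card B"
      using basis_in_card[OF M B(1) CI(1)] CI(2) by auto
    moreover have "card (B - X) + card (Y - X) \<le> card C"
    proof -
      have "card (B - X) + card (Y - X) = card ((B - X) \<union> (Y - X))"
        using fins B(2) by (intro card_Un_disjoint[symmetric]) auto
      also have "\<dots> \<le> card C" using YC C(2) fins by (intro card_mono) auto
      finally show ?thesis .
    qed
    moreover have "card B = card (B - X) + card (B \<inter> X)"
      using fins card_Diff_subset_Int[of B X] card_mono[of B "B \<inter> X"] by auto
    moreover have "card (B \<inter> X) \<le> card (X - Y)"
      using fins B(2) by (intro card_mono) auto
    moreover have "card (X - Y) < card (Y - X)"
      using card_less_sym_Diff[OF fins(3,4) card] .
    ultimately show False by linarith
  qed
  moreover obtain B where "basis_in I E B"
    using basis_extend[OF M is_matroidD(4)[OF M]] by auto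
  hence "{} \<in> ?D" by auto
  moreover have "\<forall>X\<in>?D. \<forall>Y. Y \<subseteq> X \<longrightarrow> Y \<in> ?D" by blast
  ultimately have "is_matroid E ?D"
    using is_matroidD(1)[OF M] unfolding is_matroid_def by blast
  thus "(case M of (E, I) \<Rightarrow> (E, {X. X \<subseteq> E \<and> (\<exists>B. basis_in I E B \<and> B \<inter> X = {})}))
          \<in> {(E, I). is_matroid E I}"
    by (simp add: MEI)
qed

lift_definition contraction :: "'a matroid \<Rightarrow> 'a set \<Rightarrow> 'a matroid" is
  "\<lambda>(E, I) A. (E - A, {X. X \<subseteq> E - A \<and> (\<exists>B. basis_in I A B \<and> X \<union> B \<in> I)})"
proof -
  fix M :: "'a set \<times> 'a set set" and A
  obtain E I where MEI: "M = (E, I)" by fastforce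
  assume "M \<in> {(E, I). is_matroid E I}"
  hence M: "is_matroid E I" by (simp add: MEI)
  let ?C = "{X. X \<subseteq> E - A \<and> (\<exists>B. basis_in I A B \<and> X \<union> B \<in> I)}"
  have "\<exists>y\<in>Y - X. insert y X \<in> ?C"
    if X: "X \<in> ?C" and Y: "Y \<in> ?C" and card: "card X < card Y" for X Y
  proof -
    from X obtain B where B: "basis_in I A B" "X \<union> B \<in> I" by auto
    from Y obtain C where C: "basis_in I A C" "Y \<union> C \<in> I" by auto
    have BC: "B \<in> I" "B \<subseteq> A" "C \<in> I" "C \<subseteq> A" using B C by (auto simp: basis_in_def)
    have fins: "finite X" "finite Y" "finite B" "finite C"
      using is_matroidD(3)[OF M B(2)] is_matroidD(3)[OF M C(2)] by auto
    have "card B = card C"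
      using basis_in_card[OF M B(1) BC(3,4)] basis_in_card[OF M C(1) BC(1,2)] by simp
    moreover have "card (X \<union> B) = card X + card B"
      using fins X BC by (intro card_Un_disjoint) auto
    moreover have "card (Y \<union> C) = card Y + card C"
      using fins Y BC by (intro card_Un_disjoint) auto
    ultimately obtain y where y: "y \<in> (Y \<union> C) - (X \<union> B)" "insert y (X \<union> B) \<in> I"
      using is_matroidD(6)[OF M B(2) C(2)] card by auto
    have "insert y B \<in> I" using is_matroidD(5)[OF M y(2)] by blast
    hence "y \<notin> A" using B(1) y(1) by (auto simp: basis_in_def)
    hence "y \<in> Y - X" using y(1) BC by auto
    moreover have "insert y X \<in> ?C" using \<open>y \<in> Y - X\<close> X Y y(2) B(1) by auto
    ultimately show ?thesis by blast
  qed
  moreover obtain B where "basis_in I A B"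
    using basis_extend[OF M is_matroidD(4)[OF M]] by auto
  hence "{} \<in> ?C" by (auto simp: basis_in_def)
  moreover have "\<forall>X\<in>?C. \<forall>Y. Y \<subseteq> X \<longrightarrow> Y \<in> ?C"
  proof (intro ballI allI impI)
    fix X Y assume "X \<in> ?C" "Y \<subseteq> X"
    then obtain B where "X \<subseteq> E - A" "basis_in I A B" "X \<union> B \<in> I" by auto
    moreover have "Y \<union> B \<in> I"
      using is_matroidD(5)[OF M \<open>X \<union> B \<in> I\<close>, of "Y \<union> B"] \<open>Y \<subseteq> X\<close> by auto
    ultimately show "Y \<in> ?C" using \<open>Y \<subseteq> X\<close> by blast
  qed
  ultimately have "is_matroid (E - A) ?C"
    using is_matroidD(1)[OF M] unfolding is_matroid_def by blast
  thus "(case M of (E, I) \<Rightarrow> \<lambda>A. (E - A, {X. X \<subseteq> E - A \<and> (\<exists>B. basis_in I A B \<and> X \<union> B \<in> I)})) A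
          \<in> {(E, I). is_matroid E I}"
    by (simp add: MEI)
qed

definition rank_of :: "'a matroid \<Rightarrow> 'a set \<Rightarrow> nat" where
  "rank_of M A = Max (card ` {X \<in> indeps M. X \<subseteq> A})"

definition rk :: "'a matroid \<Rightarrow> nat" where
  "rk M = rank_of M (ground M)"

definition circuit :: "'a matroid \<Rightarrow> 'a set \<Rightarrow> bool" where
  "circuit M C \<longleftrightarrow> C \<subseteq> ground M \<and> C \<notin> indeps M \<and> (\<forall>D. D \<subset> C \<longrightarrow> D \<in> indeps M)"

definition paving :: "'a matroid \<Rightarrow> bool" where
  "paving M \<longleftrightarrow> (\<forall>C. circuit M C \<longrightarrow> rk M \<le> card C)"

definition sparse_paving :: "'a matroid \<Rightarrow> bool" where
  "sparse_paving M \<longleftrightarrow> paving M \<and> paving (dual M)"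

section \<open>The lattice of flats and characteristic polynomials\<close>

text \<open>The lattice of flats is represented by its set of elements, ordered by inclusion.\<close>

definition flats :: "'a matroid \<Rightarrow> 'a set set" where
  "flats M = {F. F \<subseteq> ground M \<and> (\<forall>x\<in>ground M - F. rank_of M F < rank_of M (insert x F))}"

text \<open>The minimum of the lattice of flats (the set of loops of \<open>M\<close>).\<close>

definition min_flat :: "'a matroid \<Rightarrow> 'a set" where
  "min_flat M = \<Inter> (flats M)"

text \<open>
  The Moebius function of a family of finite sets, ordered by inclusion. The finiteness guard
  only serves termination: all flats are finite.
\<close>

function moebius :: "'a set set \<Rightarrow> 'a set \<Rightarrow> 'a set \<Rightarrow> int" where
  "moebius L X Y =
     (if X = Y then 1
      else if X \<subset> Y \<and> finite Y then - (\<Sum>Z\<in>{Z \<in> L. X \<subseteq> Z \<and> Z \<subset> Y}. moebius L X Z)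
      else 0)"
  by pat_completeness auto
termination
  by (relation "measure (\<lambda>(L, X, Y). card Y)") (auto intro: psubset_card_mono)

declare moebius.simps [simp del]

text \<open>
  The characteristic polynomial of the restriction of \<open>M\<close> to a flat \<open>F\<close>, whose flats are the
  flats of \<open>M\<close> contained in \<open>F\<close>.
\<close>

definition char_poly_restr :: "'a matroid \<Rightarrow> 'a set \<Rightarrow> int poly" where
  "char_poly_restr M F =
     (\<Sum>G\<in>{G \<in> flats M. G \<subseteq> F}.
        monom (moebius (flats M) (min_flat M) G) (rank_of M F - rank_of M G))"

section \<open>Kazhdan--Lusztig, Z- and gamma-polynomials\<close>

text \<open>
  For \<open>degree p \<le> d\<close> this is the polynomial $x^d p(x^{-1})$; note that \<open>reflect_poly p\<close> is
  $x^{\deg p} p(x^{-1})$.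
\<close>

definition reverse_poly :: "nat \<Rightarrow> int poly \<Rightarrow> int poly" where
  "reverse_poly d p = monom 1 (d - degree p) * reflect_poly p"

definition is_KL :: "('a matroid \<Rightarrow> int poly) \<Rightarrow> bool" where
  "is_KL P \<longleftrightarrow>
     (\<forall>M. (rk M = 0 \<longrightarrow> P M = 1) \<and>
          (rk M > 0 \<longrightarrow> real (degree (P M)) < real (rk M) / 2) \<and>
          reverse_poly (rk M) (P M) =
            (\<Sum>F\<in>flats M. char_poly_restr M F * P (contraction M F)))"

text \<open>
  The ground set of a contraction lies in the same type as the original ground set, so it is
  enough to consider assignments on all matroids with ground set in one fixed type.
\<close>

definition KL_poly :: "'a matroid \<Rightarrow> int poly" where
  "KL_poly = (THE P. is_KL P)"

definition Z_poly :: "'a matroid \<Rightarrow> int poly" where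
  "Z_poly M = (\<Sum>F\<in>flats M. monom 1 (rank_of M F) * KL_poly (contraction M F))"

text \<open>
  The identity of rational functions defining the gamma-polynomial is stated as an identity
  of values at all real points other than the pole.
\<close>

definition is_gamma_poly :: "'a matroid \<Rightarrow> int poly \<Rightarrow> bool" where
  "is_gamma_poly M G \<longleftrightarrow>
     degree G \<le> rk M div 2 \<and>
     (\<forall>x::real. x \<noteq> -1 \<longrightarrow>
        poly (map_poly of_int (Z_poly M)) x =
          (1 + x) ^ rk M * poly (map_poly of_int G) (x / (1 + x)\<^sup>2))"

definition gamma_poly :: "'a matroid \<Rightarrow> int poly" where
  "gamma_poly M = (THE G. is_gamma_poly M G)"

definition only_negative_real_zeros :: "int poly \<Rightarrow> bool" where
  "only_negative_real_zeros p \<longleftrightarrow>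
     (\<forall>z::complex. poly (map_poly of_int p) z = 0 \<longrightarrow> z \<in> \<real> \<and> Re z < 0)"

end

theory Submission
  imports Defs "HOL-Computational_Algebra.Fundamental_Theorem_Algebra"
begin

text \<open>
  Let \<open>M\<close> be sparse paving of rank \<open>k\<close> on \<open>k + m\<close> elements with \<open>\<lambda>\<close> circuit-hyperplanes, and let \<open>\<theta> = x d/dx\<close>.
  The Kazhdan--Lusztig polynomial of \<open>M\<close> is that of the uniform matroid minus \<open>\<lambda>\<close> times a polynomial
  depending only on \<open>k\<close>. Comparing corank \<open>m\<close> with corank \<open>m - 1\<close> turns everything into hypergeometric
  terms and gives \<open>\<Gamma>\<^sub>M = N(\<theta>) f\<close>, up to a scalar, where \<open>f = \<Sum> x\<^sup>i / ((k - 2i)! i! (m + i)!)\<close> is a disguised Gegenbauer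
  polynomial with negative zeros and \<open>N\<close> is an explicit real polynomial.

  The signs of \<open>N\<close> at negative integers produce real zeros \<open>- a\<^sub>s\<close> with \<open>s < a\<^sub>s < s + 1\<close> for \<open>2 \<le> s \<le> m - 2\<close>,
  and one further zero lies to the right of \<open>k div 2\<close>. The corresponding linear factors of \<open>N(\<theta>)\<close> preserve
  real-rootedness. The remaining factor \<open>q\<^sub>2 \<theta>\<^sup>2 + q\<^sub>1 \<theta> + q\<^sub>0\<close> may have complex zeros, but it preserves
  real-rootedness as soon as \<open>(q\<^sub>1 + q\<^sub>2)\<^sup>2 \<ge> 4 q\<^sub>0 q\<^sub>2\<close>, and this follows from the bounds
  \<open>\<lambda> \<le> C(m + k, k) / (m + 1)\<close> and \<open>\<lambda> \<le> C(m + k, k) / (k + 1)\<close>.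
\<close>

section \<open>Operators preserving real-rootedness\<close>

text \<open>The obstacle is a large \<open>\<lambda>\<close>: \<open>N(-1)\<close> has the sign of
  \<open>C - k\<close> with \<open>C = 2 \<lambda> / k\<close>, so the sign change between
  \<open>-1\<close> and \<open>0\<close> can be lost and two zeros of \<open>N\<close> may be
  complex. Normal ordering rescues the argument: \<open>:(\<theta> + u)(\<theta> + v):\<close> is
  \<open>\<theta>^2 + (u + v - 1) \<theta> + u v\<close>, so real \<open>u, v > 0\<close> reach
  quadratics whose ordinary discriminant \<open>q1^2 - 4 q0 q2\<close> is negative. The quadratic
  factor is never computed; it is controlled through \<open>N(0)\<close>, \<open>N(1)\<close>,
  \<open>N(-1)\<close> and the location of the other zeros.

  On the matroid side no characteristic polynomial is inverted. A polynomial of degree below half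
  the rank is determined once adding it to the contribution of the proper contractions gives a
  palindromic polynomial, and every gamma expansion is palindromic. Closed formulas therefore need
  only be verified. Moebius inversion occurs once, to show that this palindromic recursion solves
  the defining equation.\<close>

lemma divide_eq_uminus_divide:
  fixes a b v z :: complex
  assumes "z * a = - v * b" "z \<noteq> 0" "b \<noteq> 0"
  shows "a / b = - v / z"
  using assms by (subst frac_eq_eq) (simp_all add: mult.commute)

lemma poly_roots_factor:
  fixes p :: "complex poly"
  assumes "degree p > 0"
  obtains w q where "p = [:-w, 1:] * q" "degree p = Suc (degree q)" "poly p w = 0"
proof -
  have "\<not> constant (poly p)" using assms by (auto simp: constant_degree)
  then obtain w where w: "poly p w = 0" using fundamental_theorem_of_algebra by blast
  then obtain q where q: "p = [:-w, 1:] * q" by (metis dvdE poly_eq_0_iff_dvd)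
  have "q \<noteq> 0" using assms q by auto
  then have "degree p = Suc (degree q)" unfolding q by (subst degree_mult_eq) auto
  with q w that show ?thesis by blast
qed

text \<open>The logarithmic derivative is the sum of \<open>1 / (z - w)\<close> over the zeros \<open>w\<close>.\<close>

lemma Im_logderiv_neg:
  fixes p :: "complex poly"
  assumes "degree p > 0" "\<And>w. poly p w = 0 \<Longrightarrow> Im w \<le> 0" "Im z > 0"
  shows "Im (poly (pderiv p) z / poly p z) < 0"
  using assms
proof (induction "degree p" arbitrary: p rule: less_induct)
  case less
  obtain w q where p: "p = [:-w, 1:] * q" "degree p = Suc (degree q)" "poly p w = 0"
    using poly_roots_factor less.prems(1) by blast
  have w: "Im w \<le> 0" using less.prems p by blast
  have zw: "Im (1 / (z - w)) < 0"
    using w less.prems(3) by (auto simp: Im_divide intro!: divide_neg_pos sum_power2_gt_zero_iff[THEN iffD2])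
  have z: "z - w \<noteq> 0" "poly q z \<noteq> 0"
    using w less.prems(2)[of z] less.prems(3) by (auto simp: p(1))
  have eq: "poly (pderiv p) z / poly p z = 1 / (z - w) + poly (pderiv q) z / poly q z"
  proof -
    have "poly (pderiv p) z = poly q z + (z - w) * poly (pderiv q) z" "poly p z = (z - w) * poly q z"
      unfolding p(1) pderiv_mult by (simp_all add: pderiv_pCons algebra_simps del: mult_pCons_left)
    then show ?thesis using z by (simp add: add_frac_eq mult.commute)
  qed
  show ?case
  proof (cases "degree q = 0")
    case True
    then have "pderiv q = 0" by (simp add: pderiv_eq_0_iff)
    then show ?thesis using eq zw by simp
  next
    case False
    then have "Im (poly (pderiv q) z / poly q z) < 0"
      using less.hyps[of q] less.prems p by auto
    then show ?thesis using eq zw by simp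
  qed
qed

text \<open>Each zero \<open>w\<close> contributes \<open>z / (z - w) = 1 + w / (z - w)\<close>. For
  real negative \<open>w\<close> its imaginary part is \<open>- w * Im z / |z - w|^2 > 0\<close>, so
  the negativity of the zeros fixes the sign.\<close>

lemma Im_euler_logderiv_pos:
  fixes p :: "complex poly"
  assumes "degree p > 0" "\<And>w. poly p w = 0 \<Longrightarrow> Im w = 0 \<and> Re w < 0" "Im z > 0"
  shows "Im (z * poly (pderiv p) z / poly p z) > 0"
  using assms
proof (induction "degree p" arbitrary: p rule: less_induct)
  case less
  obtain w q where p: "p = [:-w, 1:] * q" "degree p = Suc (degree q)" "poly p w = 0"
    using poly_roots_factor less.prems(1) by blast
  have w: "Im w = 0" "Re w < 0" using less.prems p by blast+
  have zw: "Im (z / (z - w)) > 0"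
    using w less.prems(3)
    by (auto simp: Im_divide algebra_simps mult_pos_neg intro!: divide_neg_pos sum_power2_gt_zero_iff[THEN iffD2])
  have z: "z - w \<noteq> 0" "poly q z \<noteq> 0"
    using w less.prems(2)[of z] less.prems(3) by (auto simp: p(1))
  have eq: "z * poly (pderiv p) z / poly p z = z / (z - w) + z * poly (pderiv q) z / poly q z"
  proof -
    have "poly (pderiv p) z = poly q z + (z - w) * poly (pderiv q) z" "poly p z = (z - w) * poly q z"
      unfolding p(1) pderiv_mult by (simp_all add: pderiv_pCons algebra_simps del: mult_pCons_left)
    then show ?thesis using z by (simp add: add_frac_eq mult.commute) (simp add: algebra_simps)
  qed
  show ?case
  proof (cases "degree q = 0")
    case True
    then have "pderiv q = 0" by (simp add: pderiv_eq_0_iff)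
    then show ?thesis using eq zw by simp
  next
    case False
    then have "Im (z * poly (pderiv q) z / poly q z) > 0"
      using less.hyps[of q] less.prems p by auto
    then show ?thesis using eq zw by simp
  qed
qed

text \<open>Every complex number is a zero of the zero polynomial, so real-rootedness in this sense
  includes being nonzero.\<close>

definition real_rooted :: "real poly \<Rightarrow> bool" where
  "real_rooted p \<longleftrightarrow> (\<forall>z::complex. poly (map_poly of_real p) z = 0 \<longrightarrow> z \<in> \<real>)"

lemma of_real_poly_cnj: "poly (map_poly of_real p) (cnj z) = cnj (poly (map_poly of_real p) z)"
  by (induction p) (auto simp: map_poly_pCons)

text \<open>Zeros of a real polynomial come in conjugate pairs, so excluding the upper half-plane
  suffices.\<close>

lemma real_rootedI:
  assumes "\<And>z. Im z > 0 \<Longrightarrow> poly (map_poly of_real p) z \<noteq> 0"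
  shows "real_rooted p"
  unfolding real_rooted_def
proof (intro allI impI)
  fix z :: complex assume z: "poly (map_poly of_real p) z = 0"
  have "\<not> Im z > 0" using assms z by blast
  moreover have "\<not> Im z < 0" using assms[of "cnj z"] z by (auto simp: of_real_poly_cnj)
  ultimately show "z \<in> \<real>" by (simp add: complex_is_Real_iff)
qed

lemma real_rooted_upper: "real_rooted p \<Longrightarrow> Im z > 0 \<Longrightarrow> poly (map_poly of_real p) z \<noteq> 0"
  unfolding real_rooted_def by (auto simp: complex_is_Real_iff)

lemma degree_of_real_poly [simp]: "degree (map_poly of_real p :: complex poly) = degree p"
  by (simp add: degree_map_poly)

lemma of_real_poly_pderiv: "map_poly of_real (pderiv p) = (pderiv (map_poly of_real p) :: complex poly)"
  by (rule poly_eqI) (simp add: coeff_pderiv coeff_map_poly)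

lemma of_real_poly_add: "map_poly of_real (p + q) = (map_poly of_real p + map_poly of_real q :: complex poly)"
  by (rule poly_eqI) (simp add: coeff_map_poly)

lemma of_real_poly_diff: "map_poly of_real (p - q) = (map_poly of_real p - map_poly of_real q :: complex poly)"
  by (rule poly_eqI) (simp add: coeff_map_poly)

lemma of_real_poly_smult: "map_poly of_real (smult c q) = (smult (of_real c) (map_poly of_real q) :: complex poly)"
  by (rule poly_eqI) (simp add: coeff_map_poly)

section \<open>The Euler operator on real-rooted polynomials\<close>

definition euler_op :: "'a::{comm_semiring_1,semiring_no_zero_divisors} poly \<Rightarrow> 'a poly" where
  "euler_op p = pCons 0 (pderiv p)"

lemma coeff_euler_op [simp]: "coeff (euler_op p) i = of_nat i * coeff p i"
  by (cases i) (auto simp: euler_op_def coeff_pderiv coeff_pCons)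

lemma poly_of_real_euler_op:
  "poly (map_poly of_real (euler_op p)) z = z * poly (pderiv (map_poly of_real p)) (z::complex)"
  by (simp add: euler_op_def map_poly_pCons of_real_poly_pderiv)

text \<open>A zero \<open>z\<close> in the upper half-plane would give
  \<open>f'(z) / f(z) = - v / z\<close>, where the left side has negative and the right side
  nonnegative imaginary part. The zeros of \<open>f\<close> may have either sign.\<close>

lemma real_rooted_euler_add:
  assumes "real_rooted f" "v > 0"
  shows "real_rooted (euler_op f + smult v f)"
proof (rule real_rootedI)
  fix z :: complex assume z: "Im z > 0"
  define g :: "complex poly" where "g = map_poly of_real f"
  have g0: "poly g z \<noteq> 0" using assms z real_rooted_upper g_def by blast
  have *: "poly (map_poly of_real (euler_op f + smult v f)) z = z * poly (pderiv g) z + of_real v * poly g z"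
    by (simp add: of_real_poly_add of_real_poly_smult poly_of_real_euler_op g_def)
  show "poly (map_poly of_real (euler_op f + smult v f)) z \<noteq> 0"
  proof (cases "degree g = 0")
    case True
    then have "pderiv g = 0" by (simp add: pderiv_eq_0_iff)
    then show ?thesis using * g0 assms by simp
  next
    case False
    have neg: "Im (poly (pderiv g) z / poly g z) < 0"
      using False assms z unfolding g_def
      by (intro Im_logderiv_neg) (auto simp: real_rooted_def complex_is_Real_iff)
    show ?thesis
    proof
      assume "poly (map_poly of_real (euler_op f + smult v f)) z = 0"
      then have "z * poly (pderiv g) z = - of_real v * poly g z"
        using * by (simp add: eq_neg_iff_add_eq_0)
      moreover have "z \<noteq> 0" using z by auto
      ultimately have "poly (pderiv g) z / poly g z = - of_real v / z"
        using g0 by (rule divide_eq_uminus_divide)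
      then have "Im (poly (pderiv g) z / poly g z) = v * Im z / ((Re z)\<^sup>2 + (Im z)\<^sup>2)"
        by (simp add: Im_divide)
      also have "\<dots> \<ge> 0" using assms z by auto
      finally show False using neg by simp
    qed
  qed
qed

text \<open>A zero \<open>z\<close> in the upper half-plane would make \<open>z f'(z) / f(z)\<close>
  the real number \<open>a / c\<close>. This asks for negative zeros of \<open>f\<close>, but leaves
  the sign of \<open>c\<close> free; it serves the zero of \<open>N\<close> to the right of
  \<open>k div 2\<close>.\<close>

lemma real_rooted_euler_linear:
  assumes "\<And>w::complex. poly (map_poly of_real f) w = 0 \<Longrightarrow> Im w = 0 \<and> Re w < 0" "a > 0"
  shows "real_rooted (smult a f - smult c (euler_op f))"
proof (rule real_rootedI)
  fix z :: complex assume z: "Im z > 0"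
  define g :: "complex poly" where "g = map_poly of_real f"
  have g0: "poly g z \<noteq> 0" using assms(1)[of z] z unfolding g_def by auto
  have *: "poly (map_poly of_real (smult a f - smult c (euler_op f))) z
             = of_real a * poly g z - of_real c * (z * poly (pderiv g) z)"
    by (simp add: of_real_poly_diff of_real_poly_smult poly_of_real_euler_op g_def)
  show "poly (map_poly of_real (smult a f - smult c (euler_op f))) z \<noteq> 0"
  proof (cases "degree g = 0 \<or> c = 0")
    case True
    then have "pderiv g = 0 \<or> c = 0" by (auto simp: pderiv_eq_0_iff)
    then show ?thesis using * g0 assms by auto
  next
    case False
    have pos: "Im (z * poly (pderiv g) z / poly g z) > 0"
      using False assms z unfolding g_def by (intro Im_euler_logderiv_pos) auto
    show ?thesis
    proof
      assume "poly (map_poly of_real (smult a f - smult c (euler_op f))) z = 0"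
      then have "z * poly (pderiv g) z / poly g z = of_real (a / c)"
        using * g0 False by (auto simp: field_simps)
      then show False using pos by simp
    qed
  qed
qed

text \<open>
  The quadratic operator is \<open>:(\<theta> + u)(\<theta> + v):\<close>, normally ordered. At a point \<open>z\<close> it takes the value
  \<open>u (z F'(z) + v F(z))\<close> with \<open>F = f + (z / u) f'\<close>, and \<open>F\<close> has no zeros in the upper half-plane.
\<close>

lemma real_rooted_euler_normal_ordered:
  assumes f: "real_rooted f" and uv: "u > 0" "v > 0"
  shows "real_rooted (euler_op (euler_op f) + smult (u + v - 1) (euler_op f) + smult (u * v) f)"
    (is "real_rooted ?h")
proof (rule real_rootedI)
  fix z :: complex assume z: "Im z > 0"
  define g :: "complex poly" where "g = map_poly of_real f"
  have g0: "poly g z \<noteq> 0" using f z real_rooted_upper g_def by blast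
  have hz: "poly (map_poly of_real ?h) z = z\<^sup>2 * poly (pderiv (pderiv g)) z
              + of_real (u + v) * z * poly (pderiv g) z + of_real (u * v) * poly g z"
    by (simp add: of_real_poly_add of_real_poly_smult poly_of_real_euler_op g_def euler_op_def
        of_real_poly_pderiv map_poly_pCons pderiv_pCons algebra_simps power2_eq_square)
  show "poly (map_poly of_real ?h) z \<noteq> 0"
  proof (cases "degree g = 0")
    case True
    then have "pderiv g = 0" by (simp add: pderiv_eq_0_iff)
    then show ?thesis using hz g0 uv by simp
  next
    case False
    have neg: "Im (poly (pderiv g) w / poly g w) < 0" if "Im w > 0" for w
      using False f that unfolding g_def
      by (intro Im_logderiv_neg) (auto simp: real_rooted_def complex_is_Real_iff)
    \<comment> \<open>The evaluation point \<open>z\<close> is frozen as a coefficient of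
      \<open>F\<close>, so \<open>pderiv F\<close> treats it as a constant.\<close>
    define F where "F = g + smult (z / of_real u) (pderiv g)"
    have degF: "degree F = degree g"
      unfolding F_def using False
      by (intro degree_add_eq_left) (auto simp: degree_pderiv intro: le_less_trans[OF degree_smult_le])
    have Fw: "poly F w \<noteq> 0" if w: "Im w > 0" for w
    proof
      assume "poly F w = 0"
      then have "z * poly (pderiv g) w = - of_real u * poly g w"
        using uv by (simp add: F_def field_simps eq_neg_iff_add_eq_0)
      moreover have "z \<noteq> 0" using z by auto
      moreover have "poly g w \<noteq> 0" using f w real_rooted_upper g_def by blast
      ultimately have "poly (pderiv g) w / poly g w = - of_real u / z"
        by (rule divide_eq_uminus_divide)
      then have "Im (poly (pderiv g) w / poly g w) = u * Im z / ((Re z)\<^sup>2 + (Im z)\<^sup>2)"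
        by (simp add: Im_divide)
      also have "\<dots> \<ge> 0" using uv z by auto
      finally show False using neg[OF w] by simp
    qed
    have negF: "Im (poly (pderiv F) z / poly F z) < 0"
      using False Fw z by (intro Im_logderiv_neg) (auto simp: degF not_less[symmetric])
    have "poly (map_poly of_real ?h) z = of_real u * (of_real v * poly F z + z * poly (pderiv F) z)"
      unfolding hz using uv by (simp add: F_def pderiv_add pderiv_smult field_simps power2_eq_square)
    moreover have "of_real v * poly F z + z * poly (pderiv F) z \<noteq> 0"
    proof
      assume "of_real v * poly F z + z * poly (pderiv F) z = 0"
      then have "z * poly (pderiv F) z = - of_real v * poly F z"
        by (simp add: eq_neg_iff_add_eq_0 add.commute)
      moreover have "z \<noteq> 0" using z by auto
      ultimately have "poly (pderiv F) z / poly F z = - of_real v / z"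
        using Fw[OF z] by (rule divide_eq_uminus_divide)
      then have "Im (poly (pderiv F) z / poly F z) = v * Im z / ((Re z)\<^sup>2 + (Im z)\<^sup>2)"
        by (simp add: Im_divide)
      also have "\<dots> \<ge> 0" using uv z by auto
      finally show False using negF by simp
    qed
    ultimately show ?thesis using uv by simp
  qed
qed

text \<open>Matching with \<open>q2\<close> times the normally ordered product asks for
  \<open>u + v = (q1 + q2) / q2\<close> and \<open>u v = q0 / q2\<close>; the hypotheses say that
  this has a real positive solution. The shift by \<open>q2\<close> in the discriminant comes from
  the \<open>- 1\<close> in \<open>u + v - 1\<close>.\<close>

lemma real_rooted_euler_quadratic:
  assumes f: "real_rooted f" and q: "q0 > 0" "q2 > 0" "q1 + q2 > 0" "(q1 + q2)\<^sup>2 \<ge> 4 * q0 * q2"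
  shows "real_rooted (smult q2 (euler_op (euler_op f)) + smult q1 (euler_op f) + smult q0 f)"
proof -
  define s where "s = (q1 + q2) / q2"
  define b where "b = q0 / q2"
  have sb: "s > 0" "b > 0" "s\<^sup>2 \<ge> 4 * b"
    using q by (auto simp: s_def b_def field_simps power2_eq_square)
  define r where "r = sqrt (s\<^sup>2 - 4 * b)"
  have r: "r\<^sup>2 = s\<^sup>2 - 4 * b" "r \<ge> 0" using sb by (auto simp: r_def)
  have "r < s" using r sb by (intro power2_less_imp_less[of r s]) auto
  define u v where "u = (s + r) / 2" and "v = (s - r) / 2"
  have uv: "u > 0" "v > 0" "u + v = s" "u * v = b"
    using r \<open>r < s\<close> sb by (auto simp: u_def v_def field_simps power2_eq_square)
  have rr: "real_rooted (euler_op (euler_op f) + smult (s - 1) (euler_op f) + smult b f)"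
    using real_rooted_euler_normal_ordered[OF f uv(1,2)] uv by simp
  have "smult q2 (euler_op (euler_op f)) + smult q1 (euler_op f) + smult q0 f
      = smult q2 (euler_op (euler_op f) + smult (s - 1) (euler_op f) + smult b f)"
    using q by (simp add: s_def b_def smult_add_right field_simps)
  then show ?thesis using rr q unfolding real_rooted_def
    by (auto simp: of_real_poly_smult)
qed

section \<open>Gegenbauer polynomials\<close>

lemma poly_eq_sum_atMost:
  fixes p :: "'a::comm_semiring_1 poly"
  assumes "degree p \<le> n"
  shows "poly p x = (\<Sum>i\<le>n. coeff p i * x ^ i)"
  unfolding poly_altdef using assms
  by (intro sum.mono_neutral_left) (auto simp: coeff_eq_0)

lemma coeff_sum_monom:
  fixes f :: "nat \<Rightarrow> 'a::comm_monoid_add"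
  shows "coeff (\<Sum>j\<le>n. monom (f j) j) i = (if i \<le> n then f i else 0)"
proof -
  have "coeff (\<Sum>j\<le>n. monom (f j) j) i = (\<Sum>j\<le>n. if j = i then f i else 0)"
    unfolding coeff_sum by (intro sum.cong) auto
  then show ?thesis by (simp add: sum.delta)
qed

text \<open>Gauss-Lucas for the real line: the logarithmic derivative cannot vanish in the upper
  half-plane, and the lower one is reduced to it by substituting \<open>- x\<close> for
  \<open>x\<close>.\<close>

lemma real_zeros_pderiv:
  fixes p :: "complex poly"
  assumes "degree p > 0" "\<And>w. poly p w = 0 \<Longrightarrow> Im w = 0" "poly (pderiv p) w = 0"
  shows "Im w = 0"
proof (rule ccontr)
  assume "Im w \<noteq> 0"
  then consider "Im w > 0" | "Im w < 0" by linarith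
  then show False
  proof cases
    case 1
    then show False using Im_logderiv_neg[of p w] assms by auto
  next
    case 2
    define q where "q = pcompose p [:0, -1:]"
    have "degree q > 0" using assms(1) by (simp add: q_def degree_pcompose)
    moreover have "Im v \<le> 0" if "poly q v = 0" for v
      using assms(2)[of "- v"] that by (simp add: q_def poly_pcompose)
    ultimately have "Im (poly (pderiv q) (-w) / poly q (-w)) < 0"
      using 2 by (intro Im_logderiv_neg) auto
    then show False using assms(3)
      by (simp add: q_def pderiv_pcompose poly_pcompose pderiv_pCons)
  qed
qed

lemma real_zeros_higher_pderiv:
  fixes p :: "complex poly"
  assumes "degree p \<ge> j" "p \<noteq> 0" "\<And>w. poly p w = 0 \<Longrightarrow> Im w = 0"
    and "poly ((pderiv ^^ j) p) w = 0"
  shows "Im w = 0"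
  using assms(1,4)
proof (induction j arbitrary: w)
  case 0
  then show ?case using assms(3) by simp
next
  case (Suc j)
  have "degree ((pderiv ^^ j) p) = degree p - j"
    by (rule degree_higher_pderiv)
  then show ?case using Suc
    by (intro real_zeros_pderiv[of "(pderiv ^^ j) p" w]) auto
qed

text \<open>Taylor's formula at \<open>y\<close>. It turns a vanishing derivative into a vanishing
  coefficient of the shifted polynomial, which the binomial theorem computes.\<close>

lemma poly_higher_pderiv:
  fixes p :: "'a::{comm_ring_1,ring_char_0,semiring_no_zero_divisors} poly"
  shows "poly ((pderiv ^^ j) p) y = fact j * coeff (pcompose p [:y, 1:]) j"
proof (induction j arbitrary: p)
  case 0
  then show ?case by (simp add: coeff_pcompose_0)
next
  case (Suc j)
  have "poly ((pderiv ^^ Suc j) p) y = fact j * coeff (pcompose (pderiv p) [:y, 1:]) j"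
    using Suc.IH[of "pderiv p"] by (simp add: funpow_swap1)
  also have "pcompose (pderiv p) [:y, 1:] = pderiv (pcompose p [:y, 1:])"
    by (simp add: pderiv_pcompose pderiv_pCons)
  finally show ?case by (simp add: coeff_pderiv algebra_simps)
qed

text \<open>Expand \<open>(a + t (b + t))^(k + m)\<close>: choosing \<open>a\<close> from
  \<open>i\<close> factors leaves \<open>t^(k + m - i) (b + t)^(k + m - i)\<close>, whose second
  factor must supply \<open>t^(m + i)\<close>. The exponent \<open>k + 2 m\<close> is the order of
  the derivative in Rodrigues' formula.\<close>

lemma coeff_monic_quadratic_power:
  fixes a b :: "'a::comm_ring_1"
  shows "coeff ([:a, b, 1:] ^ (k + m)) (k + 2 * m)
     = (\<Sum>i\<le>k div 2. of_nat ((k + m choose i) * (k + m - i choose m + i)) * a ^ i * b ^ (k - 2 * i))"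
proof -
  let ?n = "k + m"
  have "[:a, b, 1:] = [:a:] + monom 1 1 * [:b, 1:]"
    by (simp add: monom_altdef)
  then have "[:a, b, 1:] ^ ?n = (\<Sum>i\<le>?n. of_nat (?n choose i) * [:a:] ^ i * (monom 1 1 * [:b, 1:]) ^ (?n - i))"
    by (simp only: binomial_ring)
  also have "\<dots> = (\<Sum>i\<le>?n. smult (of_nat (?n choose i) * a ^ i) (monom 1 (?n - i) * [:b, 1:] ^ (?n - i)))"
    by (intro sum.cong refl)
      (simp add: of_nat_poly poly_const_pow power_mult_distrib monom_power mult.assoc mult.commute[of "a ^ _"]
        del: mult_pCons_right)
  finally have "coeff ([:a, b, 1:] ^ ?n) (k + 2 * m)
      = (\<Sum>i\<le>?n. of_nat (?n choose i) * a ^ i * coeff (monom 1 (?n - i) * [:b, 1:] ^ (?n - i)) (k + 2 * m))"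
    by (simp add: coeff_sum)
  also have "\<dots> = (\<Sum>i\<le>?n. of_nat (?n choose i) * a ^ i * coeff ([:b, 1:] ^ (?n - i)) (m + i))"
    by (intro sum.cong refl) (auto simp: coeff_monom_mult algebra_simps)
  also have "\<dots> = (\<Sum>i\<le>k div 2. of_nat (?n choose i) * a ^ i * coeff ([:b, 1:] ^ (?n - i)) (m + i))"
  proof (intro sum.mono_neutral_right ballI)
    fix i assume "i \<in> {..?n} - {..k div 2}"
    then have "?n - i < m + i" by auto
    moreover have "degree ([:b, 1:] ^ (?n - i)) \<le> ?n - i"
      using degree_power_le[of "[:b, 1:]" "?n - i"] by simp
    ultimately show "of_nat (?n choose i) * a ^ i * coeff ([:b, 1:] ^ (?n - i)) (m + i) = 0"
      by (simp add: coeff_eq_0)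
  qed auto
  also have "\<dots> = (\<Sum>i\<le>k div 2. of_nat ((?n choose i) * (?n - i choose m + i)) * a ^ i * b ^ (k - 2 * i))"
  proof (intro sum.cong refl)
    fix i assume i: "i \<in> {..k div 2}"
    then have "?n - i - (m + i) = k - 2 * i" "m + i \<le> ?n - i" by auto
    then show "of_nat (?n choose i) * a ^ i * coeff ([:b, 1:] ^ (?n - i)) (m + i)
      = of_nat ((?n choose i) * (?n - i choose m + i)) * a ^ i * b ^ (k - 2 * i)"
      by (simp add: coeff_linear_poly_power algebra_simps)
  qed
  finally show ?thesis .
qed

text \<open>The derivative of order \<open>k + 2 m\<close> of \<open>(y^2 - 1)^(k + m)\<close> is,
  up to scalars, the \<open>m\<close>-th derivative of a Legendre polynomial of degree
  \<open>k + m\<close>, hence the Gegenbauer polynomial of degree \<open>k\<close> and parameter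
  \<open>m + 1/2\<close>. After removing \<open>y^k\<close> and substituting
  \<open>x = (y^2 - 1) / (4 y^2)\<close>, this polynomial remains.\<close>

definition gegenbauer :: "nat \<Rightarrow> nat \<Rightarrow> real poly" where
  "gegenbauer k m = (\<Sum>i\<le>k div 2. monom (1 / (fact (k - 2 * i) * fact i * fact (m + i))) i)"

lemma coeff_gegenbauer:
  "coeff (gegenbauer k m) i = (if 2 * i \<le> k then 1 / (fact (k - 2 * i) * fact i * fact (m + i)) else 0)"
  unfolding gegenbauer_def coeff_sum_monom by auto

lemma trinomial_fact:
  assumes "2 * i \<le> k"
  shows "real ((k + m choose i) * (k + m - i choose m + i))
     = fact (k + m) / (fact (k - 2 * i) * fact i * fact (m + i))"
proof -
  have "k + m - i - (m + i) = k - 2 * i" using assms by auto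
  then show ?thesis using assms by (simp add: binomial_fact field_simps)
qed

text \<open>
  Rodrigues' formula: with \<open>x = (y\<^sup>2 - 1) / (4 y\<^sup>2)\<close>, the polynomial is up to a factor
  \<open>y\<^sup>k\<close> a derivative of \<open>(y\<^sup>2 - 1)\<^sup>k\<^sup>+\<^sup>m\<close>, so \<open>y\<close> is real.
\<close>

lemma gegenbauer_zeros:
  assumes "poly (map_poly of_real (gegenbauer k m)) (x::complex) = 0"
  shows "Im x = 0 \<and> Re x < 0"
proof -
  have px: "poly (map_poly of_real (gegenbauer k m)) z
     = (\<Sum>i\<le>k div 2. z ^ i / (fact (k - 2 * i) * fact i * fact (m + i)))" for z :: complex
  proof -
    have "degree (gegenbauer k m) \<le> k div 2"
      unfolding gegenbauer_def by (intro degree_sum_le) (auto intro: order.trans[OF degree_monom_le])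
    then have "poly (map_poly of_real (gegenbauer k m)) z
       = (\<Sum>i\<le>k div 2. of_real (coeff (gegenbauer k m) i) * z ^ i)"
      by (subst poly_eq_sum_atMost) (auto simp: coeff_map_poly)
    also have "\<dots> = (\<Sum>i\<le>k div 2. z ^ i / (fact (k - 2 * i) * fact i * fact (m + i)))"
      by (intro sum.cong) (auto simp: coeff_gegenbauer)
    finally show ?thesis .
  qed
  \<comment> \<open>All coefficients are positive. This is used twice: to exclude
    \<open>x = 1/4\<close>, where the substitution degenerates, and at the end to make a real zero
    negative.\<close>
  have pos: "x \<noteq> of_real r" if "r \<ge> 0" for r
  proof
    assume "x = of_real r"
    then have "of_real (\<Sum>i\<le>k div 2. r ^ i / (fact (k - 2 * i) * fact i * fact (m + i))) = (0::complex)"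
      using assms by (simp add: px)
    then have "(\<Sum>i\<le>k div 2. r ^ i / (fact (k - 2 * i) * fact i * fact (m + i))) = 0"
      by (simp only: of_real_eq_0_iff)
    moreover have "(\<Sum>i\<le>k div 2. r ^ i / (fact (k - 2 * i) * fact i * fact (m + i))) > 0"
      using that by (intro sum_pos2[where i = 0]) auto
    ultimately show False by simp
  qed
  have x4: "1 - 4 * x \<noteq> 0"
  proof
    assume "1 - 4 * x = 0"
    then have "x = of_real (1 / 4)" by (simp add: eq_divide_eq mult.commute)
    then show False using pos[of "1/4"] by simp
  qed
  \<comment> \<open>Solves \<open>x = (y^2 - 1) / (4 y^2)\<close> for \<open>y^2\<close>.\<close>
  define y where "y = csqrt (1 / (1 - 4 * x))"
  have y2: "y\<^sup>2 = 1 / (1 - 4 * x)" by (simp add: y_def)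
  have y0: "y \<noteq> 0" using y2 x4 by auto
  have "y\<^sup>2 * (1 - 4 * x) = 1" using y2 x4 by simp
  then have xy: "y\<^sup>2 - 1 = 4 * y\<^sup>2 * x" by (simp add: algebra_simps)
  let ?n = "k + m"
  define g :: "complex poly" where "g = [:-1, 0, 1:] ^ ?n"
  have comp: "pcompose g [:y, 1:] = [:y\<^sup>2 - 1, 2 * y, 1:] ^ ?n"
  proof -
    have "pcompose (p ^ j) q = pcompose p q ^ j" for p q :: "complex poly" and j
      by (induction j) (simp_all add: pcompose_mult pcompose_1)
    then show ?thesis by (simp add: g_def pcompose_pCons power2_eq_square)
  qed
  have "coeff (pcompose g [:y, 1:]) (k + 2 * m)
     = (\<Sum>i\<le>k div 2. of_nat ((?n choose i) * (?n - i choose m + i)) * (y\<^sup>2 - 1) ^ i * (2 * y) ^ (k - 2 * i))"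
    unfolding comp by (rule coeff_monic_quadratic_power)
  also have "\<dots> = (\<Sum>i\<le>k div 2. fact ?n * (2 * y) ^ k * (x ^ i / (fact (k - 2 * i) * fact i * fact (m + i))))"
  proof (intro sum.cong refl)
    fix i assume "i \<in> {..k div 2}"
    then have i: "2 * i \<le> k" by auto
    have "of_nat ((?n choose i) * (?n - i choose m + i))
        = complex_of_real (real ((?n choose i) * (?n - i choose m + i)))" by simp
    also have "\<dots> = fact ?n / (fact (k - 2 * i) * fact i * fact (m + i))"
      unfolding trinomial_fact[OF i] by simp
    finally have 1: "of_nat ((?n choose i) * (?n - i choose m + i))
        = (fact ?n / (fact (k - 2 * i) * fact i * fact (m + i)) :: complex)" .
    have "(y\<^sup>2 - 1) ^ i * (2 * y) ^ (k - 2 * i) = x ^ i * ((2 * y) ^ (2 * i) * (2 * y) ^ (k - 2 * i))"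
      unfolding xy by (simp add: power_mult power_mult_distrib)
    also have "(2 * y) ^ (2 * i) * (2 * y) ^ (k - 2 * i) = (2 * y) ^ k"
      using i by (simp only: power_add[symmetric] le_add_diff_inverse)
    finally show "of_nat ((?n choose i) * (?n - i choose m + i)) * (y\<^sup>2 - 1) ^ i * (2 * y) ^ (k - 2 * i)
       = fact ?n * (2 * y) ^ k * (x ^ i / (fact (k - 2 * i) * fact i * fact (m + i)))"
      unfolding 1 by (simp add: mult.assoc)
  qed
  also have "\<dots> = 0"
    unfolding sum_distrib_left[symmetric] using assms by (simp only: px mult_zero_right)
  finally have "poly ((pderiv ^^ (k + 2 * m)) g) y = 0"
    by (simp add: poly_higher_pderiv)
  moreover have "Im w = 0" if "poly g w = 0" for w
  proof -
    have "w\<^sup>2 = 1" using that by (auto simp: g_def poly_power power2_eq_square algebra_simps)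
    then show ?thesis by (auto simp: power2_eq_1_iff)
  qed
  moreover have "degree g = 2 * ?n"
    unfolding g_def by (subst degree_power_eq) auto
  moreover have "g \<noteq> 0" by (simp add: g_def)
  ultimately have "Im y = 0"
    using real_zeros_higher_pderiv[of "k + 2 * m" g y] by auto
  then obtain r where r: "y = of_real r" by (metis complex_is_Real_iff Reals_cases)
  have r0: "r \<noteq> 0" using y0 r by auto
  have "x = of_real ((r\<^sup>2 - 1) / (4 * r\<^sup>2))"
    using xy r0 unfolding r by (simp add: field_simps)
  then show ?thesis using pos by (metis Im_complex_of_real Re_complex_of_real not_le)
qed

section \<open>The multiplier polynomial\<close>

text \<open>This is \<open>N(\<theta>) f\<close>, since \<open>\<theta>\<close> multiplies the
  coefficient of index \<open>i\<close> by \<open>i\<close>. In coefficient form, composition of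
  operators is visibly multiplication of the multipliers.\<close>

definition scale_poly :: "real poly \<Rightarrow> real poly \<Rightarrow> real poly" where
  "scale_poly N f = (\<Sum>i\<le>degree f. monom (poly N (real i) * coeff f i) i)"

lemma coeff_scale_poly: "coeff (scale_poly N f) i = poly N (real i) * coeff f i"
  unfolding scale_poly_def coeff_sum_monom by (auto simp: coeff_eq_0)

lemma scale_poly_mult: "scale_poly (N * N') f = scale_poly N (scale_poly N' f)"
  by (rule poly_eqI) (simp add: coeff_scale_poly)

lemma real_rooted_scale_poly_prod:
  assumes "real_rooted f" "finite A" "\<And>s. s \<in> A \<Longrightarrow> a s > 0"
  shows "real_rooted (scale_poly (\<Prod>s\<in>A. [:a s, 1:]) f)"
  using assms(2,3)
proof (induction A rule: finite_induct)
  case empty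
  have "scale_poly 1 f = f" by (rule poly_eqI) (simp add: coeff_scale_poly)
  then show ?case using assms(1) by simp
next
  case (insert s A)
  define g where "g = scale_poly (\<Prod>s\<in>A. [:a s, 1:]) f"
  have "scale_poly (\<Prod>s\<in>insert s A. [:a s, 1:]) f = scale_poly [:a s, 1:] g"
    unfolding g_def scale_poly_mult[symmetric] prod.insert[OF insert.hyps] by (rule refl)
  also have "\<dots> = euler_op g + smult (a s) g"
    by (rule poly_eqI) (simp add: coeff_scale_poly algebra_simps)
  finally show ?case
    using real_rooted_euler_add[of g "a s"] insert by (simp add: g_def)
qed

text \<open>The order matters: the factor with \<open>\<alpha>\<close> and \<open>c\<close> acts
  first, on the Gegenbauer polynomial, whose zeros are known to be negative. The other factors only
  ask for a real-rooted argument.\<close>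

lemma real_rooted_scale_gegenbauer:
  assumes N: "N = [:\<alpha>, -c:] * [:q0, q1, q2:] * (\<Prod>s\<in>A. [:a s, 1:])"
    and "\<alpha> > 0" "finite A" "\<And>s. s \<in> A \<Longrightarrow> a s > 0"
    and q: "q0 > 0" "q2 > 0" "q1 + q2 > 0" "(q1 + q2)\<^sup>2 \<ge> 4 * q0 * q2"
  shows "real_rooted (scale_poly N (gegenbauer k m))"
proof -
  define g where "g = scale_poly [:\<alpha>, -c:] (gegenbauer k m)"
  have "g = smult \<alpha> (gegenbauer k m) - smult c (euler_op (gegenbauer k m))"
    by (rule poly_eqI) (simp add: g_def coeff_scale_poly algebra_simps)
  then have g: "real_rooted g"
    using real_rooted_euler_linear[OF gegenbauer_zeros \<open>\<alpha> > 0\<close>] by simp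
  define g' where "g' = scale_poly [:q0, q1, q2:] g"
  have "g' = smult q2 (euler_op (euler_op g)) + smult q1 (euler_op g) + smult q0 g"
    by (rule poly_eqI) (simp add: g'_def coeff_scale_poly algebra_simps)
  then have "real_rooted g'"
    using real_rooted_euler_quadratic[OF g q] by simp
  then have "real_rooted (scale_poly (\<Prod>s\<in>A. [:a s, 1:]) g')"
    by (rule real_rooted_scale_poly_prod) (use assms in auto)
  moreover have "N = (\<Prod>s\<in>A. [:a s, 1:]) * ([:q0, q1, q2:] * [:\<alpha>, -c:])"
    unfolding N by (simp only: mult_ac)
  ultimately show ?thesis by (simp only: scale_poly_mult g'_def g_def)
qed

text \<open>For \<open>s > 0\<close> this is the binomial coefficient \<open>s + k - 1\<close> over
  \<open>k\<close>. At \<open>s = m + 1\<close> it is the quantity that bounds the number of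
  circuit-hyperplanes.\<close>

definition weight :: "nat \<Rightarrow> nat \<Rightarrow> real" where
  "weight k s = pochhammer (real s) k / fact k"

lemma weight_1 [simp]: "weight k (Suc 0) = 1"
  by (simp add: weight_def flip: pochhammer_fact)

lemma weight_pos: "s > 0 \<Longrightarrow> weight k s > 0"
  by (simp add: weight_def pochhammer_pos)

lemma pochhammer_shift: "x * pochhammer (x + 1) k = (x + of_nat k) * pochhammer (x::real) k"
  using pochhammer_rec[of x k] pochhammer_Suc[of x k] by (simp add: mult.commute)

lemma weight_Suc: "s > 0 \<Longrightarrow> weight k (Suc s) = weight k s * (real s + real k) / real s"
  using pochhammer_shift[of "real s" k] by (simp add: weight_def field_simps)

lemma weight_less_Suc:
  assumes "s > 0" "k > 0"
  shows "weight k s < weight k (Suc s)"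
proof -
  have "weight k s * real s < weight k s * (real s + real k)"
    using weight_pos[of s k] assms by (intro mult_strict_left_mono) auto
  then show ?thesis using assms by (simp add: weight_Suc pos_less_divide_eq)
qed

lemma weight_2: "weight k 2 = real k + 1"
  using weight_Suc[of 1 k] by (simp add: numeral_2_eq_2)

text \<open>For positive \<open>x\<close> this is \<open>x (x + 1) ... (x + m)\<close> divided by
  \<open>(s + x - 1) (s + x)\<close>. At \<open>s = 1\<close> the denominator contains
  \<open>x\<close> itself, which cancels the leading factor; hence the case distinction.\<close>

definition numer_term :: "nat \<Rightarrow> nat \<Rightarrow> real poly" where
  "numer_term m s = (if s = 1 then 1 else [:0, 1:]) * (\<Prod>t\<in>{1..m} - {s - 1, s}. [:real t, 1:])"

text \<open>The multiplier \<open>N\<close> of the overview: \<open>gamma_rat k m C\<close>, read as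
  a rational function, times \<open>x (x + 1) ... (x + m)\<close>.\<close>

definition numer_poly :: "nat \<Rightarrow> nat \<Rightarrow> real \<Rightarrow> real poly" where
  "numer_poly k m C = (\<Sum>s\<in>{1..m}. smult (weight k s) (numer_term m s))
     - smult C ([:0, 1:] * (\<Prod>t\<in>{2..m}. [:real t, 1:]))"

lemma poly_numer_term:
  "poly (numer_term m s) x = (if s = 1 then 1 else x) * (\<Prod>t\<in>{1..m} - {s - 1, s}. real t + x)"
  by (simp add: numer_term_def poly_prod)

lemma poly_numer_poly:
  "poly (numer_poly k m C) x = (\<Sum>s\<in>{1..m}. weight k s * poly (numer_term m s) x)
     - C * x * (\<Prod>t\<in>{2..m}. real t + x)"
  by (simp add: numer_poly_def poly_sum poly_prod algebra_simps)

lemma prod_atLeastAtMost_fact: "(\<Prod>t\<in>{1..m}. real t + real i) = fact (m + i) / fact i"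
proof (induction m)
  case (Suc m)
  have "(\<Prod>t\<in>{1..Suc m}. real t + real i) = (fact (m + i) / fact i) * (real (Suc m) + real i)"
    using Suc by simp
  then show ?case by (simp add: algebra_simps)
qed simp

lemma poly_numer_poly_pos:
  assumes "x > 0" "m > 0"
  shows "poly (numer_poly k m C) x = x * (\<Prod>t\<in>{1..m}. real t + x)
      * ((\<Sum>s\<in>{1..m}. weight k s / ((real s + x - 1) * (real s + x))) - C / (x + 1))"
proof -
  let ?P = "\<Prod>t\<in>{1..m}. real t + x"
  have nt: "poly (numer_term m s) x = x * ?P / ((real s + x - 1) * (real s + x))" if s: "s \<in> {1..m}" for s
  proof (cases "s = 1")
    case True
    have "?P = (1 + x) * (\<Prod>t\<in>{1..m} - {1}. real t + x)"
      using assms by (subst prod.remove[of _ 1]) auto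
    moreover have "{1..m} - {0, Suc 0} = {1..m} - {1}" by auto
    ultimately show ?thesis using True assms by (simp add: poly_numer_term)
  next
    case False
    have "?P = (real (s - 1) + x) * (\<Prod>t\<in>{1..m} - {s - 1}. real t + x)"
      using s False by (subst prod.remove[of _ "s - 1"]) auto
    also have "(\<Prod>t\<in>{1..m} - {s - 1}. real t + x)
        = (real s + x) * (\<Prod>t\<in>{1..m} - {s - 1} - {s}. real t + x)"
      using s False by (subst prod.remove[of _ s]) auto
    also have "{1..m} - {s - 1} - {s} = {1..m} - {s - 1, s}" by auto
    finally have "?P = (real s + x - 1) * (real s + x) * (\<Prod>t\<in>{1..m} - {s - 1, s}. real t + x)"
      using s by (simp add: of_nat_diff algebra_simps)
    moreover have "real s + x - 1 > 0" "real s + x > 0" using s assms by auto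
    ultimately show ?thesis using False by (simp add: poly_numer_term)
  qed
  have "?P = (1 + x) * (\<Prod>t\<in>{2..m}. real t + x)"
    using assms by (subst prod.atLeast_Suc_atMost) (auto simp: numeral_2_eq_2)
  then have c: "C * x * (\<Prod>t\<in>{2..m}. real t + x) = x * ?P * (C / (x + 1))"
    using assms by (simp add: field_simps)
  have "(\<Sum>s\<in>{1..m}. weight k s * poly (numer_term m s) x)
     = x * ?P * (\<Sum>s\<in>{1..m}. weight k s / ((real s + x - 1) * (real s + x)))"
    unfolding sum_distrib_left by (intro sum.cong refl) (simp add: nt)
  then show ?thesis unfolding poly_numer_poly c by (simp add: right_diff_distrib)
qed

section \<open>Values of the multiplier polynomial at nonpositive integers\<close>

lemma poly_numer_poly_0:
  assumes "m > 0"
  shows "poly (numer_poly k m C) 0 = fact m"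
proof -
  have "(\<Sum>s\<in>{1..m}. weight k s * poly (numer_term m s) 0)
      = (\<Sum>s\<in>{1..m}. if s = 1 then poly (numer_term m 1) 0 else 0)"
    by (intro sum.cong) (auto simp: poly_numer_term)
  also have "\<dots> = poly (numer_term m 1) 0" using assms by simp
  also have "\<dots> = (\<Prod>t\<in>{1..m} - {1}. real t)"
  proof -
    have "{1..m} - {0, Suc 0} = {1..m} - {1}" by auto
    then show ?thesis by (simp add: poly_numer_term)
  qed
  also have "\<dots> = (\<Prod>t\<in>{1..m}. real t)"
    using assms by (subst (2) prod.remove[of _ 1]) auto
  also have "\<dots> = fact m" by (simp add: fact_prod)
  finally show ?thesis by (simp add: poly_numer_poly)
qed

text \<open>The product next to \<open>C\<close> starts at \<open>t = 2\<close>, so the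
  \<open>C\<close> term survives at \<open>-1\<close>. The sign of the value thus depends on whether
  \<open>C\<close> exceeds \<open>k\<close>, and a zero between \<open>-1\<close> and
  \<open>0\<close> is not guaranteed.\<close>

lemma poly_numer_poly_minus_1:
  assumes "m \<ge> 2"
  shows "poly (numer_poly k m C) (-1) = fact (m - 1) * (C - real k)"
proof -
  have z: "poly (numer_term m s) (-1) = 0" if "s \<in> {1..m}" "s \<noteq> 1" "s \<noteq> 2" for s
  proof -
    have "1 \<in> {1..m} - {s - 1, s}" using that assms by auto
    then show ?thesis unfolding poly_numer_term
      by (subst prod_zero) (auto intro!: bexI[of _ 1])
  qed
  have P: "(\<Prod>t\<in>{2..m}. real t - 1) = fact (m - 1)"
  proof -
    have "(\<Prod>t\<in>{2..m}. real t - 1) = (\<Prod>t\<in>{1..m - 1}. real t)"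
      by (rule prod.reindex_bij_witness[of _ Suc "\<lambda>t. t - 1"]) auto
    then show ?thesis by (simp add: fact_prod)
  qed
  have t1: "poly (numer_term m 1) (-1) = fact (m - 1)"
  proof -
    have "{1..m} - {0, Suc 0} = {2..m}" by auto
    then show ?thesis using P by (simp add: poly_numer_term)
  qed
  have t2: "poly (numer_term m 2) (-1) = - fact (m - 1)"
  proof -
    have "(\<Prod>t\<in>{2..m}. real t - 1) = (\<Prod>t\<in>{2..m} - {2}. real t - 1)"
      using assms by (subst prod.remove[of _ 2]) auto
    moreover have "{2..m} - {2} = {1..m} - {1, 2}" by auto
    ultimately show ?thesis using P by (simp add: poly_numer_term)
  qed
  have "(\<Sum>s\<in>{1..m}. weight k s * poly (numer_term m s) (-1))
      = (\<Sum>s\<in>{1, 2}. weight k s * poly (numer_term m s) (-1))"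
    using assms z by (intro sum.mono_neutral_right) auto
  also have "\<dots> = fact (m - 1) * (1 - (real k + 1))"
    using t1 t2 by (simp add: weight_2 algebra_simps)
  finally show ?thesis using P by (simp add: poly_numer_poly algebra_simps)
qed

text \<open>At \<open>- s\<close> the \<open>C\<close> term vanishes, and only the terms
  \<open>s\<close> and \<open>Suc s\<close> lack the vanishing factor. They enter with opposite
  signs, so the value is a signed product times the difference of two consecutive weights, which is
  positive.\<close>

lemma poly_numer_poly_minus:
  assumes s: "2 \<le> s" "s < m" and "k > 0"
  shows "(-1) ^ s * poly (numer_poly k m C) (- real s) > 0"
proof -
  let ?x = "- real s"
  define Q where "Q = (\<Prod>t\<in>{1..m} - {s}. real t + ?x)"
  have z: "poly (numer_term m r) ?x = 0" if "r \<in> {1..m}" "r \<noteq> s" "r \<noteq> Suc s" for r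
  proof -
    have "s \<in> {1..m} - {r - 1, r}" using that s by auto
    then show ?thesis unfolding poly_numer_term
      by (subst prod_zero) (auto intro!: bexI[of _ s])
  qed
  have t1: "poly (numer_term m s) ?x = real s * Q"
  proof -
    have "Q = (real (s - 1) + ?x) * (\<Prod>t\<in>{1..m} - {s} - {s - 1}. real t + ?x)"
      unfolding Q_def using s by (subst prod.remove[of _ "s - 1"]) auto
    moreover have "{1..m} - {s} - {s - 1} = {1..m} - {s - 1, s}" by auto
    ultimately have "Q = - (\<Prod>t\<in>{1..m} - {s - 1, s}. real t + ?x)"
      using s by (simp add: of_nat_diff)
    then show ?thesis using s by (simp add: poly_numer_term)
  qed
  have t2: "poly (numer_term m (Suc s)) ?x = - real s * Q"
  proof -
    have "Q = (real (Suc s) + ?x) * (\<Prod>t\<in>{1..m} - {s} - {Suc s}. real t + ?x)"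
      unfolding Q_def using s by (subst prod.remove[of _ "Suc s"]) auto
    moreover have "{1..m} - {s} - {Suc s} = {1..m} - {s, Suc s}" by auto
    ultimately show ?thesis using s by (simp add: poly_numer_term)
  qed
  have "(\<Sum>r\<in>{1..m}. weight k r * poly (numer_term m r) ?x)
      = (\<Sum>r\<in>{s, Suc s}. weight k r * poly (numer_term m r) ?x)"
    using s z by (intro sum.mono_neutral_right) auto
  also have "\<dots> = - real s * Q * (weight k (Suc s) - weight k s)"
    using t1 t2 by (simp add: algebra_simps)
  finally have N: "poly (numer_poly k m C) ?x = - real s * Q * (weight k (Suc s) - weight k s)"
    using s prod_zero[of "{2..m}" "\<lambda>t. real t + ?x"] by (auto simp: poly_numer_poly)
  have "Q = (\<Prod>t\<in>{1..<s}. real t + ?x) * (\<Prod>t\<in>{s<..m}. real t + ?x)"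
    unfolding Q_def using s by (subst prod.union_disjoint[symmetric]) (auto intro!: prod.cong)
  also have "(\<Prod>t\<in>{1..<s}. real t + ?x) = (\<Prod>t\<in>{1..<s}. (-1) * (real s - real t))"
    by (intro prod.cong) auto
  also have "\<dots> = (-1) ^ (s - 1) * (\<Prod>t\<in>{1..<s}. real s - real t)"
    by (subst prod.distrib) simp
  finally have "(-1) ^ s * poly (numer_poly k m C) ?x
    = ((-1) ^ s * (-1) ^ (s - 1) * (-1)) * (real s * (\<Prod>t\<in>{1..<s}. real s - real t) * (\<Prod>t\<in>{s<..m}. real t + ?x)
        * (weight k (Suc s) - weight k s))"
    unfolding N by (simp only: mult_ac)
  moreover have "(-1) ^ s * (-1) ^ (s - 1) * (-1) = (1::real)"
    using s by (cases s) (auto simp flip: power_add)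
  moreover have "real s * (\<Prod>t\<in>{1..<s}. real s - real t) * (\<Prod>t\<in>{s<..m}. real t + ?x)
        * (weight k (Suc s) - weight k s) > 0"
    using s assms weight_less_Suc[of s k]
    by (intro mult_pos_pos prod_pos) auto
  ultimately show ?thesis by simp
qed

section \<open>Locating the zeros and factoring the multiplier polynomial\<close>

lemma prod_linear_dvd:
  fixes p :: "'a::idom poly"
  assumes "finite A" "inj_on a A" "\<And>s. s \<in> A \<Longrightarrow> poly p (- a s) = 0"
  shows "(\<Prod>s\<in>A. [:a s, 1:]) dvd p"
  using assms
proof (induction A rule: finite_induct)
  case (insert s A)
  then obtain q where q: "p = (\<Prod>s\<in>A. [:a s, 1:]) * q" by (auto elim: dvdE)
  have "poly p (- a s) = 0" using insert by auto
  moreover have "a t \<noteq> a s" if "t \<in> A" for t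
    using insert.hyps insert.prems that by (auto simp: inj_on_def)
  then have "(\<Prod>t\<in>A. a t + - a s) \<noteq> 0"
    using insert.hyps by (simp add: prod_zero_iff)
  ultimately have "poly q (- a s) = 0" unfolding q by (simp add: poly_prod)
  then have "[:a s, 1:] dvd q" using poly_eq_0_iff_dvd[of q "- a s"] by simp
  then have "[:a s, 1:] * (\<Prod>s\<in>A. [:a s, 1:]) dvd p"
    unfolding q by (metis mult.commute mult_dvd_mono dvd_refl)
  then show ?case unfolding prod.insert[OF insert.hyps(1,2)] .
qed simp

lemma degree_prod_linear: "finite A \<Longrightarrow> degree (\<Prod>s\<in>A. [:a s, 1::real:]) = card A"
  by (subst degree_prod_eq_sum_degree) auto

lemma lead_coeff_prod_linear: "lead_coeff (\<Prod>s\<in>A. [:a s, 1::real:]) = 1"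
  by (simp add: lead_coeff_prod)

lemma numer_term_monic:
  assumes "s \<in> {1..m}"
  shows "degree (numer_term m s) = m - 1" "coeff (numer_term m s) (m - 1) = 1"
proof -
  have nz: "(\<Prod>t\<in>A. [:real t, 1:]) \<noteq> 0" for A
    using lead_coeff_prod_linear[of real A] by auto
  have "degree (numer_term m s) = m - 1 \<and> lead_coeff (numer_term m s) = 1"
  proof (cases "s = 1")
    case True
    have "{1..m} - {0, Suc 0} = {1..m} - {1}" by auto
    then have "card ({1..m} - {0, Suc 0}) = m - 1" using assms by simp
    then have "degree (\<Prod>t\<in>{1..m} - {0, Suc 0}. [:real t, 1:]) = m - 1"
      by (subst degree_prod_linear) auto
    then show ?thesis using True lead_coeff_prod_linear[of real "{1..m} - {0, Suc 0}"]
      by (simp only: numer_term_def) simp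
  next
    case False
    have "card ({1..m} - {s - 1, s}) = card {1..m} - card {s - 1, s}"
      using assms False by (intro card_Diff_subset) auto
    also have "card {s - 1, s} = 2" using assms by (cases s) auto
    finally have "card ({1..m} - {s - 1, s}) = m - 2" by simp
    moreover have "m \<ge> 2" using assms False by auto
    ultimately have "degree (numer_term m s) = m - 1"
      using False nz by (simp add: numer_term_def degree_mult_eq degree_prod_linear del: mult_pCons_left)
    moreover have "lead_coeff (numer_term m s) = 1"
      using False by (simp add: numer_term_def lead_coeff_mult lead_coeff_prod_linear del: mult_pCons_left)
    ultimately show ?thesis by blast
  qed
  then show "degree (numer_term m s) = m - 1" "coeff (numer_term m s) (m - 1) = 1" by auto
qed

lemma degree_numer_sum: "degree (\<Sum>s\<in>{1..m}. smult (weight k s) (numer_term m s)) \<le> m - 1"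
  using numer_term_monic(1)
  by (intro degree_sum_le) (auto intro: order.trans[OF degree_smult_le])

lemma lead_coeff_numer_poly:
  assumes "m > 0" "C \<noteq> 0"
  shows "degree (numer_poly k m C) = m" "coeff (numer_poly k m C) m = - C"
proof -
  let ?T = "[:0, 1:] * (\<Prod>t\<in>{2..m}. [:real t, 1:])"
  have nz: "(\<Prod>t\<in>A. [:real t, 1:]) \<noteq> 0" for A
    using lead_coeff_prod_linear[of real A] by auto
  have T: "degree ?T = m"
    using assms nz by (simp add: degree_mult_eq degree_prod_linear del: mult_pCons_left)
  have "lead_coeff ?T = 1"
    by (simp add: lead_coeff_mult lead_coeff_prod_linear del: mult_pCons_left)
  then have cT: "coeff ?T m = 1" by (simp only: T)
  have S: "coeff (\<Sum>s\<in>{1..m}. smult (weight k s) (numer_term m s)) m = 0"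
    using degree_numer_sum[of k m] assms by (intro coeff_eq_0) auto
  show c: "coeff (numer_poly k m C) m = - C"
    using S cT by (simp add: numer_poly_def del: mult_pCons_left)
  have "degree (numer_poly k m C) \<le> m"
    unfolding numer_poly_def using degree_numer_sum[of k m] T
    by (intro degree_diff_le) (auto intro: order.trans[OF degree_smult_le] simp del: mult_pCons_left)
  moreover have "degree (numer_poly k m C) \<ge> m" using c assms by (intro le_degree) auto
  ultimately show "degree (numer_poly k m C) = m" by simp
qed

lemma lead_coeff_numer_poly_0:
  assumes "m > 0"
  shows "degree (numer_poly k m 0) = m - 1" "coeff (numer_poly k m 0) (m - 1) > 0"
proof -
  have "coeff (numer_poly k m 0) (m - 1) = (\<Sum>s\<in>{1..m}. weight k s * 1)"
    unfolding numer_poly_def using numer_term_monic(2)[of _ m] by (simp add: coeff_sum)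
  also have "\<dots> > 0" using assms weight_pos by (intro sum_pos) auto
  finally show c: "coeff (numer_poly k m 0) (m - 1) > 0" .
  then have "degree (numer_poly k m 0) \<ge> m - 1" by (intro le_degree) auto
  then show "degree (numer_poly k m 0) = m - 1"
    using degree_numer_sum[of k m] by (simp add: numer_poly_def)
qed

lemma poly_root_ge:
  fixes Q :: "real poly"
  assumes "lead_coeff Q < 0" "poly Q h \<ge> 0"
  obtains r where "r \<ge> h" "poly Q r = 0"
proof (cases "poly Q h = 0")
  case False
  have "lead_coeff (- Q) > 0" using assms by simp
  then obtain n where n: "\<And>x. x \<ge> n \<Longrightarrow> poly (- Q) x \<ge> lead_coeff (- Q)"
    using poly_pinfty_gt_lc by blast
  define b where "b = max (h + 1) n"
  have "h < b" by (simp add: b_def)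
  have "poly Q b < 0" using n[of b] assms(1) by (auto simp: b_def)
  then obtain r where "h < r" "poly Q r = 0"
    using poly_IVT_neg[of h b Q] \<open>h < b\<close> False assms(2) by auto
  then show ?thesis using that[of r] by simp
qed (use that in auto)

lemma degree_2_poly:
  fixes q :: "real poly"
  assumes "degree q \<le> 2"
  shows "q = [:coeff q 0, coeff q 1, coeff q 2:]"
  using assms by (intro poly_eqI) (auto simp: coeff_pCons coeff_eq_0 numeral_2_eq_2 split: nat.splits)

text \<open>Degree count for \<open>C > 0\<close>: the alternating signs give \<open>m - 3\<close>
  zeros, the negative leading coefficient together with the value at \<open>h\<close> gives one zero
  in \<open>[h, \<infinity>)\<close>, and a quadratic is left over. Writing its position as
  \<open>\<alpha> \<ge> C * h\<close> instead of \<open>\<alpha> / C \<ge> h\<close> covers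
  \<open>C = 0\<close> too.\<close>

lemma numer_poly_factor:
  assumes m: "m \<ge> 3" and k: "k > 0" and C: "C \<ge> 0"
    and h: "h > 0" "poly (numer_poly k m C) h \<ge> 0"
  obtains a \<alpha> q0 q1 q2 where
    "\<And>s. s \<in> {2..m - 2} \<Longrightarrow> real s < a s \<and> a s < real (Suc s)"
    "\<alpha> > 0" "\<alpha> \<ge> C * h" "q2 > 0"
    "numer_poly k m C = [:\<alpha>, -C:] * [:q0, q1, q2:] * (\<Prod>s\<in>{2..m - 2}. [:a s, 1:])"
proof -
  let ?N = "numer_poly k m C"
  have "\<exists>a. real s < a \<and> a < real (Suc s) \<and> poly ?N (- a) = 0" if s: "s \<in> {2..m - 2}" for s
  proof -
    have s': "2 \<le> s" "s < m" "2 \<le> Suc s" "Suc s < m" using s m by auto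
    have "(-1) ^ s * poly ?N (- real s) * ((-1) ^ Suc s * poly ?N (- real (Suc s))) > 0"
      using s' k by (intro mult_pos_pos poly_numer_poly_minus) auto
    then have "((-1) ^ s * (-1) ^ Suc s) * (poly ?N (- real (Suc s)) * poly ?N (- real s)) > 0"
      by (simp only: mult_ac)
    moreover have "(-1) ^ s * (-1) ^ Suc s = (-1 :: real)"
      by (simp flip: power_add mult_2)
    ultimately have "poly ?N (- real (Suc s)) * poly ?N (- real s) < 0" by simp
    then obtain x where "- real (Suc s) < x" "x < - real s" "poly ?N x = 0"
      using poly_IVT[of "- real (Suc s)" "- real s" ?N] by auto
    then show ?thesis by (intro exI[of _ "- x"]) auto
  qed
  then obtain a where a: "\<And>s. s \<in> {2..m - 2} \<Longrightarrow> real s < a s \<and> a s < real (Suc s) \<and> poly ?N (- a s) = 0"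
    by metis
  have inj: "inj_on a {2..m - 2}"
  proof (rule inj_onI)
    fix s t assume "s \<in> {2..m - 2}" "t \<in> {2..m - 2}" "a s = a t"
    then have "real s < real (Suc t)" "real t < real (Suc s)"
      using a[of s] a[of t] by auto
    then show "s = t" by simp
  qed
  define P where "P = (\<Prod>s\<in>{2..m - 2}. [:a s, 1:])"
  have "P dvd ?N" unfolding P_def using inj a by (intro prod_linear_dvd) auto
  then obtain Q where Q: "?N = P * Q" by (elim dvdE)
  have lP: "lead_coeff P = 1" "degree P = m - 3"
    unfolding P_def using m by (simp_all only: lead_coeff_prod_linear) (simp add: degree_prod_linear)
  have P0: "P \<noteq> 0" using lP by auto
  have lQ: "lead_coeff Q = lead_coeff ?N" using lP by (simp add: Q lead_coeff_mult)
  have Ph: "poly P h > 0"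
    unfolding P_def poly_prod using a h by (intro prod_pos) (force simp: add_pos_pos)
  have Q0: "Q \<noteq> 0"
    using Q lead_coeff_numer_poly[of m C k] lead_coeff_numer_poly_0[of m k] m by (cases "C = 0") auto
  have degQ: "degree Q + (m - 3) = degree ?N"
    using P0 Q0 lP by (simp add: Q degree_mult_eq)
  show ?thesis
  proof (cases "C = 0")
    case True
    \<comment> \<open>For \<open>C = 0\<close> the degree drops by one: the zero on the right has
      escaped to infinity and its factor becomes the constant 1.\<close>
    have "degree Q = 2" using degQ True lead_coeff_numer_poly_0(1)[of m k] m by auto
    moreover have "lead_coeff Q > 0"
      unfolding lQ True using lead_coeff_numer_poly_0[of m k] m by simp
    ultimately have "degree Q = 2" "coeff Q 2 > 0" by auto
    then show ?thesis
      using that[of a 1 "coeff Q 2" "coeff Q 0" "coeff Q 1"] a degree_2_poly[of Q] True Q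
      by (auto simp: P_def mult.commute simp del: mult_pCons_left mult_pCons_right)
  next
    case False
    then have C': "C > 0" using C by simp
    have d: "degree Q = 3" and l: "lead_coeff Q = - C"
      using degQ lQ False lead_coeff_numer_poly[of m C k] m by auto
    have "poly Q h \<ge> 0" using h(2) Ph by (simp add: Q zero_le_mult_iff)
    then obtain r where r: "r \<ge> h" "poly Q r = 0"
      using poly_root_ge[of Q h] l C' by auto
    then obtain q where q: "Q = [:-r, 1:] * q" by (metis dvdE poly_eq_0_iff_dvd)
    have q0: "q \<noteq> 0" using q Q0 by auto
    have dq: "degree q = 2" using d q0 by (simp add: q degree_mult_eq del: mult_pCons_left)
    have lq: "coeff q 2 = - C"
      using l dq unfolding q lead_coeff_mult by simp
    define q' where "q' = smult (- 1 / C) q"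
    have q': "degree q' = 2" "coeff q' 2 = 1"
      using dq lq C' by (auto simp: q'_def)
    have "Q = [:C * r, -C:] * q'"
    proof -
      have "[:C * r, -C:] = smult (- C) [:-r, 1:]" by simp
      then show ?thesis unfolding q q'_def using C'
        by (simp del: mult_pCons_left smult_pCons)
    qed
    then have "?N = [:C * r, -C:] * [:coeff q' 0, coeff q' 1, coeff q' 2:] * P"
      using degree_2_poly[of q'] q' Q by (simp only: mult.commute[of P] order.refl)
    moreover have "C * r > 0" "C * r \<ge> C * h" using r h C' by auto
    ultimately show ?thesis
      using that[of a "C * r" "coeff q' 2" "coeff q' 0" "coeff q' 1"] a q' by (simp add: P_def)
  qed
qed

section \<open>Positivity of the coefficients\<close>

text \<open>The difference of the two sides is a concave quadratic in \<open>s\<close>, so its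
  values at \<open>s = 1\<close> and \<open>s = k\<close> decide. The identities below are the
  interpolation formula between these endpoints, with the last summand carrying the
  concavity.\<close>

lemma gamma_increment_small:
  fixes k h s :: nat
  assumes "h = k div 2" "k \<ge> 2" "1 \<le> s" "s \<le> k"
  shows "2 * (real s + real h - 1) * (real s + real h) \<le> (real h + 1) * (real k + 1) * real s"
proof -
  define H S where "H = real h" and "S = real s"
  have H1: "H \<ge> 1" using assms by (auto simp: H_def)
  \<comment> \<open>Integrality enters here: for even \<open>k\<close> the endpoint value at
    \<open>s = k\<close> is \<open>4 H (H - 1) (H - 2)\<close>.\<close>
  have "h = 1 \<or> h \<ge> 2" using assms by auto
  then have H12: "(H - 1) * (H - 2) \<ge> 0" by (auto simp: H_def)
  have S1: "S \<ge> 1" using assms by (simp add: S_def)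
  show ?thesis
  proof (cases "even k")
    case True
    then have k: "real k = 2 * H" using assms by (auto simp: H_def elim!: evenE)
    have S2: "S \<le> 2 * H" using assms k by (simp add: S_def)
    have "(2 * H - 1) * ((H + 1) * (2 * H + 1) * S - 2 * (S + H - 1) * (S + H))
        = (2 * H - S) * (H + 1) + (S - 1) * (4 * H * ((H - 1) * (H - 2))) + 2 * ((S - 1) * (2 * H - S)) * (2 * H - 1)"
      by (simp add: algebra_simps)
    also have "\<dots> \<ge> 0"
    proof -
      have "(S - 1) * (4 * H * ((H - 1) * (H - 2))) \<ge> 0"
        using H1 S1 by (intro mult_nonneg_nonneg[OF _ mult_nonneg_nonneg[OF _ H12]]) auto
      moreover have "(2 * H - S) * (H + 1) \<ge> 0" "2 * ((S - 1) * (2 * H - S)) * (2 * H - 1) \<ge> 0"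
        using H1 S1 S2 by simp_all
      ultimately show ?thesis by linarith
    qed
    finally have "(H + 1) * (2 * H + 1) * S - 2 * (S + H - 1) * (S + H) \<ge> 0"
      using H1 by (simp add: zero_le_mult_iff)
    then show ?thesis by (simp add: k flip: H_def S_def)
  next
    case False
    then have k: "real k = 2 * H + 1" using assms by (auto simp: H_def elim!: oddE)
    have S2: "S \<le> 2 * H + 1" using assms k by (simp add: S_def)
    have "(H - 1) * (2 * H\<^sup>2 - 2 * H - 1) = 2 * H * ((H - 1) * (H - 2)) + (H - 1) * (2 * H - 1)"
      by (simp add: algebra_simps power2_eq_square)
    also have "\<dots> \<ge> 0"
    proof -
      have "2 * H * ((H - 1) * (H - 2)) \<ge> 0" using H1 H12 by (intro mult_nonneg_nonneg[OF _ H12]) auto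
      moreover have "(H - 1) * (2 * H - 1) \<ge> 0" using H1 by simp
      ultimately show ?thesis by linarith
    qed
    finally have H3: "(H - 1) * (2 * H\<^sup>2 - 2 * H - 1) \<ge> 0" .
    have "H * ((H + 1) * (2 * H + 2) * S - 2 * (S + H - 1) * (S + H))
        = (2 * H + 1 - S) * (H + 1) + (S - 1) * ((H - 1) * (2 * H\<^sup>2 - 2 * H - 1)) + 2 * ((S - 1) * (2 * H + 1 - S)) * H"
      by (simp add: algebra_simps power2_eq_square)
    also have "\<dots> \<ge> 0"
    proof -
      have "(S - 1) * ((H - 1) * (2 * H\<^sup>2 - 2 * H - 1)) \<ge> 0"
        using S1 by (intro mult_nonneg_nonneg[OF _ H3]) auto
      moreover have "(2 * H + 1 - S) * (H + 1) \<ge> 0" "2 * ((S - 1) * (2 * H + 1 - S)) * H \<ge> 0"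
        using H1 S1 S2 by simp_all
      ultimately show ?thesis by linarith
    qed
    finally have "(H + 1) * (2 * H + 2) * S - 2 * (S + H - 1) * (S + H) \<ge> 0"
      using H1 by (simp add: zero_le_mult_iff)
    then show ?thesis by (simp add: k algebra_simps flip: H_def S_def)
  qed
qed

text \<open>After writing \<open>h = 1 + J\<close> and \<open>s = k + T\<close>, the difference of
  the two sides is a polynomial in \<open>J\<close> and \<open>T\<close> with nonnegative
  coefficients, for either parity of \<open>k\<close>.\<close>

lemma gamma_increment_large:
  fixes k h s :: nat
  assumes "h = k div 2" "k \<ge> 2" "k \<le> s"
  shows "2 * (real k - 1) * (real s + real h - 1) * (real s + real h)
     \<le> real k * (real h + 1) * real s * (real s + 1)"
proof -
  obtain t where s: "s = k + t" using assms(3) le_Suc_ex by blast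
  have "h \<ge> 1" using assms by auto
  then obtain j where h: "h = Suc j" using that[of "h - 1"] by simp
  define J T where "J = real j" and "T = real t"
  have JT: "J \<ge> 0" "T \<ge> 0" by (auto simp: J_def T_def)
  have H: "real h = 1 + J" by (simp add: h J_def)
  have mono: "J * T \<ge> 0" "J^2 \<ge> 0" "J^3 \<ge> 0" "J^4 \<ge> 0" "T^2 \<ge> 0" "J^2 * T \<ge> 0" "J^3 * T \<ge> 0" "J * T^2 \<ge> 0" "J^2 * T^2 \<ge> 0"
    using JT by auto
  have "0 \<le> real k * (real h + 1) * real s * (real s + 1) - 2 * (real k - 1) * (real s + real h - 1) * (real s + real h)"
  proof (cases "even k")
    case True
    then have k: "real k = 2 * (1 + J)" using assms H by (auto elim!: evenE)
    have S: "real s = 2 * (1 + J) + T" by (simp add: s k T_def)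
    show ?thesis unfolding k S H
      using JT mono by (simp add: algebra_simps power2_eq_square power3_eq_cube power4_eq_xxxx)
  next
    case False
    then have k: "real k = 2 * (1 + J) + 1" using assms H by (auto elim!: oddE)
    have S: "real s = 2 * (1 + J) + 1 + T" by (simp add: s k T_def)
    show ?thesis unfolding k S H
      using JT mono by (simp add: algebra_simps power2_eq_square power3_eq_cube power4_eq_xxxx)
  qed
  then show ?thesis by simp
qed

lemma weight_binomial: "weight k (Suc s) = real (s + k choose k)"
proof -
  have "weight k (Suc s) = ((real s + real k) gchoose k)"
    by (simp add: weight_def gbinomial_pochhammer' add.commute)
  also have "\<dots> = real (s + k choose k)"
    by (simp add: binomial_gbinomial)
  finally show ?thesis .
qed

text \<open>
  Gives the nonnegativity of the leading coefficient of the gamma polynomial. For \<open>s \<le> k\<close> the sum grows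
  faster than the bound \<open>\<lambda> \<le> C(m + k, k) / (k + 1)\<close>, afterwards faster than \<open>\<lambda> \<le> C(m + k, k) / (m + 1)\<close>.
\<close>

lemma weight_sum_bound_small:
  assumes h: "h = k div 2" and k: "k \<ge> 2" and m: "1 \<le> m" "m \<le> k"
  shows "2 * weight k (Suc m) / (real k * (real h + 1) * (real k + 1))
      \<le> (\<Sum>s\<in>{1..m}. weight k s / ((real s + real h - 1) * (real s + real h)))"
  using m
proof (induction m rule: dec_induct)
  case base
  have "h \<ge> 1" "2 * h \<le> k" using h k by auto
  then have "2 * real h \<le> real k" by linarith
  then have "2 / (real k * (real h + 1)) \<le> 1 / (real h * (real h + 1))"
    using \<open>h \<ge> 1\<close> mult_right_mono[of "2 * real h" "real k" "real h + 1"] k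
    by (simp add: divide_le_eq pos_le_divide_eq mult.assoc)
  moreover have w2: "weight k (Suc 1) = real k + 1" using weight_2[of k] by (simp add: numeral_2_eq_2)
  have "2 * weight k (Suc 1) / (real k * (real h + 1) * (real k + 1)) = 2 / (real k * (real h + 1))"
    unfolding w2 by (rule mult_divide_mult_cancel_right) simp
  ultimately show ?case by (simp add: add.commute)
next
  case (step m)
  let ?c = "2 / (real k * (real h + 1) * (real k + 1))"
  let ?s = "real (Suc m)"
  have h1: "h \<ge> 1" using h k by auto
  have w: "weight k (Suc (Suc m)) = weight k (Suc m) + weight k (Suc m) * real k / ?s"
    using weight_Suc[of "Suc m" k] by (simp add: field_simps)
  have inc: "?c * (weight k (Suc m) * real k / ?s) \<le> weight k (Suc m) / ((?s + real h - 1) * (?s + real h))"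
  proof -
    have le: "2 * (?s + real h - 1) * (?s + real h) \<le> (real h + 1) * (real k + 1) * ?s"
      using step h k by (intro gamma_increment_small) auto
    have pos: "(?s + real h - 1) * (?s + real h) > 0" using h1 by simp
    have "2 / ((real h + 1) * (real k + 1) * ?s) \<le> 1 / ((?s + real h - 1) * (?s + real h))"
      using le pos by (simp only: divide_le_eq pos_le_divide_eq times_divide_eq_left mult.assoc mult_1 if_True) simp
    then have "weight k (Suc m) * (2 / ((real h + 1) * (real k + 1) * ?s))
        \<le> weight k (Suc m) * (1 / ((?s + real h - 1) * (?s + real h)))"
      using weight_pos[of "Suc m" k] by (intro mult_left_mono) auto
    moreover have "?c * (weight k (Suc m) * real k / ?s) = weight k (Suc m) * (2 / ((real h + 1) * (real k + 1) * ?s))"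
      using k by simp
    ultimately show ?thesis by simp
  qed
  have "2 * weight k (Suc (Suc m)) / (real k * (real h + 1) * (real k + 1))
     = 2 * weight k (Suc m) / (real k * (real h + 1) * (real k + 1)) + ?c * (weight k (Suc m) * real k / ?s)"
    unfolding w by (simp add: add_divide_distrib ring_distribs)
  then show ?case using step inc by simp
qed

lemma weight_sum_bound_large:
  assumes h: "h = k div 2" and k: "k \<ge> 2" and m: "k \<le> m"
  shows "2 * weight k (Suc m) / (real k * (real h + 1) * (real m + 1))
      \<le> (\<Sum>s\<in>{1..m}. weight k s / ((real s + real h - 1) * (real s + real h)))"
  using m
proof (induction m rule: dec_induct)
  case base
  \<comment> \<open>At \<open>m = k\<close> the two bounds coincide, so the small range supplies the
    base case.\<close>
  show ?case using weight_sum_bound_small[OF h k, of k] k by simp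
next
  case (step m)
  let ?c = "2 / (real k * (real h + 1))"
  let ?s = "real (Suc m)"
  have h1: "h \<ge> 1" using h k by auto
  have w: "weight k (Suc (Suc m)) / (?s + 1) = weight k (Suc m) / ?s + weight k (Suc m) * (real k - 1) / (?s * (?s + 1))"
    using weight_Suc[of "Suc m" k] by (simp add: divide_simps) (simp add: algebra_simps)
  have inc: "?c * (weight k (Suc m) * (real k - 1) / (?s * (?s + 1))) \<le> weight k (Suc m) / ((?s + real h - 1) * (?s + real h))"
  proof -
    have le: "2 * (real k - 1) * (?s + real h - 1) * (?s + real h) \<le> real k * (real h + 1) * ?s * (?s + 1)"
      using step h k by (intro gamma_increment_large) auto
    have pos: "(?s + real h - 1) * (?s + real h) > 0" "real k * (real h + 1) * ?s * (?s + 1) > 0"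
      using h1 k by simp_all
    have "2 * (real k - 1) / (real k * (real h + 1) * ?s * (?s + 1)) \<le> 1 / ((?s + real h - 1) * (?s + real h))"
      using le pos by (simp only: divide_le_eq pos_le_divide_eq times_divide_eq_left mult.assoc mult_1 if_True)
    then have "weight k (Suc m) * (2 * (real k - 1) / (real k * (real h + 1) * ?s * (?s + 1)))
        \<le> weight k (Suc m) * (1 / ((?s + real h - 1) * (?s + real h)))"
      using weight_pos[of "Suc m" k] by (intro mult_left_mono) auto
    moreover have "?c * (weight k (Suc m) * (real k - 1) / (?s * (?s + 1)))
        = weight k (Suc m) * (2 * (real k - 1) / (real k * (real h + 1) * ?s * (?s + 1)))"
      by (simp add: mult_ac)
    ultimately show ?thesis by simp
  qed
  have "2 * weight k (Suc (Suc m)) / (real k * (real h + 1) * (real (Suc m) + 1)) = ?c * (weight k (Suc (Suc m)) / (?s + 1))"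
    by simp
  also have "\<dots> = 2 * weight k (Suc m) / (real k * (real h + 1) * (real m + 1))
      + ?c * (weight k (Suc m) * (real k - 1) / (?s * (?s + 1)))"
    unfolding w by (simp add: ring_distribs add.commute)
  finally show ?case using step inc by simp
qed

text \<open>This says \<open>gamma_rat k m (2 * l / k) h \<ge> 0\<close> at the top index
  \<open>h = k div 2\<close>. It makes \<open>N(h)\<close> nonnegative, which places a zero of
  \<open>N\<close> at or beyond \<open>h\<close>.\<close>

lemma weight_sum_ge:
  assumes h: "h = k div 2" and k: "k \<ge> 2" and m: "m \<ge> 1"
    and l: "l * (real m + 1) \<le> weight k (Suc m)" "l * (real k + 1) \<le> weight k (Suc m)"
  shows "(2 * l / real k) / (real h + 1) \<le> (\<Sum>s\<in>{1..m}. weight k s / ((real s + real h - 1) * (real s + real h)))"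
proof (cases "m \<le> k")
  case True
  have "l \<le> weight k (Suc m) / (real k + 1)" using l by (simp add: pos_le_divide_eq)
  then have "2 / (real k * (real h + 1)) * l \<le> 2 / (real k * (real h + 1)) * (weight k (Suc m) / (real k + 1))"
    by (intro mult_left_mono) auto
  then show ?thesis using weight_sum_bound_small[OF h k m True] by simp
next
  case False
  have "l \<le> weight k (Suc m) / (real m + 1)" using l by (simp add: pos_le_divide_eq)
  then have "2 / (real k * (real h + 1)) * l \<le> 2 / (real k * (real h + 1)) * (weight k (Suc m) / (real m + 1))"
    by (intro mult_left_mono) auto
  then show ?thesis using weight_sum_bound_large[OF h k, of m] False by simp
qed

section \<open>Inequalities for the quadratic factor\<close>

text \<open>
  With \<open>C = 2 \<lambda> / k\<close>, the quadratic factor \<open>q\<close> of the multiplier polynomial satisfies \<open>q(1) / q(0) \<ge> Y\<close>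
  and \<open>q(-1) / q(0) \<le> C - k\<close>. The conclusion of the following estimates is the resulting
  condition on \<open>q\<close>; the case distinction only reflects how fast binomial coefficients grow.
\<close>

lemma square_cond_mono:
  fixes Y Y' C C' k :: real
  assumes "Y' \<ge> 2" "(Y' - 2)\<^sup>2 + 1 \<ge> 2 * (C' - k)" "Y \<ge> Y'" "C \<le> C'"
  shows "Y \<ge> 2 \<and> (Y - 2)\<^sup>2 + 1 \<ge> 2 * (C - k)"
proof -
  have "(Y' - 2)\<^sup>2 \<le> (Y - 2)\<^sup>2" using assms by (intro power_mono) auto
  moreover have "2 * (C - k) \<le> 2 * (C' - k)" using assms by simp
  ultimately have "(Y - 2)\<^sup>2 + 1 \<ge> 2 * (C - k)" using assms(2) by simp
  then show ?thesis using assms by simp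
qed

section \<open>Monotonicity and explicit values of the weights\<close>

lemma weight_Suc_mono:
  assumes "k > 0" "s \<le> t"
  shows "weight k (Suc s) \<le> weight k (Suc t)"
  using assms(2)
proof (induction t rule: dec_induct)
  case (step t)
  then show ?case using weight_less_Suc[of "Suc t" k] assms(1) by auto
qed simp

lemma weight_ratio_mono:
  assumes "k > 0" "m \<le> m'"
  shows "weight k (Suc m) / (real m + 1) \<le> weight k (Suc m') / (real m' + 1)"
  using assms(2)
proof (induction m' rule: dec_induct)
  case (step m')
  have "weight k (Suc m') / (real m' + 1) \<le> weight k (Suc (Suc m')) / (real (Suc m') + 1)"
  proof -
    have w: "weight k (Suc (Suc m')) / (real (Suc m') + 1)
       = weight k (Suc m') / (real m' + 1) * ((real m' + 1 + real k) / (real m' + 2))"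
      using weight_Suc[of "Suc m'" k] by (simp add: add_ac)
    have "(real m' + 1 + real k) / (real m' + 2) \<ge> 1" using assms by simp
    then show ?thesis unfolding w
      using weight_pos[of "Suc m'" k] mult_left_mono[of 1 "(real m' + 1 + real k) / (real m' + 2)" "weight k (Suc m') / (real m' + 1)"]
      by simp
  qed
  then show ?case using step by simp
qed simp

lemma weight_Suc_sym: "weight k (Suc m) = weight m (Suc k)"
  using binomial_symmetric[of k "m + k"] by (simp add: weight_binomial add.commute)

lemma weight_Suc_pochhammer: "weight k (Suc m) = pochhammer (real k + 1) m / fact m"
  unfolding weight_Suc_sym[of k m] by (simp add: weight_def add.commute)

lemma pochhammer_expand:
  fixes x :: real
  shows "pochhammer x 4 = x * (x + 1) * (x + 2) * (x + 3)"
    "pochhammer x 5 = x * (x + 1) * (x + 2) * (x + 3) * (x + 4)"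
    "pochhammer x 7 = x * (x + 1) * (x + 2) * (x + 3) * (x + 4) * (x + 5) * (x + 6)"
  by (simp_all add: numeral_eq_Suc pochhammer_Suc add_ac)

lemma weight_Suc_expand:
  "weight k (Suc 4) = (real k + 1) * (real k + 2) * (real k + 3) * (real k + 4) / 24"
  "weight k (Suc 5) = (real k + 1) * (real k + 2) * (real k + 3) * (real k + 4) * (real k + 5) / 120"
  "weight k (Suc 7) = (real k + 1) * (real k + 2) * (real k + 3) * (real k + 4) * (real k + 5)
      * (real k + 6) * (real k + 7) / 5040"
  unfolding weight_Suc_pochhammer pochhammer_expand by (simp_all add: fact_numeral add_ac)

text \<open>The bound used is \<open>l \<le> X\<close> with
  \<open>X = weight k (Suc m) / (m + 1)\<close>, which is nondecreasing in \<open>m\<close>, so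
  \<open>m = 7\<close> is the critical case. With \<open>Y' - 2 = (D - K) / (K - 1)\<close> it
  suffices that \<open>2 D (K - 1)^2 \<le> (D - K)^2\<close>. This follows from
  \<open>D - 2 K \<ge> 2 (K - 1)^2\<close>, since
  \<open>D (D - 2 K) \<le> (D - K)^2\<close>.\<close>

lemma square_cond_large:
  assumes k: "k \<ge> 6" and m: "m \<ge> 7" and l: "l * (real m + 1) \<le> weight k (Suc m)"
  defines "Y \<equiv> 2 * (weight k (Suc m) / (real m + 1) - 1) / (real k - 1) - 2 * l / real k"
  shows "Y \<ge> 2 \<and> (Y - 2)\<^sup>2 + 1 \<ge> 2 * (2 * l / real k - real k)"
proof -
  define K where "K = real k"
  define X where "X = weight k (Suc m) / (real m + 1)"
  define D where "D = 2 * X / K - K"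
  have K: "K \<ge> 6" using k by (simp add: K_def)
  obtain t where t: "K = 6 + t" "t \<ge> 0" using K by (metis add_diff_cancel_left' diff_ge_0_iff_ge diff_add_cancel add.commute)
  \<comment> \<open>This is \<open>D \<ge> 2 K + 2 (K - 1)^2\<close> at \<open>m = 7\<close>, that
    is \<open>2 X \<ge> K (2 K^2 - K + 2)\<close>, multiplied by
    \<open>20160 = 7! * 8 / 2\<close>.\<close>
  have "20160 * K * (2 * K\<^sup>2 - K + 2) \<le> (K + 1) * (K + 2) * (K + 3) * (K + 4) * (K + 5) * (K + 6) * (K + 7)"
  proof -
    \<comment> \<open>The seven factors are symmetric about \<open>K + 4 = 10 + t\<close>; opposite
      ones multiply to \<open>(10 + t)^2\<close> minus 9, 4 or 1, that is \<open>91 + u\<close>,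
      \<open>96 + u\<close> and \<open>99 + u\<close>.\<close>
    define u where "u = 20 * t + t\<^sup>2"
    have u: "u \<ge> 20 * t" "u \<ge> 0" using t(2) by (auto simp: u_def)
    have "u\<^sup>2 \<ge> (20 * t)\<^sup>2" using u t(2) by (intro power_mono) auto
    moreover have "27249 * u \<ge> 544980 * t + 27249 * t\<^sup>2" by (simp add: u_def)
    moreover have "(91 + u) * (96 + u) * (99 + u) = 864864 + 27249 * u + 286 * u\<^sup>2 + u ^ 3"
      by (simp add: algebra_simps power2_eq_square power3_eq_cube)
    moreover have "u ^ 3 \<ge> 0" using u by simp
    moreover have "(20 * t)\<^sup>2 = 400 * t\<^sup>2" by (simp add: power_mult_distrib)
    ultimately have *: "(91 + u) * (96 + u) * (99 + u) \<ge> 864864 + 544980 * t + 141649 * t\<^sup>2"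
      by (simp only:)
    have "20160 * K * (2 * K\<^sup>2 - K + 2) = 8225280 + 4152960 * t + 705600 * t\<^sup>2 + 40320 * t ^ 3"
      unfolding t(1) by (simp add: algebra_simps power2_eq_square power3_eq_cube)
    also have "\<dots> \<le> 8648640 + 6314664 * t + 1961470 * t\<^sup>2 + 141649 * t ^ 3"
      using t(2) by (intro add_mono mult_right_mono) auto
    also have "\<dots> = (10 + t) * (864864 + 544980 * t + 141649 * t\<^sup>2)"
      by (simp add: algebra_simps power2_eq_square power3_eq_cube)
    also have "\<dots> \<le> (10 + t) * ((91 + u) * (96 + u) * (99 + u))"
      using * t(2) by (intro mult_left_mono) auto
    also have "\<dots> = ((K + 4) * ((K + 1) * (K + 7)) * ((K + 2) * (K + 6)) * ((K + 3) * (K + 5)))"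
    proof -
      have "(K + 1) * (K + 7) = 91 + u" "(K + 2) * (K + 6) = 96 + u" "(K + 3) * (K + 5) = 99 + u" "K + 4 = 10 + t"
        unfolding t(1) u_def by (simp_all add: algebra_simps power2_eq_square)
      then show ?thesis by (simp only: mult.assoc)
    qed
    also have "\<dots> = (K + 1) * (K + 2) * (K + 3) * (K + 4) * (K + 5) * (K + 6) * (K + 7)"
      by (simp only: mult_ac)
    finally show ?thesis .
  qed
  also have "\<dots> = 5040 * weight k (Suc 7)"
    unfolding weight_Suc_expand by (simp add: K_def)
  also have "\<dots> \<le> 40320 * X"
    using weight_ratio_mono[of k 7 m] k m by (simp add: X_def)
  finally have X: "X \<ge> K * (2 * K\<^sup>2 - K + 2) / 2" by simp
  have "2 * X / K \<ge> 2 * K\<^sup>2 - K + 2" using X K by (simp add: field_simps)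
  then have D: "D \<ge> 2 * K + 2 * (K - 1)\<^sup>2" by (simp add: D_def algebra_simps power2_eq_square)
  define Y' where "Y' = (D - K) / (K - 1) + 2"
  have lX: "l \<le> X" using l by (simp add: X_def pos_le_divide_eq)
  have C: "2 * l / K \<le> D + K" using lX K by (simp add: D_def divide_right_mono)
  have DX: "2 * X = (D + K) * K" using K by (simp add: D_def)
  have "Y' = 2 * (X - 1) / (K - 1) - (D + K)"
    using K unfolding Y'_def right_diff_distrib DX by (simp add: field_simps)
  then have "Y \<ge> Y'" using C by (simp add: Y_def X_def K_def)
  moreover have "D \<ge> K" using D K zero_le_power2[of "K - 1"] by linarith
  then have "Y' \<ge> 2" using K by (simp add: Y'_def)
  moreover have "(Y' - 2)\<^sup>2 + 1 \<ge> 2 * ((D + K) - K)"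
  proof -
    have "2 * D * (K - 1)\<^sup>2 \<le> D * (D - 2 * K)"
      using mult_left_mono[OF D, of D] D K zero_le_power2[of "K - 1"] by (simp add: algebra_simps)
    also have "\<dots> \<le> (D - K)\<^sup>2" by (simp add: power2_eq_square algebra_simps)
    finally have "2 * D \<le> (D - K)\<^sup>2 / (K - 1)\<^sup>2" using K by (simp add: pos_le_divide_eq)
    then show ?thesis by (simp add: Y'_def power_divide)
  qed
  ultimately show ?thesis using square_cond_mono[of Y' "D + K" K Y "2 * l / K"] C by (simp add: K_def)
qed

text \<open>Since \<open>k > m\<close>, the bound with \<open>k + 1\<close> is the sharper one and
  reads \<open>C \<le> W\<close>. Also \<open>K \<ge> m + 1\<close> gives
  \<open>Y' - 2 = 2 (W - K) / (K - 1)\<close> as lower bound for \<open>Y - 2\<close>. It then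
  suffices that \<open>W - K \<ge> (K - 1)^2 / 2\<close>, and by monotonicity of the weight in
  \<open>m\<close> this is checked at \<open>m = 5\<close>.\<close>

lemma square_cond_5_6:
  assumes k: "k > m" and m: "m \<ge> 5" and l: "l * (real k + 1) \<le> weight k (Suc m)"
  defines "Y \<equiv> 2 * (weight k (Suc m) / (real m + 1) - 1) / (real k - 1) - 2 * l / real k"
  shows "Y \<ge> 2 \<and> (Y - 2)\<^sup>2 + 1 \<ge> 2 * (2 * l / real k - real k)"
proof -
  define K where "K = real k"
  have K: "K \<ge> 6" using k m by (simp add: K_def)
  define W where "W = 2 * weight k (Suc m) / (K * (K + 1))"
  have "(K + 2) * (K + 3) * (K + 4) * (K + 5) - 30 * K * (K\<^sup>2 + 1)
      = K\<^sup>2 * ((K - 8)\<^sup>2 + 7) + 124 * K + 120"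
    by (simp add: algebra_simps power2_eq_square)
  also have "\<dots> \<ge> 0" using K by simp
  finally have "(K\<^sup>2 + 1) / 2 \<le> (K + 2) * (K + 3) * (K + 4) * (K + 5) / (60 * K)"
    using K by (simp add: pos_le_divide_eq mult_ac)
  also have "\<dots> = 2 * weight k (Suc 5) / (K * (K + 1))"
    unfolding weight_Suc_expand using K by (simp add: divide_simps K_def)
  also have "\<dots> \<le> W"
    unfolding W_def using weight_Suc_mono[of k 5 m] m k K
    by (intro divide_right_mono mult_left_mono) auto
  finally have W: "W - K \<ge> (K - 1)\<^sup>2 / 2" by (simp add: field_simps power2_eq_square)
  have "0 \<le> (K - 1)\<^sup>2 / 2" by simp
  from order.trans[OF this W] have WK: "W \<ge> K" by simp
  have "W * K / 2 * (K + 1) = weight k (Suc m)" using K by (simp add: W_def divide_simps)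
  then have "l * (K + 1) \<le> W * K / 2 * (K + 1)" using l by (simp add: K_def)
  then have "l \<le> W * K / 2" using K by (simp only: mult_le_cancel_right)
  then have C: "2 * l / K \<le> W" using K by (simp add: field_simps)
  define Y' where "Y' = 2 * (W - K) / (K - 1) + 2"
  have "weight k (Suc m) / (real m + 1) \<ge> W * (K + 1) / 2"
  proof -
    have "weight k (Suc m) = W * (K + 1) / 2 * K" using K by (simp add: W_def)
    moreover have "K \<ge> real m + 1" using k by (simp add: K_def)
    moreover have "W \<ge> 0" using WK K by simp
    then have "W * (K + 1) / 2 \<ge> 0" using K by simp
    ultimately have "weight k (Suc m) \<ge> W * (K + 1) / 2 * (real m + 1)" by (simp only: mult_left_mono)
    then show ?thesis by (simp only: pos_le_divide_eq[of "real m + 1"] of_nat_0_le_iff add_nonneg_pos zero_less_one)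
  qed
  then have "W * (K + 1) / 2 - 1 \<le> weight k (Suc m) / (real m + 1) - 1" by linarith
  then have "2 * (weight k (Suc m) / (real m + 1) - 1) / (K - 1) \<ge> 2 * (W * (K + 1) / 2 - 1) / (K - 1)"
    using K by (intro divide_right_mono mult_left_mono) auto
  moreover have "2 * (W * (K + 1) / 2 - 1) / (K - 1) - W = Y'"
    using K by (simp add: Y'_def field_simps)
  ultimately have "Y \<ge> Y'" using C by (simp add: Y_def K_def)
  moreover have "Y' \<ge> 2" using WK K by (simp add: Y'_def)
  moreover have "(Y' - 2)\<^sup>2 + 1 \<ge> 2 * (W - K)"
  proof -
    define D where "D = W - K"
    have "2 * D * (K - 1)\<^sup>2 = 4 * (D * ((K - 1)\<^sup>2 / 2))" by simp
    also have "\<dots> \<le> 4 * (D * D)" using W WK unfolding D_def by (intro mult_left_mono) auto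
    also have "\<dots> = (2 * D)\<^sup>2" by (simp add: power2_eq_square)
    finally have "2 * (W - K) * (K - 1)\<^sup>2 \<le> (2 * (W - K))\<^sup>2" unfolding D_def .
    then have "2 * (W - K) \<le> (2 * (W - K))\<^sup>2 / (K - 1)\<^sup>2"
      using K by (simp add: pos_le_divide_eq)
    then show ?thesis by (simp add: Y'_def power_divide)
  qed
  ultimately show ?thesis using square_cond_mono[of Y' W K Y "2 * l / K"] C by (simp add: K_def)
qed

text \<open>The constants \<open>10\<close>, \<open>17/25\<close> and \<open>12/5\<close> are the
  values at \<open>K = 6\<close> of \<open>W\<close>, \<open>g\<close> and
  \<open>2 K / (K - 1)\<close>. Replacing the last two by these and \<open>K\<close> by 6 on the
  right leaves a quadratic inequality in \<open>W\<close>.\<close>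

lemma square_cond_4:
  assumes k: "k \<ge> 6" and l: "l * (real k + 1) \<le> weight k (Suc 4)"
  defines "Y \<equiv> 2 * (weight k (Suc 4) / (real 4 + 1) - 1) / (real k - 1) - 2 * l / real k"
  shows "Y \<ge> 2 \<and> (Y - 2)\<^sup>2 + 1 \<ge> 2 * (2 * l / real k - real k)"
proof -
  define K where "K = real k"
  have K: "K \<ge> 6" using k by (simp add: K_def)
  define W where "W = (K + 2) * (K + 3) * (K + 4) / (12 * K)"
  have w4: "weight k (Suc 4) = W * K * (K + 1) / 2"
    unfolding weight_Suc_expand W_def using K by (simp add: K_def)
  have "l * (K + 1) \<le> W * K / 2 * (K + 1)" using l unfolding w4 by (simp add: K_def)
  then have "l \<le> W * K / 2" using K by (simp only: mult_le_cancel_right)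
  then have C: "2 * l / K \<le> W" using K by (simp add: field_simps)
  have W10: "W \<ge> 10"
  proof -
    have "(K + 2) * (K + 3) * (K + 4) - 120 * K = (K - 6) * (K * (K + 15) - 4)"
      by (simp add: algebra_simps)
    also have "\<dots> \<ge> 0"
    proof (rule mult_nonneg_nonneg)
      have "K * (K + 15) \<ge> 6 * (6 + 15)" using K by (intro mult_mono) auto
      then show "K * (K + 15) - 4 \<ge> 0" by simp
    qed (use K in simp)
    finally show ?thesis using K by (simp add: W_def field_simps)
  qed
  define g where "g = K * (K + 1) / (5 * (K - 1)) - 1"
  have g: "g \<ge> 17 / 25"
  proof -
    have "K * (K + 1) - 42 / 5 * (K - 1) = (K - 6) * (K - 7 / 5)"
      by (simp add: field_simps)
    also have "\<dots> \<ge> 0" using K by (intro mult_nonneg_nonneg) auto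
    finally show ?thesis using K by (simp add: g_def field_simps)
  qed
  define Y' where "Y' = 17 / 25 * W - 2 / 5"
  have "2 * K / (K - 1) \<le> 12 / 5" using K by (simp add: field_simps)
  moreover have "17 / 25 * W \<le> g * W" using g W10 by (intro mult_right_mono) auto
  moreover have "2 * (weight k (Suc 4) / (real 4 + 1) - 1) / (K - 1) - W = g * W - 2 * K / (K - 1) + 2"
  proof -
    have "2 * K / (K - 1) = 2 + 2 / (K - 1)" using K by (simp add: field_simps)
    moreover have "2 * (W * K * (K + 1) / 2 / (real 4 + 1) - 1) / (K - 1) = W * K * (K + 1) / 5 / (K - 1) - 2 / (K - 1)"
      by (simp add: diff_divide_distrib right_diff_distrib)
    moreover have "g * W = W * K * (K + 1) / 5 / (K - 1) - W"
    proof -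
      have "g * W = K * (K + 1) / (5 * (K - 1)) * W - W" by (simp add: g_def left_diff_distrib)
      also have "K * (K + 1) / (5 * (K - 1)) * W = W * K * (K + 1) / 5 / (K - 1)"
        by (simp add: mult_ac)
      finally show ?thesis .
    qed
    ultimately show ?thesis unfolding w4 by linarith
  qed
  ultimately have "Y \<ge> Y'" using C by (simp add: Y_def Y'_def K_def)
  moreover have "Y' \<ge> 2" using W10 by (simp add: Y'_def)
  moreover have "(Y' - 2)\<^sup>2 + 1 \<ge> 2 * (W - K)"
  proof -
    have "(Y' - 2)\<^sup>2 + 1 - 2 * (W - 6) = 289 / 625 * (W - 57 / 10)\<^sup>2 + (23 / 3125 * W + 233539 / 62500)"
      by (simp add: Y'_def power2_eq_square algebra_simps)
    also have "\<dots> \<ge> 0" using W10 by simp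
    finally show ?thesis using K by simp
  qed
  ultimately show ?thesis using square_cond_mono[of Y' W K Y "2 * l / K"] C by (simp add: K_def)
qed

section \<open>Real-rootedness of the gamma polynomial\<close>

definition gamma_rat :: "nat \<Rightarrow> nat \<Rightarrow> real \<Rightarrow> nat \<Rightarrow> real" where
  "gamma_rat k m C i = (\<Sum>s\<in>{1..m}. weight k s / ((real s + real i - 1) * (real s + real i))) - C / (real i + 1)"

text \<open>The coefficients of the gamma polynomial of a sparse paving matroid of rank
  \<open>k\<close> on \<open>k + m\<close> elements with \<open>l\<close> circuit-hyperplanes, as
  \<open>kl_sp_matroid\<close> shows for \<open>k \<ge> 2\<close>. The argument
  \<open>2 * l / k\<close> absorbs the correction \<open>l * gamma_circ k i\<close>.\<close>

definition gamma_coeff :: "nat \<Rightarrow> nat \<Rightarrow> real \<Rightarrow> nat \<Rightarrow> real" where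
  "gamma_coeff k m l i = (if i = 0 then 1
     else fact k / (fact (k - 2 * i) * fact (i - 1) * fact i) * gamma_rat k m (2 * l / real k) i)"

definition gamma_sp :: "nat \<Rightarrow> nat \<Rightarrow> real \<Rightarrow> real poly" where
  "gamma_sp k m l = (\<Sum>i\<le>k div 2. monom (gamma_coeff k m l i) i)"

lemma coeff_gamma_sp: "coeff (gamma_sp k m l) i = (if i \<le> k div 2 then gamma_coeff k m l i else 0)"
  unfolding gamma_sp_def by (rule coeff_sum_monom)

lemma gamma_coeff_numer:
  assumes "m > 0" "2 * i \<le> k"
  shows "gamma_coeff k m l i = fact k * poly (numer_poly k m (2 * l / real k)) (real i) * coeff (gegenbauer k m) i"
proof (cases "i = 0")
  case True
  then show ?thesis using assms
    by (simp add: gamma_coeff_def poly_numer_poly_0 coeff_gegenbauer)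
next
  case False
  have "(\<Prod>t\<in>{1..m}. real t + real i) = fact (m + i) / fact i" by (rule prod_atLeastAtMost_fact)
  then have "poly (numer_poly k m (2 * l / real k)) (real i)
      = real i * (fact (m + i) / fact i) * gamma_rat k m (2 * l / real k) i"
    using False assms by (simp add: poly_numer_poly_pos gamma_rat_def)
  moreover have "(fact i :: real) = real i * fact (i - 1)" using False by (simp add: fact_reduce)
  ultimately show ?thesis using False assms
    by (simp add: gamma_coeff_def coeff_gegenbauer)
qed

lemma gamma_sp_scale:
  assumes "m > 0"
  shows "gamma_sp k m l = smult (fact k) (scale_poly (numer_poly k m (2 * l / real k)) (gegenbauer k m))"
proof (rule poly_eqI)
  fix i
  show "coeff (gamma_sp k m l) i = coeff (smult (fact k) (scale_poly (numer_poly k m (2 * l / real k)) (gegenbauer k m))) i"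
  proof (cases "2 * i \<le> k")
    case True
    then show ?thesis using gamma_coeff_numer[OF assms True, of l]
      by (simp add: coeff_gamma_sp coeff_scale_poly)
  next
    case False
    then show ?thesis by (simp add: coeff_gamma_sp coeff_scale_poly coeff_gegenbauer)
  qed
qed

lemma gamma_coeff_nonneg:
  assumes "m > 0" "2 * i \<le> k" "poly (numer_poly k m (2 * l / real k)) (real i) \<ge> 0"
  shows "gamma_coeff k m l i \<ge> 0"
  unfolding gamma_coeff_numer[OF assms(1,2)] using assms by (simp add: coeff_gegenbauer)

lemma real_rooted_smult: "real_rooted p \<Longrightarrow> c \<noteq> 0 \<Longrightarrow> real_rooted (smult c p)"
  by (auto simp: real_rooted_def of_real_poly_smult)

text \<open>From \<open>a s > s\<close> one gets \<open>(a s + 1) / a s < (s + 1) / s\<close> and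
  \<open>a s / (a s - 1) < s / (s - 1)\<close>. The products of the right-hand sides over
  \<open>s = 2, ..., M\<close> telescope to \<open>(M + 1) / 2\<close> and \<open>M\<close>.\<close>

lemma prod_shift_bounds:
  assumes "\<And>s. s \<in> {2..M} \<Longrightarrow> real s < a s" "M \<ge> 1"
  shows "2 * (\<Prod>s\<in>{2..M}. a s + 1) \<le> (real M + 1) * (\<Prod>s\<in>{2..M}. a s)"
    and "(\<Prod>s\<in>{2..M}. a s) \<le> real M * (\<Prod>s\<in>{2..M}. a s - 1)"
    and "(\<Prod>s\<in>{2..M}. a s - 1) > 0"
proof -
  have "2 * (\<Prod>s\<in>{2..M}. a s + 1) \<le> (real M + 1) * (\<Prod>s\<in>{2..M}. a s)
      \<and> (\<Prod>s\<in>{2..M}. a s) \<le> real M * (\<Prod>s\<in>{2..M}. a s - 1) \<and> (\<Prod>s\<in>{2..M}. a s - 1) > 0"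
    using assms(2,1)
  proof (induction M rule: dec_induct)
    case (step M)
    let ?P0 = "\<Prod>s\<in>{2..M}. a s" and ?P1 = "\<Prod>s\<in>{2..M}. a s + 1" and ?Pm = "\<Prod>s\<in>{2..M}. a s - 1"
    have IH: "2 * ?P1 \<le> (real M + 1) * ?P0" "?P0 \<le> real M * ?Pm" "?Pm > 0"
      using step by auto
    have a: "a (Suc M) > real M + 1" using step.prems[of "Suc M"] step.hyps by simp
    have P0: "?P0 > 0" using step.prems by (intro prod_pos) (force simp: less_le_trans)
    have "2 * (?P1 * (a (Suc M) + 1)) \<le> (real M + 1) * ?P0 * (a (Suc M) + 1)"
      using IH(1) a mult_right_mono[OF IH(1), of "a (Suc M) + 1"] by (simp add: mult.assoc)
    also have "\<dots> = ?P0 * ((real M + 1) * (a (Suc M) + 1))" by simp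
    also have "\<dots> \<le> ?P0 * ((real M + 2) * a (Suc M))"
      using a P0 by (intro mult_left_mono) (auto simp: algebra_simps)
    finally have 1: "2 * (?P1 * (a (Suc M) + 1)) \<le> (real (Suc M) + 1) * (?P0 * a (Suc M))"
      by (simp add: algebra_simps)
    have "?P0 * a (Suc M) \<le> real M * ?Pm * a (Suc M)"
      using IH(2) a by (intro mult_right_mono) auto
    also have "\<dots> = ?Pm * (real M * a (Suc M))" by simp
    also have "\<dots> \<le> ?Pm * ((real M + 1) * (a (Suc M) - 1))"
      using a IH by (intro mult_left_mono) (auto simp: algebra_simps)
    finally have 2: "?P0 * a (Suc M) \<le> real (Suc M) * (?Pm * (a (Suc M) - 1))"
      by (simp add: algebra_simps)
    have 3: "?Pm * (a (Suc M) - 1) > 0" using IH a by simp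
    have "{2..Suc M} = insert (Suc M) {2..M}" using step.hyps by auto
    then show ?case using 1 2 3 by (simp add: mult_ac)
  qed auto
  then show "2 * (\<Prod>s\<in>{2..M}. a s + 1) \<le> (real M + 1) * (\<Prod>s\<in>{2..M}. a s)"
    "(\<Prod>s\<in>{2..M}. a s) \<le> real M * (\<Prod>s\<in>{2..M}. a s - 1)"
    "(\<Prod>s\<in>{2..M}. a s - 1) > 0" by auto
qed

text \<open>The difference \<open>weight k (Suc s) / (s + 1) - weight k s / s\<close> is
  \<open>k - 1\<close> times the summand. The formula gives the value of \<open>N\<close> at
  1.\<close>

lemma weight_sum_telescope:
  assumes "k \<ge> 2"
  shows "(\<Sum>s\<in>{1..m}. weight k s / (real s * (real s + 1))) = (weight k (Suc m) / (real m + 1) - 1) / (real k - 1)"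
proof (induction m)
  case (Suc m)
  have w: "weight k (Suc (Suc m)) = weight k (Suc m) * (real m + 1 + real k) / (real m + 1)"
    using weight_Suc[of "Suc m" k] by (simp add: add_ac)
  have "(w / (x + 1) - 1) / (y - 1) + w / ((x + 1) * (x + 2)) = (w * (x + 1 + y) / (x + 1) / (x + 2) - 1) / (y - 1)"
    if "x \<ge> 0" "y \<ge> 2" for w x y :: real
    using that by (simp add: divide_simps) (simp add: algebra_simps)
  from this[of "real m" "real k" "weight k (Suc m)"] show ?case
    using Suc assms by (simp add: w add_ac)
qed simp

text \<open>With \<open>z = q(1) / q(0)\<close> and \<open>e = q(-1) / q(0)\<close> one has
  \<open>(q1 + q2)^2 - 4 q0 q2 = q0^2 ((z - 2)^2 + 1 - 2 e)\<close>. A lower bound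
  \<open>y \<ge> 2\<close> for \<open>z\<close> and an upper bound \<open>d\<close> for
  \<open>e\<close> therefore suffice.\<close>

lemma quadratic_admissible:
  fixes q0 q1 q2 y d :: real
  assumes "q0 > 0" "q0 + q1 + q2 \<ge> y * q0" "q0 - q1 + q2 \<le> d * q0" "y \<ge> 2" "(y - 2)\<^sup>2 + 1 \<ge> 2 * d"
  shows "q1 + q2 > 0" "(q1 + q2)\<^sup>2 \<ge> 4 * q0 * q2"
proof -
  define z where "z = (q0 + q1 + q2) / q0"
  define e where "e = (q0 - q1 + q2) / q0"
  have z: "z \<ge> y" "e \<le> d" using assms by (auto simp: z_def e_def field_simps)
  have "(y - 2)\<^sup>2 \<le> (z - 2)\<^sup>2" using z assms by (intro power_mono) auto
  then have "(y - 2)\<^sup>2 + 1 \<le> (z - 2)\<^sup>2 + 1" by simp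
  moreover have "2 * e \<le> 2 * d" using z by simp
  ultimately have "2 * e \<le> (z - 2)\<^sup>2 + 1" using assms(5) by (meson order.trans)
  then have "(z - 2)\<^sup>2 + 1 - 2 * e \<ge> 0" by simp
  then have "0 \<le> q0\<^sup>2 * ((z - 2)\<^sup>2 + 1 - 2 * e)" by simp
  also have "\<dots> = (q0 * z - 2 * q0)\<^sup>2 + q0\<^sup>2 - 2 * q0 * (q0 * e)"
    by (simp add: algebra_simps power2_eq_square)
  also have "q0 * z = q0 + q1 + q2" using assms by (simp add: z_def)
  also have "q0 * e = q0 - q1 + q2" using assms by (simp add: e_def)
  finally show "(q1 + q2)\<^sup>2 \<ge> 4 * q0 * q2"
    by (simp add: algebra_simps power2_eq_square)
  have "2 * q0 \<le> y * q0" using assms by (intro mult_right_mono) auto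
  then have "q0 + q1 + q2 \<ge> 2 * q0" using assms(2) by linarith
  then show "q1 + q2 > 0" using assms by simp
qed

text \<open>The factors \<open>(m + 1) / (m - 1)\<close> and \<open>(m - 2) / m\<close> come from
  \<open>prod_shift_bounds\<close> with \<open>M = m - 2\<close>. Outside \<open>k = m = 6\<close>
  they only help and are discarded by monotonicity.\<close>

lemma square_cond:
  assumes k: "k \<ge> 6" and m: "m \<ge> 3"
    and l1: "l * (real m + 1) \<le> weight k (Suc m)" and l2: "l * (real k + 1) \<le> weight k (Suc m)"
  defines "C \<equiv> 2 * l / real k"
  defines "Y \<equiv> 2 * (weight k (Suc m) / (real m + 1) - 1) / (real k - 1) - C"
  assumes C: "C > real k"
  shows "Y * (real m + 1) / (real m - 1) \<ge> 2"
    and "(Y * (real m + 1) / (real m - 1) - 2)\<^sup>2 + 1 \<ge> 2 * ((C - real k) * (real m - 2) / real m)"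
proof -
  have "Y * (real m + 1) / (real m - 1) \<ge> 2
    \<and> (Y * (real m + 1) / (real m - 1) - 2)\<^sup>2 + 1 \<ge> 2 * ((C - real k) * (real m - 2) / real m)"
  proof (cases "m = 6 \<and> k = 6")
    \<comment> \<open>At \<open>C = 44\<close>, the largest value allowed here, the condition
      without the extra factors fails: \<open>Y = 8.4\<close>, and \<open>6.4^2 + 1 < 76\<close>.
      The factors \<open>7/5\<close> and \<open>2/3\<close> make the difference.\<close>
    case True
    have w: "weight 6 (Suc 6) = 924"
      unfolding weight_Suc_pochhammer by (simp add: numeral_eq_Suc pochhammer_Suc)
    have Cle: "C \<le> 44" using l1 True w by (simp add: C_def)
    have Y: "Y = 262 / 5 - C" using True w by (simp add: Y_def)
    have "Y * (real m + 1) / (real m - 1) - 2 \<ge> 9" using Y Cle True by simp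
    then have "(Y * (real m + 1) / (real m - 1) - 2)\<^sup>2 \<ge> 9\<^sup>2" by (intro power_mono) auto
    then show ?thesis using Y Cle True by simp
  next
    case False
    have "Y \<ge> 2 \<and> (Y - 2)\<^sup>2 + 1 \<ge> 2 * (C - real k)"
    proof -
      consider "m \<ge> 7" | "m < 7" "5 \<le> m" | "m = 4" | "m = 3" using m by linarith
      then show ?thesis
      proof cases
        case 1
        then show ?thesis unfolding Y_def C_def using square_cond_large[OF k 1 l1] by blast
      next
        case 2
        then have "k > m" using k False by auto
        then show ?thesis unfolding Y_def C_def using square_cond_5_6[OF _ 2(2) l2] by blast
      next
        case 3
        then show ?thesis unfolding Y_def C_def using square_cond_4[OF k] l2 by simp
      next
        case 4
        \<comment> \<open>For \<open>m = 3\<close> the bound on \<open>l\<close> already gives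
          \<open>C \<le> k\<close>, against the assumption of the lemma.\<close>
        define K where "K = real k"
        have K: "K \<ge> 6" using k by (simp add: K_def)
        have w3: "weight k (Suc 3) = (K + 1) * (K + 2) * (K + 3) / 6"
          unfolding weight_Suc_pochhammer by (simp add: numeral_eq_Suc pochhammer_Suc K_def add_ac)
        have "l * (K + 1) \<le> weight k (Suc 3)" using l2 4 by (simp add: K_def)
        also have "\<dots> = (K + 2) * (K + 3) / 6 * (K + 1)" unfolding w3 by simp
        finally have "l * (K + 1) \<le> (K + 2) * (K + 3) / 6 * (K + 1)" .
        then have "l \<le> (K + 2) * (K + 3) / 6" using K by (simp only: mult_le_cancel_right)
        also have "\<dots> \<le> K\<^sup>2 / 2"
        proof -
          have "6 * K \<le> K * K" using K by (intro mult_right_mono) auto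
          then have "(K + 2) * (K + 3) \<le> 3 * K\<^sup>2" using K unfolding power2_eq_square ring_distribs by linarith
          then show ?thesis by simp
        qed
        finally have "C \<le> real k" using K by (simp add: C_def K_def field_simps power2_eq_square)
        then show ?thesis using C by simp
      qed
    qed
    moreover have "Y \<le> Y * (real m + 1) / (real m - 1)" if "Y \<ge> 2"
      using that m mult_left_mono[of "real m - 1" "real m + 1" Y] by (simp add: pos_le_divide_eq)
    moreover have "(C - real k) * (real m - 2) / real m \<le> C - real k"
      using C m mult_left_mono[of "real m - 2" "real m" "C - real k"] by (simp add: pos_divide_le_eq)
    ultimately show ?thesis
      using square_cond_mono[of Y "C - real k" 0 "Y * (real m + 1) / (real m - 1)" "(C - real k) * (real m - 2) / real m"]
      by simp
  qed
  then show "Y * (real m + 1) / (real m - 1) \<ge> 2"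
    "(Y * (real m + 1) / (real m - 1) - 2)\<^sup>2 + 1 \<ge> 2 * ((C - real k) * (real m - 2) / real m)" by auto
qed

text \<open>Dividing the known values \<open>N(1)\<close> and \<open>N(-1)\<close> by
  \<open>N(0)\<close> isolates \<open>q(1) / q(0)\<close> and \<open>q(-1) / q(0)\<close>, up to
  ratios of the other factors; these are controlled because each \<open>a s\<close> exceeds
  \<open>s\<close>.\<close>

lemma gamma_sp_real_rooted_large:
  assumes k: "k \<ge> 6" and m: "m \<ge> 3" and l: "l \<ge> 0"
    and l1: "l * (real m + 1) \<le> weight k (Suc m)" and l2: "l * (real k + 1) \<le> weight k (Suc m)"
  shows "real_rooted (gamma_sp k m l) \<and> (\<forall>i\<le>k div 2. gamma_coeff k m l i \<ge> 0)"
proof -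
  define C where "C = 2 * l / real k"
  define N where "N = numer_poly k m C"
  define h where "h = k div 2"
  have h: "h \<ge> 3" using k by (auto simp: h_def)
  have C0: "C \<ge> 0" using l by (simp add: C_def)
  have hN: "poly (numer_poly k m C) (real h) \<ge> 0"
    using poly_numer_poly_pos[of "real h" m k C] weight_sum_ge[OF h_def _ _ l1 l2] k m h
    by (simp add: C_def prod_nonneg)
  have kh: "k > 0" "real h > 0" using k h by auto
  obtain a \<alpha> q0 q1 q2 where a: "\<And>s. s \<in> {2..m - 2} \<Longrightarrow> real s < a s \<and> a s < real (Suc s)"
    and \<alpha>: "\<alpha> > 0" "\<alpha> \<ge> C * real h" and q2: "q2 > 0"
    and N': "numer_poly k m C = [:\<alpha>, -C:] * [:q0, q1, q2:] * (\<Prod>s\<in>{2..m - 2}. [:a s, 1:])"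
    by (rule numer_poly_factor[OF m kh(1) C0 kh(2) hN]) blast
  note N = N'[folded N_def]
  have apos: "a s > 0" if "s \<in> {2..m - 2}" for s using a[OF that] by linarith
  define P0 P1 Pm where "P0 = (\<Prod>s\<in>{2..m - 2}. a s)" and "P1 = (\<Prod>s\<in>{2..m - 2}. a s + 1)"
    and "Pm = (\<Prod>s\<in>{2..m - 2}. a s - 1)"
  have P: "2 * P1 \<le> (real m - 1) * P0" "P0 \<le> (real m - 2) * Pm" "Pm > 0" "P0 > 0" "P1 > 0"
    using prod_shift_bounds[of "m - 2" a] a m apos
    by (auto simp: P0_def P1_def Pm_def of_nat_diff algebra_simps intro!: prod_pos add_pos_pos)
  have polyN: "poly N x = (\<alpha> - C * x) * (q0 + q1 * x + q2 * x\<^sup>2) * (\<Prod>s\<in>{2..m - 2}. a s + x)" for x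
    unfolding N by (simp add: poly_prod algebra_simps power2_eq_square)
  have N0: "\<alpha> * q0 * P0 = fact m"
    using polyN[of 0] poly_numer_poly_0[of m k C] m by (simp add: N_def P0_def)
  have q0: "q0 > 0"
  proof -
    have "\<alpha> * q0 * P0 > 0" unfolding N0 by simp
    then show ?thesis using \<alpha> P by (simp add: zero_less_mult_iff)
  qed
  have Nm: "(\<alpha> + C) * (q0 - q1 + q2) * Pm = fact (m - 1) * (C - real k)"
    using polyN[of "-1"] poly_numer_poly_minus_1[of m k C] m by (simp add: N_def Pm_def)
  have q: "q1 + q2 > 0 \<and> (q1 + q2)\<^sup>2 \<ge> 4 * q0 * q2"
  proof (cases "C \<le> real k")
    case True
    \<comment> \<open>Here \<open>N(-1) \<le> 0\<close>, hence \<open>q(-1) \<le> 0\<close>, and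
      \<open>q1 + q2 \<ge> q0 + 2 q2\<close> makes the quadratic condition immediate.\<close>
    then have "(\<alpha> + C) * (q0 - q1 + q2) * Pm \<le> 0" unfolding Nm by (simp add: mult_le_0_iff)
    then have "q0 - q1 + q2 \<le> 0" using \<alpha> C0 P by (simp add: mult_le_0_iff zero_le_mult_iff)
    then have *: "q0 + 2 * q2 \<le> q1 + q2" by simp
    have "4 * q0 * q2 \<le> (q0 + 2 * q2)\<^sup>2" using q0 q2 by (simp add: power2_eq_square algebra_simps)
    also have "\<dots> \<le> (q1 + q2)\<^sup>2" using * q0 q2 by (intro power_mono) auto
    finally show ?thesis using * q0 q2 by auto
  next
    case False
    define Y where "Y = 2 * (weight k (Suc m) / (real m + 1) - 1) / (real k - 1) - C"
    define y where "y = Y * (real m + 1) / (real m - 1)"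
    define d where "d = (C - real k) * (real m - 2) / real m"
    have yd: "y \<ge> 2" "(y - 2)\<^sup>2 + 1 \<ge> 2 * d"
      using square_cond[OF k m l1 l2] False unfolding y_def d_def Y_def C_def by auto
    have "(\<Sum>s\<in>{1..m}. weight k s / (real s * (real s + 1))) - C / 2 = Y / 2"
      using weight_sum_telescope[of k m] k by (simp add: Y_def)
    moreover have "(\<Prod>t\<in>{1..m}. real t + 1) = fact (m + 1)"
      using prod_atLeastAtMost_fact[where m = m and i = 1] by (simp only: of_nat_1 fact_1 div_by_1)
    ultimately have "poly N 1 = fact (m + 1) * (Y / 2)"
      using poly_numer_poly_pos[of 1 m k C] m by (simp add: N_def)
    then have N1: "(\<alpha> - C) * (q0 + q1 + q2) * P1 = fact (m + 1) * (Y / 2)"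
      using polyN[of 1] by (simp add: P1_def)
    have Ck: "C > 0" using False k by linarith
    then have "C * 3 \<le> C * real h" using h by (intro mult_left_mono) auto
    then have \<alpha>C: "\<alpha> - C > 0" using \<alpha>(2) Ck by linarith
    have fm: "(fact (m + 1) :: real) = (real m + 1) * fact m" by simp
    \<comment> \<open>In \<open>N(1) / N(0)\<close> the factor \<open>m + 1\<close> comes from the
      factorials; \<open>\<alpha> - C \<le> \<alpha>\<close> and
      \<open>2 * P1 \<le> (m - 1) * P0\<close> account for the rest of \<open>y\<close>.\<close>
    have "y * q0 \<le> q0 + q1 + q2"
    proof (rule ccontr)
      assume "\<not> y * q0 \<le> q0 + q1 + q2"
      then have "(\<alpha> - C) * P1 * (q0 + q1 + q2) < (\<alpha> - C) * P1 * (y * q0)"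
        using \<alpha>C P by (intro mult_strict_left_mono) auto
      also have "\<dots> \<le> \<alpha> * P1 * (y * q0)"
        using C0 P yd q0 by (intro mult_right_mono) auto
      also have "\<dots> = \<alpha> * (y * q0) * P1" by simp
      also have "\<dots> \<le> \<alpha> * (y * q0) * ((real m - 1) * P0 / 2)"
        using \<alpha> yd q0 P by (intro mult_left_mono) auto
      also have "\<dots> = (\<alpha> * q0 * P0) * (y * (real m - 1) / 2)" by simp
      also have "\<dots> = fact (m + 1) * (Y / 2)"
        unfolding N0 fm y_def using m by simp
      finally show False using N1 by (simp add: mult_ac)
    qed
    moreover have "q0 - q1 + q2 \<le> d * q0"
    proof (rule ccontr)
      assume "\<not> q0 - q1 + q2 \<le> d * q0"
      then have "(\<alpha> + C) * Pm * (d * q0) < (\<alpha> + C) * Pm * (q0 - q1 + q2)"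
        using \<alpha> C0 P by (intro mult_strict_left_mono) auto
      also have "\<dots> = fact (m - 1) * (C - real k)" using Nm by (simp add: mult_ac)
      also have "\<dots> = fact m * ((C - real k) / real m)"
        using m by (simp add: fact_reduce)
      also have "\<dots> = \<alpha> * q0 * P0 * ((C - real k) / real m)" unfolding N0 ..
      also have "\<dots> \<le> \<alpha> * q0 * ((real m - 2) * Pm) * ((C - real k) / real m)"
        using \<alpha> q0 P False m by (intro mult_right_mono mult_left_mono) auto
      also have "\<dots> = \<alpha> * Pm * (d * q0)" by (simp add: d_def)
      also have "\<dots> \<le> (\<alpha> + C) * Pm * (d * q0)"
        using C0 P q0 False m by (intro mult_right_mono) (auto simp: d_def)
      finally show False by simp
    qed
    ultimately show ?thesis using quadratic_admissible[OF q0 _ _ yd] by blast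
  qed
  have "real_rooted (scale_poly N (gegenbauer k m))"
    using real_rooted_scale_gegenbauer[OF N \<alpha>(1) _ _ q0 q2] apos q by auto
  then have "real_rooted (gamma_sp k m l)"
    using gamma_sp_scale[of m k l] m by (simp add: real_rooted_smult N_def C_def)
  moreover have "gamma_coeff k m l i \<ge> 0" if "i \<le> k div 2" for i
  proof (rule gamma_coeff_nonneg)
    have "C * real i \<le> C * real h" using that C0 by (intro mult_left_mono) (auto simp: h_def)
    then have "\<alpha> - C * real i \<ge> 0" using \<alpha> by simp
    moreover have "q0 + q1 * real i + q2 * (real i)\<^sup>2 \<ge> 0"
    proof -
      \<comment> \<open>In the basis \<open>1, i, i (i - 1)\<close> the quadratic has positive
        coefficients, and these basis functions are nonnegative at natural numbers.\<close>
      have "q0 + q1 * real i + q2 * (real i)\<^sup>2 = q0 + (q1 + q2) * real i + q2 * (real i * (real i - 1))"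
        by (simp add: algebra_simps power2_eq_square)
      moreover have "real i * (real i - 1) \<ge> 0" by (cases i) auto
      moreover have "0 \<le> (q1 + q2) * real i" "0 \<le> q2 * (real i * (real i - 1))"
        using calculation(2) q q2 by simp_all
      ultimately show ?thesis using q0 by linarith
    qed
    moreover have "(\<Prod>s\<in>{2..m - 2}. a s + real i) \<ge> 0"
      using apos by (intro prod_nonneg) (force intro: add_nonneg_nonneg less_imp_le)
    ultimately show "poly (numer_poly k m (2 * l / real k)) (real i) \<ge> 0"
      using polyN[of "real i"] unfolding N_def C_def by simp
  qed (use m that in auto)
  ultimately show ?thesis by blast
qed

section \<open>Corank at most two\<close>

lemma real_rooted_linear: "real_rooted [:1, c:]"
proof (rule real_rootedI)
  fix z :: complex assume "Im z > 0"
  then show "poly (map_poly of_real [:1, c:]) z \<noteq> 0"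
    by (cases "c = 0") (auto simp: map_poly_pCons complex_eq_iff)
qed

lemma real_rooted_quadratic:
  assumes "b\<^sup>2 \<ge> 4 * c"
  shows "real_rooted [:1, b, c:]"
proof (cases "c = 0")
  case True
  then show ?thesis using real_rooted_linear[of b] by simp
next
  case False
  show ?thesis
  proof (rule real_rootedI)
    fix z :: complex assume z: "Im z > 0"
    show "poly (map_poly of_real [:1, b, c:]) z \<noteq> 0"
    proof
      assume "poly (map_poly of_real [:1, b, c:]) z = 0"
      then have eq: "1 + of_real b * z + of_real c * z * z = 0"
        by (simp add: map_poly_pCons algebra_simps)
      have im: "Im z * (b + 2 * c * Re z) = 0" and re: "1 + b * Re z + c * ((Re z)\<^sup>2 - (Im z)\<^sup>2) = 0"
        using arg_cong[OF eq, of Im] arg_cong[OF eq, of Re] by (auto simp: algebra_simps power2_eq_square)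
      have b: "b = - 2 * c * Re z" using im z by auto
      have "1 = c * ((Re z)\<^sup>2 + (Im z)\<^sup>2)" using re unfolding b by (simp add: algebra_simps power2_eq_square)
      then have "4 * c = 4 * c * (c * ((Re z)\<^sup>2 + (Im z)\<^sup>2))" by simp
      also have "\<dots> = b\<^sup>2 + 4 * (c * Im z)\<^sup>2" by (simp add: b algebra_simps power2_eq_square)
      finally have "4 * (c * Im z)\<^sup>2 \<le> 0" using assms by simp
      then show False using False z by simp
    qed
  qed
qed

lemma real_rooted_scale_linear:
  assumes "\<alpha> > 0" "b > 0" "d \<noteq> 0" and N: "N = [:\<alpha>, -c:] * smult d [:b, 1:]"
  shows "real_rooted (scale_poly N (gegenbauer k m))"
proof -
  define g where "g = scale_poly [:\<alpha>, -c:] (gegenbauer k m)"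
  have "g = smult \<alpha> (gegenbauer k m) - smult c (euler_op (gegenbauer k m))"
    by (rule poly_eqI) (simp add: g_def coeff_scale_poly algebra_simps)
  then have g: "real_rooted g"
    using real_rooted_euler_linear[OF gegenbauer_zeros \<open>\<alpha> > 0\<close>] by simp
  have "scale_poly N (gegenbauer k m) = smult d (euler_op g + smult b g)"
    by (rule poly_eqI) (simp add: g_def N coeff_scale_poly algebra_simps)
  then show ?thesis using real_rooted_euler_add[OF g \<open>b > 0\<close>] assms by (simp add: real_rooted_smult)
qed

lemma gamma_coeff_nonneg_half:
  assumes h: "h = k div 2" and k: "k \<ge> 2" and m: "m \<ge> 1"
    and l: "l * (real m + 1) \<le> weight k (Suc m)" "l * (real k + 1) \<le> weight k (Suc m)"
  shows "gamma_coeff k m l h \<ge> 0"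
  using weight_sum_ge[OF assms] h k by (auto simp: gamma_coeff_def gamma_rat_def)

lemma numer_poly_1: "numer_poly k (Suc 0) C = [:1, - C:]"
  by (simp add: numer_poly_def numer_term_def)

lemma numer_poly_2: "numer_poly k 2 C = [:2, real k + 2 - 2 * C, - C:]"
proof -
  have "{Suc 0..2} = {1, 2::nat}" by auto
  moreover have "{Suc 0, 2} - {0, Suc 0} = {2::nat}" by auto
  ultimately show ?thesis
    by (simp add: numer_poly_def numer_term_def weight_2)
qed

text \<open>For \<open>m \<le> 2\<close> the multiplier has degree at most 2 and no uncontrolled
  quadratic factor is left: besides the zero beyond \<open>k div 2\<close> there is at most one
  more, and it is negative.\<close>

lemma gamma_sp_real_rooted_m_le_2:
  assumes k: "k \<ge> 2" and m: "m = 1 \<or> m = 2" and l: "l \<ge> 0"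
    and l1: "l * (real m + 1) \<le> weight k (Suc m)" and l2: "l * (real k + 1) \<le> weight k (Suc m)"
  shows "real_rooted (gamma_sp k m l) \<and> (\<forall>i\<le>k div 2. gamma_coeff k m l i \<ge> 0)"
proof -
  define C where "C = 2 * l / real k"
  define N where "N = numer_poly k m C"
  define h where "h = k div 2"
  have h: "h \<ge> 1" using k by (auto simp: h_def)
  have C0: "C \<ge> 0" using l by (simp add: C_def)
  have hN: "poly N (real h) \<ge> 0"
    unfolding N_def using poly_numer_poly_pos[of "real h" m k C] weight_sum_ge[OF h_def _ _ l1 l2] k m h
    by (auto simp: C_def prod_nonneg)
  have "real_rooted (scale_poly N (gegenbauer k m)) \<and> (\<forall>i\<le>k div 2. poly N (real i) \<ge> 0)"
    using m
  proof
    assume m: "m = 1"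
    have N: "N = [:1, - C:]" using m by (simp add: N_def numer_poly_1)
    have "scale_poly N (gegenbauer k m) = smult 1 (gegenbauer k m) - smult C (euler_op (gegenbauer k m))"
      by (rule poly_eqI) (simp add: N coeff_scale_poly algebra_simps)
    then have "real_rooted (scale_poly N (gegenbauer k m))"
      using real_rooted_euler_linear[OF gegenbauer_zeros zero_less_one] by simp
    moreover have "poly N (real i) \<ge> 0" if "i \<le> k div 2" for i
    proof -
      have "C * real i \<le> C * real h" using that C0 by (intro mult_left_mono) (auto simp: h_def)
      then show ?thesis using hN by (simp add: N mult.commute)
    qed
    ultimately show ?thesis by blast
  next
    assume m: "m = 2"
    have N: "N = [:2, real k + 2 - 2 * C, - C:]" using m by (simp add: N_def numer_poly_2)
    show ?thesis
    proof (cases "C = 0")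
      case True
      have "(real k + 2) * (2 / (real k + 2)) = 2"
        by (rule nonzero_mult_div_cancel_left[of "real k + 2" 2, unfolded times_divide_eq_right[symmetric]]) simp
      then have "N = [:1, -0:] * smult (real k + 2) [:2 / (real k + 2), 1:]"
        using True by (simp add: N del: times_divide_eq_right)
      then have "real_rooted (scale_poly N (gegenbauer k m))"
        by (intro real_rooted_scale_linear[of 1 "2 / (real k + 2)" "real k + 2" N 0]) auto
      then show ?thesis using True by (simp add: N)
    next
      case False
      then have C: "C > 0" using C0 by simp
      have lc: "lead_coeff N < 0" using C by (simp add: N)
      obtain r where r: "r \<ge> real h" "poly N r = 0" using poly_root_ge[OF lc hN] by auto
      have r0: "r > 0" using r h by linarith
      \<comment> \<open>The two zeros of \<open>N\<close> have product \<open>- 2 / C\<close>, so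
        the other one is \<open>- b\<close>.\<close>
      define b where "b = 2 / (C * r)"
      have b: "b > 0" using C r0 by (simp add: b_def)
      have e: "2 + r * (real k + 2 - 2 * C) - C * r * r = 0" using r(2) by (simp add: N algebra_simps)
      have b2: "C * r * b = 2" using C r0 by (simp add: b_def)
      have "r * (C * r - C * b) = r * (real k + 2 - 2 * C)"
        using e b2 by (simp add: algebra_simps)
      then have "C * r - C * b = real k + 2 - 2 * C" using r0 by simp
      then have Nf: "N = [:C * r, - C:] * smult 1 [:b, 1:]"
        using b2 by (simp add: N algebra_simps)
      have "real_rooted (scale_poly N (gegenbauer k m))"
        using C r0 b by (intro real_rooted_scale_linear[OF _ _ _ Nf]) auto
      moreover have "poly N (real i) \<ge> 0" if "i \<le> k div 2" for i
      proof -
        have "real i \<le> r" using that r(1) by (simp add: h_def)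
        then have "C * (r - real i) * (b + real i) \<ge> 0" using C b by simp
        then show ?thesis by (simp add: Nf algebra_simps)
      qed
      ultimately show ?thesis by blast
    qed
  qed
  then show ?thesis
    using gamma_sp_scale[of m k l] gamma_coeff_nonneg[of m _ k l] m
    by (auto simp: N_def C_def real_rooted_smult)
qed

section \<open>Ranks two to five by discriminants\<close>

lemma weight_4_expand: "weight 4 s = real s * (real s + 1) * (real s + 2) * (real s + 3) / 24"
  by (simp add: weight_def pochhammer_expand fact_numeral)

lemma weight_5_expand: "weight 5 s = real s * (real s + 1) * (real s + 2) * (real s + 3) * (real s + 4) / 120"
  by (simp add: weight_def pochhammer_expand fact_numeral)

lemma gamma_rat_1:
  assumes "k \<ge> 2"
  shows "gamma_rat k m C 1 = (weight k (Suc m) / (real m + 1) - 1) / (real k - 1) - C / 2"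
  using weight_sum_telescope[OF assms, of m] by (simp add: gamma_rat_def)

lemma gamma_rat_4_2: "gamma_rat 4 m C 2 = real m * (real m + 1) * (real m + 5) / 72 - C / 3"
proof -
  have "(\<Sum>s\<in>{1..m}. weight 4 s / ((real s + 1) * (real s + 2))) = real m * (real m + 1) * (real m + 5) / 72"
  proof (induction m)
    case (Suc m)
    have t: "weight 4 (Suc m) / ((real (Suc m) + 1) * (real (Suc m) + 2)) = (real m + 1) * (real m + 4) / 24"
      by (simp add: weight_4_expand divide_simps) (simp add: algebra_simps)
    show ?case unfolding sum.cl_ivl_Suc t using Suc by (simp add: field_simps)
  qed simp
  then show ?thesis by (simp add: gamma_rat_def add_ac)
qed

lemma gamma_rat_5_2:
  "gamma_rat 5 m C 2 = real m * (real m + 1) * (3 * (real m)\<^sup>2 + 31 * real m + 86) / 1440 - C / 3"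
proof -
  have "(\<Sum>s\<in>{1..m}. weight 5 s / ((real s + 1) * (real s + 2)))
      = real m * (real m + 1) * (3 * (real m)\<^sup>2 + 31 * real m + 86) / 1440"
  proof (induction m)
    case (Suc m)
    have t: "weight 5 (Suc m) / ((real (Suc m) + 1) * (real (Suc m) + 2)) = (real m + 1) * (real m + 4) * (real m + 5) / 120"
      by (simp add: weight_5_expand divide_simps) (simp add: algebra_simps)
    show ?case unfolding sum.cl_ivl_Suc t using Suc by (simp add: field_simps power2_eq_square)
  qed simp
  then show ?thesis by (simp add: gamma_rat_def add_ac)
qed

text \<open>In rank 4 both nonconstant gamma coefficients are 12 times the \<open>gamma_rat\<close>
  values, and the second inequality is the discriminant condition
  \<open>144 R^2 \<ge> 48 R'\<close>. Eliminating \<open>l\<close> in favour of \<open>R\<close>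
  leaves one polynomial in \<open>M\<close> to compare with.\<close>

lemma gamma_rat_cond_4:
  assumes m: "m \<ge> 1"
    and l1: "l * (real m + 1) \<le> weight 4 (Suc m)" and l2: "l * 5 \<le> weight 4 (Suc m)"
  shows "gamma_rat 4 m (l / 2) 1 \<ge> 0" "3 * (gamma_rat 4 m (l / 2) 1)\<^sup>2 \<ge> gamma_rat 4 m (l / 2) 2"
proof -
  define M where "M = real m"
  define X where "X = (M + 2) * (M + 3) * (M + 4) / 24"
  define R where "R = gamma_rat 4 m (l / 2) 1"
  have w: "weight 4 (Suc m) = (M + 1) * X" by (simp add: weight_4_expand M_def X_def add_ac)
  have M: "M \<ge> 1" using m by (simp add: M_def)
  have R: "R = (X - 1) / 3 - l / 4" using gamma_rat_1[of 4 m "l / 2"] M by (simp add: w R_def flip: M_def)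
  have lX: "l \<le> X" using l1 M unfolding w by (simp add: mult.commute flip: M_def)
  have lX': "l \<le> (M + 1) * X / 5" using l2 unfolding w by simp
  have R1: "R \<ge> X / 12 - 1 / 3" unfolding R using lX by (simp add: field_simps)
  have X24: "24 * X = M ^ 3 + 9 * M\<^sup>2 + 26 * M + 24"
    by (simp add: X_def algebra_simps power2_eq_square power3_eq_cube)
  show R0: "R \<ge> 0"
  proof (cases "m = 1")
    \<comment> \<open>The bound \<open>R1\<close> is negative at \<open>m = 1\<close>; the bound on
      \<open>l\<close> with \<open>k + 1 = 5\<close> is sharp enough.\<close>
    case True
    then have "M = 1" by (simp add: M_def)
    then show ?thesis using R lX' by (simp add: X_def)
  next
    case False
    then have M2: "M \<ge> 2" using m by (simp add: M_def)
    then have "M\<^sup>2 \<ge> 2\<^sup>2" "M ^ 3 \<ge> 2 ^ 3" by (intro power_mono; simp)+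
    then have "X \<ge> 4" using X24 M2 by simp
    then show ?thesis using R1 by simp
  qed
  have R2: "gamma_rat 4 m (l / 2) 2 = (M ^ 3 - 37 * M) / 216 + 2 / 3 * R"
  proof -
    have "gamma_rat 4 m (l / 2) 2 = M * (M + 1) * (M + 5) / 72 - l / 6"
      by (simp add: gamma_rat_4_2 M_def)
    also have "M * (M + 1) * (M + 5) = M ^ 3 + 6 * M\<^sup>2 + 5 * M"
      by (simp add: algebra_simps power2_eq_square power3_eq_cube)
    finally have g: "gamma_rat 4 m (l / 2) 2 = (M ^ 3 + 6 * M\<^sup>2 + 5 * M) / 72 - l / 6" .
    have "X = (M ^ 3 + 9 * M\<^sup>2 + 26 * M + 24) / 24" using X24 by simp
    then have lM: "l = 4 * (((M ^ 3 + 9 * M\<^sup>2 + 26 * M + 24) / 24 - 1) / 3 - R)" using R by simp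
    have "(M ^ 3 + 6 * M\<^sup>2 + 5 * M) / 72 - 4 * (((M ^ 3 + 9 * M\<^sup>2 + 26 * M + 24) / 24 - 1) / 3 - R) / 6
       = (M ^ 3 - 37 * M) / 216 + 2 / 3 * R"
      by (simp add: field_simps)
    then show ?thesis unfolding g lM[symmetric] .
  qed
  show "3 * R\<^sup>2 \<ge> gamma_rat 4 m (l / 2) 2"
  proof (cases "m \<le> 5")
    case True
    \<comment> \<open>The minimum of \<open>3 R^2 - 2 R / 3\<close> is \<open>- 1 / 27\<close>. The
      cubic in \<open>M\<close> stays below it for \<open>m \<le> 5\<close> but not at
      \<open>m = 6\<close>, from where on \<open>R\<close> itself is large.\<close>
    have "3 * R\<^sup>2 - 2 / 3 * R = 3 * (R - 1 / 9)\<^sup>2 - 1 / 27" by (simp add: power2_eq_square algebra_simps)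
    then have "3 * R\<^sup>2 - 2 / 3 * R \<ge> - 1 / 27" by simp
    moreover have "(M ^ 3 - 37 * M) / 216 \<le> - 1 / 27"
    proof -
      have "m = 1 \<or> m = 2 \<or> m = 3 \<or> m = 4 \<or> m = 5" using True m by linarith
      then show ?thesis by (auto simp: M_def)
    qed
    ultimately show ?thesis unfolding R2 by linarith
  next
    case False
    then have M6: "M \<ge> 6" by (simp add: M_def)
    have "M\<^sup>2 \<ge> 6\<^sup>2" "M ^ 3 \<ge> 6 ^ 3" using M6 by (intro power_mono; simp)+
    then have "R \<ge> M ^ 3 / 288" using R1 X24 M6 by simp
    moreover from this have R2': "R \<ge> 3 / 4" using \<open>M ^ 3 \<ge> 6 ^ 3\<close> by simp
    have "R * (3 * R - 2 / 3) \<ge> R * (3 * (3 / 4) - 2 / 3)" using R2' by (intro mult_left_mono) auto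
    then have "3 * R\<^sup>2 - 2 / 3 * R \<ge> 19 / 12 * R" by (simp add: power2_eq_square algebra_simps)
    ultimately have "3 * R\<^sup>2 - 2 / 3 * R \<ge> 19 / 12 * (M ^ 3 / 288)" by simp
    moreover have "(M ^ 3 - 37 * M) / 216 \<le> 19 / 12 * (M ^ 3 / 288)" using M6 \<open>M ^ 3 \<ge> 6 ^ 3\<close> by simp
    ultimately show ?thesis unfolding R2 by linarith
  qed
qed

text \<open>The rank 5 analogue: the coefficients are \<open>20 R\<close> and \<open>60 R'\<close>,
  so the discriminant condition is \<open>5 R^2 \<ge> 3 R'\<close>.\<close>

lemma gamma_rat_cond_5:
  assumes m: "m \<ge> 1"
    and l1: "l * (real m + 1) \<le> weight 5 (Suc m)" and l2: "l * 6 \<le> weight 5 (Suc m)"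
  shows "gamma_rat 5 m (2 * l / 5) 1 \<ge> 0"
    "5 * (gamma_rat 5 m (2 * l / 5) 1)\<^sup>2 \<ge> 3 * gamma_rat 5 m (2 * l / 5) 2"
proof -
  define M where "M = real m"
  define X where "X = (M + 2) * (M + 3) * (M + 4) * (M + 5) / 120"
  define R where "R = gamma_rat 5 m (2 * l / 5) 1"
  have w: "weight 5 (Suc m) = (M + 1) * X" by (simp add: weight_5_expand M_def X_def add_ac)
  have M: "M \<ge> 1" using m by (simp add: M_def)
  have R: "R = (X - 1) / 4 - l / 5" using gamma_rat_1[of 5 m "2 * l / 5"] M by (simp add: w R_def flip: M_def)
  have lX: "l \<le> X" using l1 M unfolding w by (simp add: mult.commute flip: M_def)
  have lX': "l \<le> (M + 1) * X / 6" using l2 unfolding w by simp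
  have R1: "R \<ge> X / 20 - 1 / 4" unfolding R using lX by (simp add: field_simps)
  have X120: "120 * X = M ^ 4 + 14 * M ^ 3 + 71 * M\<^sup>2 + 154 * M + 120"
    by (simp add: X_def algebra_simps power2_eq_square power3_eq_cube power4_eq_xxxx)
  show R0: "R \<ge> 0"
  proof (cases "m = 1")
    case True
    then have "M = 1" by (simp add: M_def)
    then show ?thesis using R lX' by (simp add: X_def)
  next
    case False
    then have M2: "M \<ge> 2" using m by (simp add: M_def)
    then have "M\<^sup>2 \<ge> 2\<^sup>2" "M ^ 3 \<ge> 2 ^ 3" "M ^ 4 \<ge> 2 ^ 4" by (intro power_mono; simp)+
    then have "X \<ge> 5" using X120 M2 by simp
    then show ?thesis using R1 by simp
  qed
  have R2: "3 * gamma_rat 5 m (2 * l / 5) 2 = (M ^ 4 + 6 * M ^ 3 - 25 * M\<^sup>2 - 222 * M) / 480 + 2 * R"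
  proof -
    have "3 * gamma_rat 5 m (2 * l / 5) 2 = M * (M + 1) * (3 * M\<^sup>2 + 31 * M + 86) / 480 - 2 * l / 5"
      by (simp add: gamma_rat_5_2 M_def)
    also have "M * (M + 1) * (3 * M\<^sup>2 + 31 * M + 86) = 3 * M ^ 4 + 34 * M ^ 3 + 117 * M\<^sup>2 + 86 * M"
      by (simp add: algebra_simps power2_eq_square power3_eq_cube power4_eq_xxxx)
    finally have g: "3 * gamma_rat 5 m (2 * l / 5) 2
      = (3 * M ^ 4 + 34 * M ^ 3 + 117 * M\<^sup>2 + 86 * M) / 480 - 2 * l / 5" .
    have "X = (M ^ 4 + 14 * M ^ 3 + 71 * M\<^sup>2 + 154 * M + 120) / 120" using X120 by simp
    then have lM: "l = 5 * (((M ^ 4 + 14 * M ^ 3 + 71 * M\<^sup>2 + 154 * M + 120) / 120 - 1) / 4 - R)" using R by simp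
    have "(3 * M ^ 4 + 34 * M ^ 3 + 117 * M\<^sup>2 + 86 * M) / 480
        - 2 * (5 * (((M ^ 4 + 14 * M ^ 3 + 71 * M\<^sup>2 + 154 * M + 120) / 120 - 1) / 4 - R)) / 5
       = (M ^ 4 + 6 * M ^ 3 - 25 * M\<^sup>2 - 222 * M) / 480 + 2 * R"
      by (simp add: field_simps)
    then show ?thesis unfolding g lM[symmetric] .
  qed
  show "5 * R\<^sup>2 \<ge> 3 * gamma_rat 5 m (2 * l / 5) 2"
  proof (cases "m \<le> 5")
    case True
    have "5 * R\<^sup>2 - 2 * R = 5 * (R - 1 / 5)\<^sup>2 - 1 / 5" by (simp add: power2_eq_square algebra_simps)
    then have "5 * R\<^sup>2 - 2 * R \<ge> - 1 / 5" by simp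
    moreover have "(M ^ 4 + 6 * M ^ 3 - 25 * M\<^sup>2 - 222 * M) / 480 \<le> - 1 / 5"
    proof -
      have "m = 1 \<or> m = 2 \<or> m = 3 \<or> m = 4 \<or> m = 5" using True m by linarith
      then show ?thesis by (auto simp: M_def)
    qed
    ultimately show ?thesis unfolding R2 by linarith
  next
    case False
    then have M6: "M \<ge> 6" by (simp add: M_def)
    have p: "M\<^sup>2 \<ge> 6\<^sup>2" "M ^ 3 \<ge> 6 ^ 3" "M ^ 4 \<ge> 6 ^ 4" using M6 by (intro power_mono; simp)+
    have Rl: "R \<ge> (M ^ 4 + 6 * M ^ 3) / 2400" using R1 X120 M6 p by simp
    have "R \<ge> 3 / 2" using R1 X120 M6 p by simp
    then have "R * (5 * R - 2) \<ge> R * (11 / 2)" by (intro mult_left_mono) auto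
    moreover have "R * (5 * R - 2) = 5 * R\<^sup>2 - 2 * R" by (simp add: power2_eq_square algebra_simps)
    moreover have "(M ^ 4 + 6 * M ^ 3 - 25 * M\<^sup>2 - 222 * M) / 480 \<le> 11 / 2 * ((M ^ 4 + 6 * M ^ 3) / 2400)"
      using M6 p by simp
    ultimately show ?thesis unfolding R2 using Rl by linarith
  qed
qed

lemma gamma_sp_degree_le_2:
  assumes "k div 2 \<le> 2"
  shows "gamma_sp k m l = [:1, if k < 2 then 0 else gamma_coeff k m l 1, if k < 4 then 0 else gamma_coeff k m l 2:]"
proof (rule poly_eqI)
  fix i :: nat
  have "i = 0 \<or> i = 1 \<or> i = 2 \<or> i \<ge> 3" by linarith
  moreover have "2 \<le> k div 2 \<longleftrightarrow> \<not> k < 4" "1 \<le> k div 2 \<longleftrightarrow> \<not> k < 2" by linarith+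
  ultimately show "coeff (gamma_sp k m l) i = coeff [:1, if k < 2 then 0 else gamma_coeff k m l 1, if k < 4 then 0 else gamma_coeff k m l 2:] i"
    using assms by (auto simp: coeff_gamma_sp gamma_coeff_def[of k m l 0] numeral_2_eq_2 coeff_pCons split: nat.split)
qed

lemma gamma_sp_real_rooted_small:
  assumes k: "2 \<le> k" "k < 6" and m: "m \<ge> 1"
    and l1: "l * (real m + 1) \<le> weight k (Suc m)" and l2: "l * (real k + 1) \<le> weight k (Suc m)"
  shows "real_rooted (gamma_sp k m l) \<and> (\<forall>i\<le>k div 2. gamma_coeff k m l i \<ge> 0)"
proof -
  have kh: "k div 2 \<le> 2" using k by auto
  note G = gamma_sp_degree_le_2[OF kh, of m l]
  have half: "gamma_coeff k m l (k div 2) \<ge> 0"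
    by (rule gamma_coeff_nonneg_half[OF refl k(1) m l1 l2])
  have g0: "gamma_coeff k m l 0 = 1" by (simp add: gamma_coeff_def)
  have "k = 2 \<or> k = 3 \<or> k = 4 \<or> k = 5" using k by linarith
  then consider "k < 4" | "k = 4" | "k = 5" by linarith
  then show ?thesis
  proof cases
    case 1
    then have "k div 2 = 1" using k by auto
    then have "gamma_coeff k m l i \<ge> 0" if "i \<le> k div 2" for i
      using half g0 that le_Suc_eq[of i 0] by auto
    moreover have "real_rooted (gamma_sp k m l)"
      using G 1 k real_rooted_linear by simp
    ultimately show ?thesis by blast
  next
    case 2
    have g1: "gamma_coeff k m l 1 = 12 * gamma_rat 4 m (l / 2) 1"
      and g2: "gamma_coeff k m l 2 = 12 * gamma_rat 4 m (l / 2) 2"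
      using 2 by (simp_all add: gamma_coeff_def fact_numeral)
    have c: "gamma_rat 4 m (l / 2) 1 \<ge> 0" "3 * (gamma_rat 4 m (l / 2) 1)\<^sup>2 \<ge> gamma_rat 4 m (l / 2) 2"
      using gamma_rat_cond_4[OF m] l1 l2 2 by auto
    have "(gamma_coeff k m l 1)\<^sup>2 \<ge> 4 * gamma_coeff k m l 2"
      unfolding g1 g2 using c(2) by (simp add: power_mult_distrib)
    then have "real_rooted (gamma_sp k m l)"
      using G 2 real_rooted_quadratic by simp
    moreover have "gamma_coeff k m l i \<ge> 0" if "i \<le> k div 2" for i
    proof -
      have "i = 0 \<or> i = 1 \<or> i = 2" using that 2 by auto
      then show ?thesis using half g0 g1 c(1) 2 by auto
    qed
    ultimately show ?thesis by blast
  next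
    case 3
    have g1: "gamma_coeff k m l 1 = 20 * gamma_rat 5 m (2 * l / 5) 1"
      and g2: "gamma_coeff k m l 2 = 60 * gamma_rat 5 m (2 * l / 5) 2"
      using 3 by (simp_all add: gamma_coeff_def fact_numeral)
    have c: "gamma_rat 5 m (2 * l / 5) 1 \<ge> 0"
      "5 * (gamma_rat 5 m (2 * l / 5) 1)\<^sup>2 \<ge> 3 * gamma_rat 5 m (2 * l / 5) 2"
      using gamma_rat_cond_5[OF m] l1 l2 3 by auto
    have "(gamma_coeff k m l 1)\<^sup>2 \<ge> 4 * gamma_coeff k m l 2"
      unfolding g1 g2 using c(2) by (simp add: power_mult_distrib)
    then have "real_rooted (gamma_sp k m l)"
      using G 3 real_rooted_quadratic by simp
    moreover have "gamma_coeff k m l i \<ge> 0" if "i \<le> k div 2" for i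
    proof -
      have "i = 0 \<or> i = 1 \<or> i = 2" using that 3 by auto
      then show ?thesis using half g0 g1 c(1) 3 by auto
    qed
    ultimately show ?thesis by blast
  qed
qed

theorem gamma_sp_real_rooted:
  assumes k: "2 \<le> k" and m: "m \<ge> 1" and l: "l \<ge> 0"
    and l1: "l * (real m + 1) \<le> real (m + k choose k)" and l2: "l * (real k + 1) \<le> real (m + k choose k)"
  shows "real_rooted (gamma_sp k m l)" "\<And>i. i \<le> k div 2 \<Longrightarrow> gamma_coeff k m l i \<ge> 0"
proof -
  note l' = l1[folded weight_binomial] l2[folded weight_binomial]
  have "m = 1 \<or> m = 2 \<or> k < 6 \<or> (k \<ge> 6 \<and> m \<ge> 3)" using m by linarith
  then have "real_rooted (gamma_sp k m l) \<and> (\<forall>i\<le>k div 2. gamma_coeff k m l i \<ge> 0)"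
    using gamma_sp_real_rooted_m_le_2[OF k _ l l'] gamma_sp_real_rooted_small[OF k _ m l']
      gamma_sp_real_rooted_large[OF _ _ l l'] by blast
  then show "real_rooted (gamma_sp k m l)" "\<And>i. i \<le> k div 2 \<Longrightarrow> gamma_coeff k m l i \<ge> 0" by auto
qed

section \<open>Uniform matroids\<close>

definition kl_sum :: "nat \<Rightarrow> nat \<Rightarrow> nat \<Rightarrow> real" where
  "kl_sum k i m = (\<Sum>h<m. fact (k - i + h) * pochhammer (real i) h / (fact (h + i + 1) * fact h))"

text \<open>This combination of the two sums has a closed form in \<open>m\<close>, verified one
  summand at a time. It is exactly what Pascal's rule leaves over in
  \<open>kl_coeff_rec\<close>.\<close>

lemma kl_sum_telescope:
  assumes "1 \<le> i" "2 * i \<le> k"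
  shows "real (k - 2 * i) * kl_sum k i (Suc m) + kl_sum (k - 1) (i - 1) (Suc m)
       = fact (k - i + Suc m) * pochhammer (real i) m / (fact m * fact (m + i + 1))"
proof (induction m)
  case 0
  have "k - 1 - (i - 1) = k - i" using assms by auto
  then have 1: "kl_sum k i (Suc 0) = fact (k - i) / fact (i + 1)"
    "kl_sum (k - 1) (i - 1) (Suc 0) = fact (k - i) / fact i"
    using assms by (simp_all add: kl_sum_def)
  have 2: "(fact (i + 1) :: real) = (real i + 1) * fact i"
    "(fact (k - i + Suc 0) :: real) = (real (k - 2 * i) + (real i + 1)) * fact (k - i)"
    using assms by (simp_all add: of_nat_diff)
  have "d * (F / (I * f)) + F / f = (d + I) * F / (I * f)" if "I > 0" "f > 0" for d F I f :: real
    using that by (simp add: add_divide_distrib distrib_right)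
  from this[of "real i + 1" "fact i"] show ?case
    unfolding 1 2 by simp
next
  case (Suc m)
  define h where "h = Suc m"
  have e: "k - 1 - (i - 1) = k - i" using assms by auto
  have r1: "real (k - 2 * i) = real k - 2 * real i" "real (k - i) = real k - real i"
    "real (i - 1) = real i - 1" using assms by (simp_all add: of_nat_diff)
  have p1: "pochhammer (real i) h = pochhammer (real i) m * (real i + real m)"
    by (simp add: h_def pochhammer_Suc)
  have p2: "pochhammer (real (i - 1)) h = (real i - 1) * pochhammer (real i) m"
    using r1 by (simp add: h_def pochhammer_rec)
  have f1: "(fact (h + i + 1) :: real) = (real h + real i + 1) * fact (h + i)"
    by simp
  have f2: "(fact h :: real) = real h * fact m" by (simp add: h_def)
  have f3: "(fact (k - i + Suc h) :: real) = (real k - real i + real h + 1) * fact (k - i + h)"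
    using r1 by (simp add: algebra_simps)
  have ih: "h + (i - 1) + 1 = h + i" using assms by simp
  have mh: "m + i + 1 = h + i" by (simp add: h_def)
  let ?F = "fact (k - i + h) :: real" and ?p = "pochhammer (real i) m"
  have IH: "real (k - 2 * i) * kl_sum k i (Suc m) + kl_sum (k - 1) (i - 1) (Suc m) = ?F * ?p / (fact m * fact (h + i))"
    using Suc.IH unfolding mh h_def .
  have s1: "kl_sum k i (Suc h) = kl_sum k i h + ?F * pochhammer (real i) h / (fact (h + i + 1) * fact h)"
    by (simp add: kl_sum_def)
  have s2: "kl_sum (k - 1) (i - 1) (Suc h) = kl_sum (k - 1) (i - 1) h + ?F * pochhammer (real (i - 1)) h / (fact (h + i) * fact h)"
    unfolding kl_sum_def sum.lessThan_Suc e ih ..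
  have "real (k - 2 * i) * kl_sum k i (Suc h) + kl_sum (k - 1) (i - 1) (Suc h)
      = (real (k - 2 * i) * kl_sum k i (Suc m) + kl_sum (k - 1) (i - 1) (Suc m))
        + (real (k - 2 * i) * (?F * pochhammer (real i) h / (fact (h + i + 1) * fact h))
        + ?F * pochhammer (real (i - 1)) h / (fact (h + i) * fact h))"
    unfolding s1 s2 h_def[symmetric] by (simp only: ring_distribs add_ac)
  also have "\<dots> = ?F * ?p / (fact m * fact (h + i))
        + ((real k - 2 * real i) * (?F * (?p * (real i + real m)) / ((real h + real i + 1) * fact (h + i) * (real h * fact m)))
        + ?F * ((real i - 1) * ?p) / (fact (h + i) * (real h * fact m)))"
    unfolding IH p1 p2 f1 f2 unfolding r1 ..
  also have "\<dots> = (real k - real i + real h + 1) * ?F * (?p * (real i + real m)) / (real h * fact m * ((real h + real i + 1) * fact (h + i)))"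
  proof -
    \<comment> \<open>Factorials and Pochhammer symbols are replaced by free variables, so that only
      an identity of rational functions remains.\<close>
    have gen: "F * p / (fm * fh) + ((K - 2 * I) * (F * (p * (I + M)) / ((H + I + 1) * fh * (H * fm))) + F * ((I - 1) * p) / (fh * (H * fm)))
      = (K - I + H + 1) * F * (p * (I + M)) / (H * fm * ((H + I + 1) * fh))"
      if "fm > 0" "fh > 0" "H = M + 1" "M \<ge> 0" "I \<ge> 1" for F p fm fh K I H M :: real
      using that by (simp add: divide_simps) (simp add: algebra_simps)
    show ?thesis using assms by (intro gen) (auto simp: h_def)
  qed
  also have "\<dots> = fact (k - i + Suc h) * pochhammer (real i) h / (fact h * fact (h + i + 1))"
    unfolding f1 f2 f3 p1 by (simp only: mult_ac)
  finally show ?case by (simp only: h_def)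
qed

text \<open>For \<open>0 < 2 i < k\<close> this is the binomial formula for the Kazhdan-Lusztig
  coefficients of the uniform matroid of rank \<open>k\<close> on \<open>k + m\<close> elements:
  \<open>C(k + m, i) / (k - i)\<close> times the sum over \<open>h < m\<close> of
  \<open>C(k - i + h, h + i + 1) C(i - 1 + h, h)\<close>. Keeping \<open>k - 2 i\<close> as a factor
  yields 0 at \<open>2 i = k\<close>.\<close>

definition kl_coeff :: "nat \<Rightarrow> nat \<Rightarrow> nat \<Rightarrow> real" where
  "kl_coeff k m i = (if i = 0 then 1 else if 2 * i \<le> k
     then real (k + m choose i) * real (k - 2 * i) / (real (k - i) * fact (k - 2 * i)) * kl_sum k i m else 0)"

text \<open>A hypergeometric term with two roles: it is the inhomogeneous part of the recursion for
  \<open>kl_coeff\<close> and, by \<open>gamma_coeff_Suc\<close>, the increment of the gamma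
  coefficient from corank \<open>m\<close> to \<open>m + 1\<close>.\<close>

definition gamma_inc :: "nat \<Rightarrow> nat \<Rightarrow> nat \<Rightarrow> real" where
  "gamma_inc k m i = (if 1 \<le> i \<and> 2 * i \<le> k
     then fact (k + m) * pochhammer (real i) m / (fact m * fact (k - 2 * i) * fact i * fact (m + i + 1)) else 0)"

lemma kl_coeff_0_right: "kl_coeff k 0 i = (if i = 0 then 1 else 0)"
  by (simp add: kl_coeff_def kl_sum_def)

lemma kl_coeff_eq_0: "k > 0 \<Longrightarrow> k \<le> 2 * i \<Longrightarrow> kl_coeff k m i = 0"
  by (auto simp: kl_coeff_def)

lemma kl_coeff_pred:
  assumes "1 \<le> i" "2 * i \<le> k"
  shows "kl_coeff (k - 1) (Suc m) (i - 1)
     = real (k + m choose (i - 1)) / (real (k - i) * fact (k - 2 * i)) * kl_sum (k - 1) (i - 1) (Suc m)"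
proof (cases "i = 1")
  case True
  have "kl_sum (k - 1) 0 (Suc m) = fact (k - 1)"
    unfolding kl_sum_def by (subst sum.lessThan_Suc_shift) (auto simp: pochhammer_0_left)
  moreover have "(fact (k - 1) :: real) = real (k - 1) * fact (k - 2)"
    using assms True by (subst fact_reduce) (auto simp: numeral_2_eq_2)
  ultimately show ?thesis using True assms by (simp add: kl_coeff_def)
next
  case False
  have e: "k - 1 - 2 * (i - 1) = Suc (k - 2 * i)" "k - 1 - (i - 1) = k - i" "k - 1 + Suc m = k + m"
    using assms by auto
  have "2 * (i - 1) \<le> k - 1" "i - 1 \<noteq> 0" using assms False by auto
  then show ?thesis unfolding kl_coeff_def e by (simp del: of_nat_Suc)
qed

text \<open>The three pairs of parameters are those of a uniform matroid, its contraction and its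
  deletion by one element. Pascal's rule splits the binomial factor, and
  \<open>kl_sum_telescope\<close> collapses the two sums that remain.\<close>

lemma kl_coeff_rec:
  assumes k: "k \<ge> 2" and i: "i \<ge> 1"
  shows "kl_coeff k (Suc m) i + kl_coeff (k - 1) (Suc m) (i - 1) = kl_coeff k m i + gamma_inc k m i"
proof (cases "2 * i \<le> k")
  case False
  then have "kl_coeff (k - 1) (Suc m) (i - 1) = 0" using k by (intro kl_coeff_eq_0) auto
  then show ?thesis using False i by (simp add: kl_coeff_def gamma_inc_def)
next
  case True
  let ?n = "k + m"
  define d where "d = real (k - 2 * i)"
  define e where "e = real (k - i)"
  have e: "e > 0" "d + real i = e" using True i by (auto simp: e_def d_def of_nat_diff)
  let ?A = "kl_sum k i m" and ?A1 = "kl_sum k i (Suc m)" and ?B = "kl_sum (k - 1) (i - 1) (Suc m)"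
  define p where "p = pochhammer (real i) m / (fact m * fact (m + i + 1))"
  have A1: "?A1 = ?A + fact (k - i + m) * p"
    by (simp add: kl_sum_def p_def mult.commute)
  have T: "d * ?A1 + ?B = fact (k - i + Suc m) * p"
    using kl_sum_telescope[OF i True, of m] by (simp add: d_def p_def)
  have ni: "?n - i = k - i + m" "?n - (i - 1) = k - i + Suc m" using True i by auto
  have c1: "real (?n choose i) * fact (k - i + m) = fact ?n / fact i"
  proof -
    have "i \<le> ?n" using True by simp
    then have "real (?n choose i) * fact (?n - i) = fact ?n / fact i" by (simp add: binomial_fact)
    then show ?thesis unfolding ni .
  qed
  have c2: "real (?n choose (i - 1)) * fact (k - i + Suc m) = fact ?n * real i / fact i"
  proof -
    have "i - 1 \<le> ?n" using True by simp
    then have "real (?n choose (i - 1)) * fact (?n - (i - 1)) = fact ?n / fact (i - 1)"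
      by (simp add: binomial_fact)
    also have "\<dots> = fact ?n * real i / fact i"
      using i by (cases i) auto
    finally show ?thesis unfolding ni .
  qed
  have c3: "real (k + Suc m choose i) = real (?n choose i) + real (?n choose (i - 1))"
    using binomial_Suc_Suc[of ?n "i - 1"] i by simp
  have 1: "kl_coeff k (Suc m) i = real (k + Suc m choose i) * d * ?A1 / (e * fact (k - 2 * i))"
    "kl_coeff k m i = real (?n choose i) * d * ?A / (e * fact (k - 2 * i))"
    using True i by (simp_all add: kl_coeff_def d_def e_def)
  have 2: "kl_coeff (k - 1) (Suc m) (i - 1) = real (?n choose (i - 1)) * ?B / (e * fact (k - 2 * i))"
    using kl_coeff_pred[OF i True] by (simp add: e_def)
  have "kl_coeff k (Suc m) i + kl_coeff (k - 1) (Suc m) (i - 1) - kl_coeff k m i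
      = (real (?n choose i) * d * (?A1 - ?A) + real (?n choose (i - 1)) * (d * ?A1 + ?B)) / (e * fact (k - 2 * i))"
    unfolding 1 2 c3 by (simp add: algebra_simps add_divide_distrib diff_divide_distrib)
  also have "real (?n choose i) * d * (?A1 - ?A) = d * (real (?n choose i) * fact (k - i + m)) * p"
    unfolding A1 by simp
  also have "real (?n choose (i - 1)) * (d * ?A1 + ?B) = (real (?n choose (i - 1)) * fact (k - i + Suc m)) * p"
    unfolding T by simp
  also have "(d * (real (?n choose i) * fact (k - i + m)) * p + (real (?n choose (i - 1)) * fact (k - i + Suc m)) * p)
      = e * (fact ?n / fact i * p)"
    unfolding c1 c2 e(2)[symmetric] by (simp add: algebra_simps add_divide_distrib)
  also have "e * (fact ?n / fact i * p) / (e * fact (k - 2 * i)) = gamma_inc k m i"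
    using e True i by (simp add: gamma_inc_def p_def)
  finally show ?thesis by simp
qed

text \<open>The value 0 in rank 0, instead of 1, is a convention: it makes
  \<open>kl_unif_rec\<close> true for \<open>k = 1\<close>. The rank 0 contribution is added
  separately, as \<open>monom 1 k\<close> in \<open>z_unif\<close>.\<close>

definition kl_unif :: "nat \<Rightarrow> nat \<Rightarrow> real poly" where
  "kl_unif k m = (if k = 0 then 0 else (\<Sum>i\<le>k div 2. monom (kl_coeff k m i) i))"

lemma coeff_kl_unif: "k > 0 \<Longrightarrow> coeff (kl_unif k m) i = kl_coeff k m i"
  using kl_coeff_eq_0[of k i m] by (auto simp: kl_unif_def coeff_sum_monom)

definition gamma_inc_poly :: "nat \<Rightarrow> nat \<Rightarrow> real poly" where
  "gamma_inc_poly k m = (\<Sum>i\<le>k div 2. monom (gamma_inc k m i) i)"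

lemma coeff_gamma_inc_poly: "coeff (gamma_inc_poly k m) i = gamma_inc k m i"
  unfolding gamma_inc_poly_def coeff_sum_monom by (auto simp: gamma_inc_def)

lemma kl_unif_rec:
  assumes "k > 0"
  shows "kl_unif k (Suc m) + pCons 0 (kl_unif (k - 1) (Suc m)) = kl_unif k m + gamma_inc_poly k m"
proof (rule poly_eqI)
  fix i
  show "coeff (kl_unif k (Suc m) + pCons 0 (kl_unif (k - 1) (Suc m))) i = coeff (kl_unif k m + gamma_inc_poly k m) i"
  proof (cases "i = 0")
    case True
    then show ?thesis using assms
      by (simp add: coeff_kl_unif coeff_gamma_inc_poly kl_coeff_def gamma_inc_def)
  next
    case False
    then obtain j where j: "i = Suc j" by (cases i) auto
    show ?thesis
    proof (cases "k = 1")
      case True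
      then show ?thesis using False j
        by (simp add: coeff_kl_unif coeff_gamma_inc_poly kl_coeff_eq_0 gamma_inc_def kl_unif_def[of 0])
    next
      case False
      then have "k \<ge> 2" using assms by simp
      then show ?thesis using kl_coeff_rec[of k i m] j
        by (simp add: coeff_kl_unif coeff_gamma_inc_poly)
    qed
  qed
qed

text \<open>This is \<open>(1 + x)^k G(x / (1 + x)^2)\<close> with denominators cleared, where
  \<open>G\<close> has the coefficients \<open>g\<close>.\<close>

definition gamma_expand :: "nat \<Rightarrow> (nat \<Rightarrow> real) \<Rightarrow> real poly" where
  "gamma_expand k g = (\<Sum>i\<le>k div 2. smult (g i) (monom 1 i * [:1, 1:] ^ (k - 2 * i)))"

lemma coeff_one_plus_x_power: "coeff ([:1, 1::real:] ^ n) i = real (n choose i)"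
proof (cases "i \<le> n")
  case True
  then show ?thesis by (simp add: coeff_linear_poly_power)
next
  case False
  moreover have "degree ([:1, 1::real:] ^ n) \<le> n" using degree_power_le[of "[:1, 1::real:]" n] by simp
  ultimately show ?thesis by (simp add: coeff_eq_0 binomial_eq_0)
qed

lemma one_plus_x_power: "[:1, 1:] ^ n = (\<Sum>j\<le>n. monom (real (n choose j)) j)"
  by (rule poly_eqI) (simp add: coeff_sum_monom coeff_one_plus_x_power binomial_eq_0)

text \<open>The Z-polynomial of the uniform matroid: for \<open>j < k\<close> its flats of rank
  \<open>j\<close> are all \<open>j\<close>-subsets, with contractions uniform of rank
  \<open>k - j\<close> and the same corank \<open>m\<close>.\<close>

definition z_unif :: "nat \<Rightarrow> nat \<Rightarrow> real poly" where
  "z_unif k m = (\<Sum>j<k. monom (real (k + m choose j)) j * kl_unif (k - j) m) + monom 1 k"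

lemma smult_sum_right: "smult c (sum f A) = (\<Sum>x\<in>A. smult c (f x))"
  by (induction A rule: infinite_finite_induct) (simp_all add: smult_add_right)

text \<open>The factorials rearrange so that \<open>C(k + m, j)\<close> times
  \<open>gamma_inc (k - j) m i\<close> equals \<open>gamma_inc k m i\<close> times
  \<open>C(k - 2 i, j)\<close>. Summing over \<open>j\<close> then produces
  \<open>(1 + x)^(k - 2 i)\<close>.\<close>

lemma gamma_inc_expand:
  "(\<Sum>j<k. monom (real (k + m choose j)) j * gamma_inc_poly (k - j) m) = gamma_expand k (gamma_inc k m)"
proof -
  have t: "monom (real (k + m choose j)) j * monom (gamma_inc (k - j) m i) i
     = monom (gamma_inc k m i * real (k - 2 * i choose j)) (j + i)"
    if "j \<le> k - 2 * i" "1 \<le> i" "2 * i \<le> k" for i j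
  proof -
    define G where "G = pochhammer (real i) m / (fact m * fact i * fact (m + i + 1))"
    have le: "2 * i \<le> k - j" "k - j - 2 * i = k - 2 * i - j" using that by auto
    have b1: "real (k + m choose j) * fact (k - j + m) = fact (k + m) / fact j"
    proof -
      have e: "k + m - j = k - j + m" using that by simp
      have "j \<le> k + m" using that by simp
      then have "real (k + m choose j) * fact (k + m - j) = fact (k + m) / fact j"
        by (simp add: binomial_fact)
      then show ?thesis unfolding e .
    qed
    have b2: "real (k - 2 * i choose j) / fact (k - 2 * i) = 1 / (fact j * fact (k - 2 * i - j))"
      using that by (simp add: binomial_fact)
    have g1: "gamma_inc (k - j) m i = fact (k - j + m) * (G / fact (k - 2 * i - j))"
      unfolding gamma_inc_def G_def le(2) using that le(1) by simp
    have g2: "gamma_inc k m i = fact (k + m) * (G / fact (k - 2 * i))"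
      unfolding gamma_inc_def G_def using that by simp
    have "real (k + m choose j) * gamma_inc (k - j) m i
        = (real (k + m choose j) * fact (k - j + m)) * (G / fact (k - 2 * i - j))"
      unfolding g1 by simp
    also have "\<dots> = fact (k + m) * G * (1 / (fact j * fact (k - 2 * i - j)))"
      unfolding b1 by simp
    also have "\<dots> = gamma_inc k m i * real (k - 2 * i choose j)"
      unfolding b2[symmetric] g2 by simp
    finally show ?thesis by (simp add: mult_monom)
  qed
  have z: "gamma_inc (k - j) m i = 0" if "\<not> (1 \<le> i \<and> 2 * i \<le> k \<and> j \<le> k - 2 * i)" for i j
    using that by (auto simp: gamma_inc_def)
  have "(\<Sum>j<k. monom (real (k + m choose j)) j * gamma_inc_poly (k - j) m)
     = (\<Sum>j<k. \<Sum>i\<le>k div 2. monom (real (k + m choose j)) j * monom (gamma_inc (k - j) m i) i)"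
  proof (rule sum.cong[OF refl])
    fix j
    have "gamma_inc_poly (k - j) m = (\<Sum>i\<le>k div 2. monom (gamma_inc (k - j) m i) i)"
      unfolding gamma_inc_poly_def by (rule sum.mono_neutral_left) (auto simp: gamma_inc_def)
    then show "monom (real (k + m choose j)) j * gamma_inc_poly (k - j) m
       = (\<Sum>i\<le>k div 2. monom (real (k + m choose j)) j * monom (gamma_inc (k - j) m i) i)"
      by (simp add: sum_distrib_left)
  qed
  also have "\<dots> = (\<Sum>i\<le>k div 2. \<Sum>j<k. monom (real (k + m choose j)) j * monom (gamma_inc (k - j) m i) i)"
    by (rule sum.swap)
  also have "\<dots> = (\<Sum>i\<le>k div 2. smult (gamma_inc k m i) (monom 1 i * [:1, 1:] ^ (k - 2 * i)))"
  proof (rule sum.cong[OF refl])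
    fix i assume i: "i \<in> {..k div 2}"
    show "(\<Sum>j<k. monom (real (k + m choose j)) j * monom (gamma_inc (k - j) m i) i)
       = smult (gamma_inc k m i) (monom 1 i * [:1, 1:] ^ (k - 2 * i))"
    proof (cases "i = 0")
      case True
      then show ?thesis by (simp add: gamma_inc_def)
    next
      case False
      then have i: "1 \<le> i" "2 * i \<le> k" using i by auto
      have "(\<Sum>j<k. monom (real (k + m choose j)) j * monom (gamma_inc (k - j) m i) i)
          = (\<Sum>j\<le>k - 2 * i. monom (real (k + m choose j)) j * monom (gamma_inc (k - j) m i) i)"
      proof (rule sum.mono_neutral_right)
        show "\<forall>j\<in>{..<k} - {..k - 2 * i}. monom (real (k + m choose j)) j * monom (gamma_inc (k - j) m i) i = 0"
        proof
          fix j assume "j \<in> {..<k} - {..k - 2 * i}"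
          then have "gamma_inc (k - j) m i = 0" by (intro z) auto
          then show "monom (real (k + m choose j)) j * monom (gamma_inc (k - j) m i) i = 0" by simp
        qed
      qed (use i in auto)
      also have "\<dots> = (\<Sum>j\<le>k - 2 * i. smult (gamma_inc k m i) (monom 1 i * monom (real (k - 2 * i choose j)) j))"
      proof (rule sum.cong[OF refl])
        fix j assume "j \<in> {..k - 2 * i}"
        then have "j \<le> k - 2 * i" by simp
        from t[OF this i] show "monom (real (k + m choose j)) j * monom (gamma_inc (k - j) m i) i
          = smult (gamma_inc k m i) (monom 1 i * monom (real (k - 2 * i choose j)) j)"
          by (simp add: mult_monom smult_monom add.commute[of i])
      qed
      also have "\<dots> = smult (gamma_inc k m i) (monom 1 i * [:1, 1:] ^ (k - 2 * i))"
        by (simp add: one_plus_x_power smult_sum_right sum_distrib_left)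
      finally show ?thesis .
    qed
  qed
  finally show ?thesis unfolding gamma_expand_def .
qed

lemma z_unif_Suc: "z_unif k (Suc m) = z_unif k m + gamma_expand k (gamma_inc k m)"
proof (cases "k = 0")
  case True
  then show ?thesis by (simp add: z_unif_def gamma_expand_def gamma_inc_def)
next
  case False
  let ?K = "\<lambda>j. kl_unif (k - j) (Suc m)"
  let ?c = "\<lambda>j. monom (real (k + m choose j)) j"
  have pascal: "monom (real (k + Suc m choose j)) j = ?c j + (if j = 0 then 0 else monom (real (k + m choose (j - 1))) j)" for j
    by (cases j) (auto simp: add_monom)
  have "(\<Sum>j<k. monom (real (k + Suc m choose j)) j * ?K j)
      = (\<Sum>j<k. ?c j * ?K j) + (\<Sum>j<k. (if j = 0 then 0 else monom (real (k + m choose (j - 1))) j) * ?K j)"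
    unfolding pascal by (simp add: ring_distribs sum.distrib)
  also have "(\<Sum>j<k. (if j = 0 then 0 else monom (real (k + m choose (j - 1))) j) * ?K j)
      = (\<Sum>j<k - 1. monom (real (k + m choose j)) (Suc j) * kl_unif (k - Suc j) (Suc m))"
    using False sum.lessThan_Suc_shift[of "\<lambda>j. (if j = 0 then 0 else monom (real (k + m choose (j - 1))) j) * ?K j" "k - 1"] by simp
  \<comment> \<open>The added summand \<open>j = k - 1\<close> vanishes because
    \<open>kl_unif 0\<close> is 0.\<close>
  also have "\<dots> = (\<Sum>j<k. monom (real (k + m choose j)) (Suc j) * kl_unif (k - Suc j) (Suc m))"
    by (rule sum.mono_neutral_left) (auto simp: kl_unif_def)
  also have "\<dots> = (\<Sum>j<k. ?c j * pCons 0 (kl_unif (k - j - 1) (Suc m)))"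
    by (intro sum.cong) (auto simp: monom_Suc)
  also have "(\<Sum>j<k. ?c j * ?K j) + (\<Sum>j<k. ?c j * pCons 0 (kl_unif (k - j - 1) (Suc m)))
      = (\<Sum>j<k. ?c j * (kl_unif (k - j) (Suc m) + pCons 0 (kl_unif (k - j - 1) (Suc m))))"
    by (simp only: ring_distribs sum.distrib)
  also have "\<dots> = (\<Sum>j<k. ?c j * (kl_unif (k - j) m + gamma_inc_poly (k - j) m))"
  proof (rule sum.cong[OF refl])
    fix j assume "j \<in> {..<k}"
    then have "k - j > 0" by simp
    then show "?c j * (kl_unif (k - j) (Suc m) + pCons 0 (kl_unif (k - j - 1) (Suc m)))
        = ?c j * (kl_unif (k - j) m + gamma_inc_poly (k - j) m)"
      by (simp only: kl_unif_rec)
  qed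
  also have "\<dots> = (\<Sum>j<k. ?c j * kl_unif (k - j) m) + gamma_expand k (gamma_inc k m)"
    by (simp only: ring_distribs sum.distrib gamma_inc_expand)
  finally show ?thesis by (simp add: z_unif_def)
qed

lemma gamma_coeff_Suc:
  assumes "2 * i \<le> k"
  shows "gamma_coeff k (Suc m) 0 i = gamma_coeff k m 0 i + gamma_inc k m i"
proof (cases "i = 0")
  case True
  then show ?thesis by (simp add: gamma_coeff_def gamma_inc_def)
next
  case False
  have w: "weight k (Suc m) = fact (m + k) / (fact m * fact k)"
    by (simp add: weight_binomial binomial_fact)
  have f: "(fact (m + i + 1) :: real) = (real m + real i + 1) * (real m + real i) * fact (m + i - 1)"
    using False by (cases i) (auto simp: algebra_simps)
  have p: "pochhammer (real i) m = fact (m + i - 1) / fact (i - 1)"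
  proof -
    have "fact (i - 1 + m) = (fact (i - 1) * pochhammer (real (i - 1) + 1) m :: real)"
      using pochhammer_product'[of "1 :: real" "i - 1" m] unfolding pochhammer_fact add.commute[of "real _" 1] .
    then show ?thesis using False by (simp add: of_nat_diff add.commute)
  qed
  have "gamma_coeff k (Suc m) 0 i = gamma_coeff k m 0 i + fact k / (fact (k - 2 * i) * fact (i - 1) * fact i)
      * (weight k (Suc m) / ((real m + real i) * (real m + real i + 1)))"
    using False by (simp add: gamma_coeff_def gamma_rat_def ring_distribs add_ac)
  also have "fact k / (fact (k - 2 * i) * fact (i - 1) * fact i)
      * (weight k (Suc m) / ((real m + real i) * (real m + real i + 1))) = gamma_inc k m i"
  proof -
    have "fk / (a * b * c) * (q / (m' * fk) / (x * y)) = q * (r / b) / (m' * a * c * (y * x * r))"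
      if "fk > 0" "r > 0" for fk a b c q m' x y r :: real
      using that by simp
    from this[of "fact k" "fact (m + i - 1)"] show ?thesis
      unfolding gamma_inc_def w p f using False assms by (simp add: add.commute[of k m])
  qed
  finally show ?thesis .
qed

lemma gamma_expand_cong: "(\<And>i. 2 * i \<le> k \<Longrightarrow> f i = g i) \<Longrightarrow> gamma_expand k f = gamma_expand k g"
  unfolding gamma_expand_def by (intro sum.cong) auto

lemma gamma_expand_add: "gamma_expand k (\<lambda>i. f i + g i) = gamma_expand k f + gamma_expand k g"
  unfolding gamma_expand_def by (simp add: smult_add_left sum.distrib)

lemma gamma_expand_smult: "gamma_expand k (\<lambda>i. c * f i) = smult c (gamma_expand k f)"
  unfolding gamma_expand_def by (simp add: smult_sum_right)

lemma gamma_expand_diff: "gamma_expand k (\<lambda>i. f i - g i) = gamma_expand k f - gamma_expand k g"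
  unfolding gamma_expand_def by (simp add: smult_diff_left sum_subtractf)

text \<open>Corank 0 is the Boolean case with \<open>(1 + x)^k\<close>; raising the corank by one
  adds the same increment to both sides.\<close>

lemma z_unif_gamma: "z_unif k m = gamma_expand k (gamma_coeff k m 0)"
proof (induction m)
  case 0
  have "kl_unif (k - j) 0 = 1" if "j < k" for j
    by (rule poly_eqI) (use that in \<open>simp add: coeff_kl_unif kl_coeff_0_right coeff_1\<close>)
  then have "z_unif k 0 = (\<Sum>j\<le>k. monom (real (k choose j)) j)"
    unfolding z_unif_def by (simp flip: lessThan_Suc_atMost)
  also have "\<dots> = gamma_expand k (\<lambda>i. if i = 0 then 1 else 0)"
    unfolding one_plus_x_power[symmetric] gamma_expand_def
    by (subst sum.remove[of _ 0]) (auto simp: sum.neutral)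
  also have "\<dots> = gamma_expand k (gamma_coeff k 0 0)"
    by (intro gamma_expand_cong) (auto simp: gamma_coeff_def gamma_rat_def)
  finally show ?case .
next
  case (Suc m)
  have "z_unif k (Suc m) = gamma_expand k (\<lambda>i. gamma_coeff k m 0 i + gamma_inc k m i)"
    by (simp add: z_unif_Suc Suc gamma_expand_add)
  also have "\<dots> = gamma_expand k (gamma_coeff k (Suc m) 0)"
    by (intro gamma_expand_cong) (simp add: gamma_coeff_Suc)
  finally show ?case .
qed

section \<open>Relaxation of circuit-hyperplanes\<close>

text \<open>The contribution of one circuit-hyperplane, read off from corank 1. With one
  circuit-hyperplane, a sparse paving matroid of rank \<open>k\<close> on \<open>k + 1\<close>
  elements is a circuit of size \<open>k\<close> plus a coloop. The coloop does not affect the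
  Kazhdan-Lusztig polynomial, so the loss relative to the uniform matroid is this
  difference.\<close>

definition kl_circ :: "nat \<Rightarrow> real poly" where
  "kl_circ k = (if k \<le> 1 then 0 else kl_unif k 1 - kl_unif (k - 1) 1)"

definition gamma_circ :: "nat \<Rightarrow> nat \<Rightarrow> real" where
  "gamma_circ k i = (if i = 0 then 0 else 2 * fact (k - 1) / (fact (k - 2 * i) * fact (i - 1) * fact (i + 1)))"

lemma gamma_coeff_diff:
  assumes "k > 0"
  shows "gamma_coeff k m l i = gamma_coeff k m 0 i - l * gamma_circ k i"
proof (cases "i = 0")
  case False
  have f: "(fact k :: real) = real k * fact (k - 1)" "(fact (i + 1) :: real) = (real i + 1) * fact i"
    using assms by (simp_all add: fact_reduce)
  define S where "S = (\<Sum>s\<in>{1..m}. weight k s / ((real s + real i - 1) * (real s + real i)))"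
  define a b c where "a = (fact (k - 2 * i) :: real)" and "b = (fact (i - 1) :: real)" and "c = (fact i :: real)"
  have g: "gamma_coeff k m l i = real k * fact (k - 1) / (a * b * c) * (S - 2 * l / real k / (real i + 1))" for l
    using False unfolding gamma_coeff_def gamma_rat_def f(1) S_def a_def b_def c_def by simp
  have "real k * F / D * (S - 2 * l / real k / I) = real k * F / D * S - l * (2 * F / (D * I))" if "I > 0" for F D I :: real
    using that assms by (simp add: right_diff_distrib mult_ac)
  from this[of "real i + 1" "fact (k - 1)" "a * b * c"] show ?thesis
    unfolding g gamma_circ_def f(2) a_def b_def c_def using False by (simp add: mult_ac)
qed (simp add: gamma_coeff_def gamma_circ_def)

lemma gamma_coeff_1: "i > 0 \<Longrightarrow> gamma_coeff k 1 0 i = fact k / (fact (k - 2 * i) * fact i * fact (i + 1))"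
  by (cases i) (simp_all add: gamma_coeff_def gamma_rat_def field_simps)

text \<open>The gamma counterpart of \<open>kl_circ\<close>: a coloop multiplies the Z-polynomial by
  \<open>1 + x\<close> and leaves the gamma coefficients unchanged.\<close>

lemma gamma_circ_eq:
  assumes "k \<ge> 2" "2 * i \<le> k"
  shows "gamma_circ k i = gamma_coeff k 1 0 i - (if 2 * i \<le> k - 1 then gamma_coeff (k - 1) 1 0 i else 0)"
proof (cases "i = 0")
  case True
  then show ?thesis by (simp add: gamma_circ_def gamma_coeff_def)
next
  case False
  have f1: "(fact k :: real) = real k * fact (k - 1)" using assms by (simp add: fact_reduce)
  have f2: "(fact i :: real) = real i * fact (i - 1)" using False by (simp add: fact_reduce)
  show ?thesis
  proof (cases "2 * i = k")
    case True
    have rk: "real k = 2 * real i" using True by simp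
    have "\<not> 2 * i \<le> k - 1" using True assms by simp
    then show ?thesis using False
      unfolding gamma_circ_def gamma_coeff_1[OF False[unfolded neq0_conv]] f1 f2 unfolding rk
      by simp
  next
    case neq: False
    have f3: "(fact (k - 2 * i) :: real) = (real k - 2 * real i) * fact (k - 1 - 2 * i)"
    proof -
      have "k - 2 * i = Suc (k - 1 - 2 * i)" using neq assms by simp
      moreover have "real (k - 2 * i) = real k - 2 * real i" using assms by (simp add: of_nat_diff)
      ultimately show ?thesis by (metis fact_Suc)
    qed
    have pos: "real k - 2 * real i > 0" using neq assms by linarith
    have "2 * F / (d * G * f' * g) = K * F / (d * G * (I * f') * g) - F / (G * (I * f') * g)"
      if "d = K - 2 * I" "d > 0" "I > 0" for F d G f' g K I :: real
    proof -
      have "K * F / (d * G * (I * f') * g) - F / (G * (I * f') * g) = (K * F - d * F) / (d * G * (I * f') * g)"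
        using that by (simp add: diff_divide_distrib)
      also have "K * F - d * F = 2 * I * F" unfolding that by (simp add: algebra_simps)
      also have "2 * I * F / (d * G * (I * f') * g) = 2 * F / (d * G * f' * g)" using that by simp
      finally show ?thesis ..
    qed
    from this[of "real k - 2 * real i" "real k" "real i" "fact (k - 1)" "fact (k - 1 - 2 * i)" "fact (i - 1)" "fact (i + 1)"]
    moreover have "2 * i \<le> k - 1" using neq assms by linarith
    ultimately show ?thesis using False neq assms pos
      unfolding gamma_circ_def gamma_coeff_1[OF False[unfolded neq0_conv]] f1 f2 f3
      by simp
  qed
qed

lemma one_plus_x_gamma_expand:
  assumes "k > 0"
  shows "[:1, 1:] * gamma_expand (k - 1) g = gamma_expand k (\<lambda>i. if 2 * i \<le> k - 1 then g i else 0)"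
proof -
  have "gamma_expand k (\<lambda>i. if 2 * i \<le> k - 1 then g i else 0)
      = (\<Sum>i\<le>(k - 1) div 2. smult (if 2 * i \<le> k - 1 then g i else 0) (monom 1 i * [:1, 1:] ^ (k - 2 * i)))"
    unfolding gamma_expand_def by (rule sum.mono_neutral_right) auto
  also have "\<dots> = (\<Sum>i\<le>(k - 1) div 2. [:1, 1:] * smult (g i) (monom 1 i * [:1, 1:] ^ (k - 1 - 2 * i)))"
  proof (rule sum.cong[OF refl])
    fix i assume "i \<in> {..(k - 1) div 2}"
    then have i: "2 * i \<le> k - 1" by auto
    then have "k - 2 * i = Suc (k - 1 - 2 * i)" using assms by auto
    then have "[:1, 1::real:] ^ (k - 2 * i) = [:1, 1:] * [:1, 1:] ^ (k - 1 - 2 * i)" by (simp only: power_Suc)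
    then show "smult (if 2 * i \<le> k - 1 then g i else 0) (monom 1 i * [:1, 1:] ^ (k - 2 * i))
        = [:1, 1:] * smult (g i) (monom 1 i * [:1, 1:] ^ (k - 1 - 2 * i))"
      using i by (simp only: if_True mult_smult_right mult.left_commute)
  qed
  finally show ?thesis by (simp only: gamma_expand_def sum_distrib_left)
qed

lemma kl_unif_1: "kl_unif 1 m = 1"
  by (rule poly_eqI) (auto simp: coeff_kl_unif kl_coeff_def)

text \<open>The left side is the loss in the Z-polynomial caused by one circuit-hyperplane: its
  \<open>k\<close> subsets of size \<open>k - 1\<close> stop being hyperplanes and it becomes one
  itself, hence \<open>k - 1\<close> in degree \<open>k - 1\<close>. Algebraically it is
  \<open>z_unif k 1 - (1 + x) z_unif (k - 1) 1\<close>.\<close>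

lemma z_circ:
  assumes "k \<ge> 2"
  shows "(\<Sum>j<k. monom (real (k choose j)) j * kl_circ (k - j)) + monom (real k - 1) (k - 1)
     = gamma_expand k (gamma_circ k)"
proof -
  obtain r where r: "k = Suc r" "r \<ge> 1" using assms by (cases k) auto
  let ?K = "\<lambda>j. kl_unif j 1"
  let ?S = "\<Sum>j<r. monom (real (k choose j)) j * ?K (r - j)"
  have "(\<Sum>j<k. monom (real (k + 1 choose j)) j * ?K (k - j))
      = (\<Sum>j<k. monom (real (k choose j)) j * ?K (k - j)) + [:0, 1:] * ?S"
  proof -
    have pascal: "monom (real (k + 1 choose j)) j
        = monom (real (k choose j)) j + (if j = 0 then 0 else monom (real (k choose (j - 1))) j)" for j
      by (cases j) (auto simp: add_monom)
    have "(\<Sum>j<k. (if j = 0 then 0 else monom (real (k choose (j - 1))) j) * ?K (k - j))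
       = (\<Sum>j<r. monom (real (k choose j)) (Suc j) * ?K (r - j))"
      unfolding r(1) by (subst sum.lessThan_Suc_shift) simp
    also have "\<dots> = [:0, 1:] * ?S"
      unfolding sum_distrib_left by (intro sum.cong) (auto simp: monom_Suc)
    finally show ?thesis unfolding pascal by (simp add: ring_distribs sum.distrib)
  qed
  then have zk: "z_unif k 1 = (\<Sum>j<k. monom (real (k choose j)) j * ?K (k - j)) + [:0, 1:] * ?S + monom 1 k"
    by (simp add: z_unif_def)
  have zr: "z_unif r 1 = ?S + monom 1 r" by (simp add: z_unif_def r(1))
  have "[:1, 1:] * z_unif r 1 = ?S + monom 1 r + [:0, 1:] * ?S + monom 1 k"
  proof -
    have "[:1, 1:] * z_unif r 1 = z_unif r 1 + [:0, 1:] * z_unif r 1" by simp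
    also have "[:0, 1:] * z_unif r 1 = [:0, 1:] * ?S + monom 1 k"
      unfolding zr distrib_left by (simp add: r(1) monom_Suc)
    finally show ?thesis unfolding zr by (simp only: add.assoc)
  qed
  then have "z_unif k 1 - [:1, 1:] * z_unif r 1
      = ((\<Sum>j<k. monom (real (k choose j)) j * ?K (k - j)) + [:0, 1:] * ?S + monom 1 k)
        - (?S + monom 1 r + [:0, 1:] * ?S + monom 1 k)"
    by (simp only: zk)
  also have "\<dots> = (\<Sum>j<k. monom (real (k choose j)) j * ?K (k - j)) - ?S - monom 1 r"
    by simp
  also have "(\<Sum>j<k. monom (real (k choose j)) j * ?K (k - j))
      = (\<Sum>j<r. monom (real (k choose j)) j * ?K (k - j)) + monom (real k) r"
    using kl_unif_1[of 1] by (simp add: r(1))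
  also have "\<dots> - ?S - monom 1 r = (\<Sum>j<r. monom (real (k choose j)) j * kl_circ (k - j)) + monom (real k - 1) r"
  proof -
    have "(\<Sum>j<r. monom (real (k choose j)) j * kl_circ (k - j))
        = (\<Sum>j<r. monom (real (k choose j)) j * ?K (k - j) - monom (real (k choose j)) j * ?K (r - j))"
    proof (rule sum.cong[OF refl])
      fix j assume "j \<in> {..<r}"
      then have "\<not> k - j \<le> 1" "k - j - 1 = r - j" using r by auto
      then show "monom (real (k choose j)) j * kl_circ (k - j)
        = monom (real (k choose j)) j * ?K (k - j) - monom (real (k choose j)) j * ?K (r - j)"
        by (simp only: kl_circ_def if_False right_diff_distrib)
    qed
    then show ?thesis by (simp add: sum_subtractf diff_monom[symmetric])
  qed
  also have "(\<Sum>j<r. monom (real (k choose j)) j * kl_circ (k - j))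
      = (\<Sum>j<k. monom (real (k choose j)) j * kl_circ (k - j))"
    unfolding r(1) by (simp add: kl_circ_def[of "Suc 0"])
  finally have "(\<Sum>j<k. monom (real (k choose j)) j * kl_circ (k - j)) + monom (real k - 1) (k - 1)
      = z_unif k 1 - [:1, 1:] * z_unif (k - 1) 1" by (simp add: r(1))
  also have "\<dots> = gamma_expand k (\<lambda>i. gamma_coeff k 1 0 i - (if 2 * i \<le> k - 1 then gamma_coeff (k - 1) 1 0 i else 0))"
    unfolding z_unif_gamma using assms by (subst one_plus_x_gamma_expand) (auto simp: gamma_expand_diff)
  also have "\<dots> = gamma_expand k (gamma_circ k)"
    using assms by (intro gamma_expand_cong) (simp add: gamma_circ_eq)
  finally show ?thesis .
qed

definition kl_sp :: "nat \<Rightarrow> nat \<Rightarrow> real \<Rightarrow> real poly" where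
  "kl_sp k m l = kl_unif k m - smult l (kl_circ k)"

text \<open>The left side has the shape in which the sum over flats appears in
  \<open>kl_sp_matroid\<close>. Linearity in \<open>l\<close> reduces it to
  \<open>z_unif_gamma\<close> and \<open>z_circ\<close>.\<close>

lemma z_sp:
  assumes "k \<ge> 2"
  shows "(\<Sum>j<k. monom (real (k + m choose j)) j * kl_unif (k - j) m - smult l (monom (real (k choose j)) j * kl_circ (k - j)))
     - monom (l * (real k - 1)) (k - 1) + monom 1 k = gamma_expand k (gamma_coeff k m l)"
proof -
  have "gamma_expand k (gamma_coeff k m l) = gamma_expand k (\<lambda>i. gamma_coeff k m 0 i - l * gamma_circ k i)"
    using assms by (intro gamma_expand_cong) (simp add: gamma_coeff_diff[of k m l])
  also have "\<dots> = z_unif k m - smult l (gamma_expand k (gamma_circ k))"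
    by (simp add: gamma_expand_diff gamma_expand_smult z_unif_gamma)
  also have "\<dots> = z_unif k m - smult l (\<Sum>j<k. monom (real (k choose j)) j * kl_circ (k - j)) - monom (l * (real k - 1)) (k - 1)"
    unfolding z_circ[OF assms, symmetric] by (simp add: smult_add_right smult_monom)
  finally show ?thesis by (simp add: z_unif_def sum_subtractf smult_sum_right)
qed

lemma coeff_kl_sp_eq_0:
  assumes "k > 0" "k \<le> 2 * i"
  shows "coeff (kl_sp k m l) i = 0"
proof -
  have "coeff (kl_circ k) i = 0"
    using assms by (auto simp: kl_circ_def coeff_kl_unif kl_coeff_eq_0)
  then show ?thesis using assms by (simp add: kl_sp_def coeff_kl_unif kl_coeff_eq_0)
qed

lemma kl_sp_1: "kl_sp 1 m l = 1"
  by (simp add: kl_sp_def kl_circ_def kl_unif_1[simplified])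

section \<open>Palindromicity, integrality and zeros of gamma expansions\<close>

lemma coeff_gamma_expand:
  "coeff (gamma_expand k g) t = (\<Sum>i\<le>k div 2. if i \<le> t then g i * real (k - 2 * i choose (t - i)) else 0)"
  unfolding gamma_expand_def coeff_sum
  by (intro sum.cong) (auto simp: coeff_monom_mult coeff_one_plus_x_power)

lemma gamma_expand_palindromic:
  assumes "t \<le> k"
  shows "coeff (gamma_expand k g) (k - t) = coeff (gamma_expand k g) t"
  unfolding coeff_gamma_expand
proof (rule sum.cong[OF refl])
  fix i assume "i \<in> {..k div 2}"
  then have i: "2 * i \<le> k" by auto
  show "(if i \<le> k - t then g i * real (k - 2 * i choose (k - t - i)) else 0)
      = (if i \<le> t then g i * real (k - 2 * i choose (t - i)) else 0)"
  proof (cases "i \<le> t \<and> i \<le> k - t")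
    case True
    then have "k - 2 * i - (t - i) = k - t - i" "t - i \<le> k - 2 * i" using i assms by auto
    then show ?thesis using True binomial_symmetric[of "t - i" "k - 2 * i"] by simp
  next
    case False
    then show ?thesis using i assms by (auto simp: binomial_eq_0)
  qed
qed

text \<open>The passage from \<open>g\<close> to the lower half of the coefficients is unitriangular
  with integer entries. Integrality is wanted because the gamma polynomial is defined as an integer
  polynomial.\<close>

lemma gamma_expand_integral:
  assumes "map_poly of_int p = gamma_expand k g" "i \<le> k div 2"
  shows "g i \<in> \<int>"
  using assms(2)
proof (induction i rule: less_induct)
  case (less i)
  have "real_of_int (coeff p i) = coeff (gamma_expand k g) i"
    using arg_cong[OF assms(1), of "\<lambda>q. coeff q i"] by (simp add: coeff_map_poly)
  also have "\<dots> = (\<Sum>j\<le>i. g j * real (k - 2 * j choose (i - j)))"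
    unfolding coeff_gamma_expand using less.prems
    by (intro sum.mono_neutral_cong_right) auto
  also have "\<dots> = (\<Sum>j<i. g j * real (k - 2 * j choose (i - j))) + g i"
    by (simp flip: lessThan_Suc_atMost)
  finally have "g i = real_of_int (coeff p i) - (\<Sum>j<i. g j * real (k - 2 * j choose (i - j)))" by simp
  also have "\<dots> \<in> \<int>" using less by (intro Ints_diff Ints_sum Ints_mult) auto
  finally show ?case .
qed

lemma poly_gamma_expand:
  "poly (gamma_expand k g) x = (\<Sum>i\<le>k div 2. g i * (x ^ i * (1 + x) ^ (k - 2 * i)))"
  by (simp add: gamma_expand_def poly_sum poly_monom)

lemma poly_of_real_gamma_expand:
  "poly (map_poly of_real (gamma_expand k g)) (z::complex) = (\<Sum>i\<le>k div 2. of_real (g i) * (z ^ i * (1 + z) ^ (k - 2 * i)))"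
proof -
  have s: "map_poly of_real (sum f A) = (\<Sum>x\<in>A. map_poly of_real (f x) :: complex poly)" for f :: "nat \<Rightarrow> real poly" and A
    by (rule poly_eqI) (simp add: coeff_map_poly coeff_sum)
  have m: "map_poly of_real (p * q) = (map_poly of_real p * map_poly of_real q :: complex poly)" for p q :: "real poly"
    by (rule poly_eqI) (simp add: coeff_map_poly coeff_mult)
  have e: "map_poly of_real ([:1, 1:] ^ n) = ([:1, 1:] ^ n :: complex poly)" for n
    by (induction n) (simp_all add: m map_poly_pCons del: mult_pCons_left)
  show ?thesis
    by (simp add: gamma_expand_def s of_real_poly_smult m e map_poly_monom poly_sum poly_monom)
qed

lemma gamma_subst:
  fixes z :: "'a::field"
  assumes "1 + z \<noteq> 0" "2 * i \<le> k"
  shows "z ^ i * (1 + z) ^ (k - 2 * i) = (1 + z) ^ k * (z / (1 + z)\<^sup>2) ^ i"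
proof -
  have "(1 + z) ^ k = (1 + z) ^ (k - 2 * i) * (1 + z) ^ (2 * i)"
    using assms(2) by (simp only: power_add[symmetric] le_add_diff_inverse2)
  then show ?thesis using assms(1) by (simp add: power_divide power_mult)
qed

text \<open>
  If \<open>z / (1 + z)\<^sup>2\<close> is a negative real \<open>r\<close>, then \<open>z\<close> solves a quadratic equation with positive
  discriminant \<open>1 - 4 r\<close>.
\<close>

lemma negative_of_gamma_subst:
  fixes z :: complex
  assumes "1 + z \<noteq> 0" "z / (1 + z)\<^sup>2 = of_real r" "r < 0"
  shows "Im z = 0 \<and> Re z < 0"
proof -
  have "(1 + z)\<^sup>2 \<noteq> 0" using assms(1) by simp
  then have eq: "z = of_real r * (1 + z)\<^sup>2"
    using nonzero_divide_eq_eq[of "(1 + z)\<^sup>2" z "of_real r"] assms(1,2) by blast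
  define a b where "a = Re z" and "b = Im z"
  have "Re z = Re (of_real r * (1 + z)\<^sup>2)" using eq by (rule arg_cong)
  also have "\<dots> = r * ((1 + a)\<^sup>2 - b\<^sup>2)" by (simp add: a_def b_def power2_eq_square)
  finally have re: "a = r * ((1 + a)\<^sup>2 - b\<^sup>2)" by (simp only: a_def)
  have "Im z = Im (of_real r * (1 + z)\<^sup>2)" using eq by (rule arg_cong)
  also have "\<dots> = 2 * r * (1 + a) * b" by (simp add: a_def b_def power2_eq_square algebra_simps)
  finally have im: "2 * r * (1 + a) * b = 1 * b" by (simp only: b_def mult_1)
  have b0: "b = 0"
  proof (rule ccontr)
    assume "b \<noteq> 0"
    then have h: "2 * r * (1 + a) = 1" using mult_right_cancel[of b "2 * r * (1 + a)" 1] im by blast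
    have "2 * a = 2 * (r * ((1 + a)\<^sup>2 - b\<^sup>2))" using re by (rule arg_cong)
    also have "\<dots> = (2 * r * (1 + a)) * (1 + a) - 2 * (r * b\<^sup>2)"
      by (simp add: algebra_simps power2_eq_square)
    finally have "a = 1 - 2 * (r * b\<^sup>2)" unfolding h by simp
    moreover have "r * b\<^sup>2 \<le> 0" using assms by (simp add: mult_le_0_iff)
    ultimately have "1 + a > 0" by linarith
    then have "r * (1 + a) < 0" using assms(3) by (simp add: mult_less_0_iff)
    then show False using h by simp
  qed
  have "1 + a \<noteq> 0" using assms(1) b0 by (auto simp: a_def b_def complex_eq_iff)
  then have "r * (1 + a)\<^sup>2 < 0" using assms by (simp add: mult_less_0_iff)
  then have "a < 0" by (subst re) (simp add: b0)
  then show ?thesis using b0 by (simp add: a_def b_def)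
qed

text \<open>Nonnegative coefficients with positive constant term exclude zeros in
  \<open>[0, \<infinity>)\<close>, so real-rootedness gives negative zeros. A zero \<open>z\<close>
  of the expansion yields the zero \<open>z / (1 + z)^2\<close> of the gamma side.\<close>

lemma gamma_negative_zeros:
  assumes rr: "real_rooted (\<Sum>i\<le>k div 2. monom (g i) i)" and g: "\<And>i. i \<le> k div 2 \<Longrightarrow> g i \<ge> 0" and g0: "g 0 > 0"
  shows "(\<Sum>i\<le>k div 2. of_real (g i) * z ^ i) = (0::complex) \<Longrightarrow> Im z = 0 \<and> Re z < 0"
    and "poly (map_poly of_real (gamma_expand k g)) z = 0 \<Longrightarrow> Im z = 0 \<and> Re z < 0"
proof -
  have *: "Im z = 0 \<and> Re z < 0" if z: "(\<Sum>i\<le>k div 2. of_real (g i) * z ^ i) = 0" for z :: complex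
  proof -
    let ?G = "\<Sum>i\<le>k div 2. monom (g i) i"
    have "map_poly of_real ?G = (\<Sum>i\<le>k div 2. monom (of_real (g i)) i :: complex poly)"
      by (rule poly_eqI) (simp add: coeff_map_poly coeff_sum)
    then have "poly (map_poly of_real ?G) z = 0" using z by (simp add: poly_sum poly_monom)
    then have "z \<in> \<real>" using rr by (simp add: real_rooted_def)
    then obtain r where r: "z = of_real r" by (elim Reals_cases)
    have "of_real (\<Sum>i\<le>k div 2. g i * r ^ i) = (0::complex)" using z by (simp add: r)
    then have s: "(\<Sum>i\<le>k div 2. g i * r ^ i) = 0" by (simp only: of_real_eq_0_iff)
    have "r < 0"
    proof (rule ccontr)
      assume "\<not> r < 0"
      then have "(\<Sum>i\<le>k div 2. g i * r ^ i) > 0"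
        using g g0 by (intro sum_pos2[where i = 0]) auto
      then show False using s by simp
    qed
    then show ?thesis by (simp add: r)
  qed
  then show "(\<Sum>i\<le>k div 2. of_real (g i) * z ^ i) = (0::complex) \<Longrightarrow> Im z = 0 \<and> Re z < 0" .
  show "Im z = 0 \<and> Re z < 0" if z: "poly (map_poly of_real (gamma_expand k g)) z = 0"
  proof (cases "1 + z = 0")
    case True
    \<comment> \<open>The pole of the substitution is itself a negative real number.\<close>
    then have "z = -1" by (simp add: eq_neg_iff_add_eq_0 add.commute)
    then show ?thesis by simp
  next
    case False
    have "(1 + z) ^ k * (\<Sum>i\<le>k div 2. of_real (g i) * (z / (1 + z)\<^sup>2) ^ i) = 0"
      unfolding z[symmetric] poly_of_real_gamma_expand sum_distrib_left
      by (intro sum.cong refl) (use False in \<open>auto simp: gamma_subst\<close>)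
    then have "Im (z / (1 + z)\<^sup>2) = 0 \<and> Re (z / (1 + z)\<^sup>2) < 0" using * False by simp
    then have "z / (1 + z)\<^sup>2 = of_real (Re (z / (1 + z)\<^sup>2))" by (simp add: complex_eq_iff)
    then show ?thesis
      using negative_of_gamma_subst[OF False] \<open>Im (z / (1 + z)\<^sup>2) = 0 \<and> Re (z / (1 + z)\<^sup>2) < 0\<close> by blast
  qed
qed

section \<open>Rank, flats and contractions\<close>

lemma matroid_axioms: "is_matroid (ground M) (indeps M)"
  by transfer auto

lemmas matroidD = is_matroidD[OF matroid_axioms]

lemma matroid_eqI:
  assumes "ground M = ground N" "indeps M = indeps N"
  shows "M = N"
  using assms by transfer (auto simp: prod_eq_iff)

lemma ground_contraction: "ground (contraction M A) = ground M - A"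
  by transfer auto

lemma indeps_contraction:
  "indeps (contraction M A) = {X. X \<subseteq> ground M - A \<and> (\<exists>B. basis_in (indeps M) A B \<and> X \<union> B \<in> indeps M)}"
  by transfer auto

lemma ground_dual: "ground (dual M) = ground M"
  by transfer auto

lemma indeps_dual: "indeps (dual M) = {X. X \<subseteq> ground M \<and> (\<exists>B. basis_in (indeps M) (ground M) B \<and> B \<inter> X = {})}"
  by transfer auto

lemma finite_indeps: "finite (indeps M)"
proof -
  have "indeps M \<subseteq> Pow (ground M)" using matroidD(2)[of _ M] by auto
  then show ?thesis using matroidD(1)[of M] by (meson finite_Pow_iff finite_subset)
qed

lemma rank_of_basis:
  assumes "basis_in (indeps M) A B"
  shows "rank_of M A = card B"
  unfolding rank_of_def
proof (rule Max_eqI)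
  show "finite (card ` {X \<in> indeps M. X \<subseteq> A})" using finite_indeps[of M] by auto
  show "y \<le> card B" if "y \<in> card ` {X \<in> indeps M. X \<subseteq> A}" for y
    using that basis_in_card[OF matroid_axioms assms] by auto
  show "card B \<in> card ` {X \<in> indeps M. X \<subseteq> A}" using assms by (auto simp: basis_in_def)
qed

lemma basis_exists:
  assumes "X \<in> indeps M" "X \<subseteq> A"
  obtains B where "basis_in (indeps M) A B" "X \<subseteq> B" "rank_of M A = card B"
  using basis_extend[OF matroid_axioms assms] rank_of_basis by metis

lemma rank_of_ge: "X \<in> indeps M \<Longrightarrow> X \<subseteq> A \<Longrightarrow> card X \<le> rank_of M A"
  using basis_exists[of "{}" M A] matroidD(4) basis_in_card[OF matroid_axioms] by (metis empty_subsetI)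

lemma rank_of_mono: "A \<subseteq> B \<Longrightarrow> rank_of M A \<le> rank_of M B"
  using basis_exists[of "{}" M A] matroidD(4) rank_of_ge[of _ M B]
  by (metis basis_in_def empty_subsetI subset_trans)

lemma rank_of_le_card: "finite A \<Longrightarrow> rank_of M A \<le> card A"
  using basis_exists[of "{}" M A] matroidD(4) by (metis basis_in_def card_mono empty_subsetI)

lemma indep_iff_rank: "X \<in> indeps M \<longleftrightarrow> X \<subseteq> ground M \<and> rank_of M X = card X"
proof
  assume X: "X \<in> indeps M"
  then show "X \<subseteq> ground M \<and> rank_of M X = card X"
    using matroidD(2,3) rank_of_ge[of X M X] rank_of_le_card[of X M] by (meson antisym order_refl)
next
  assume X: "X \<subseteq> ground M \<and> rank_of M X = card X"
  then have fin: "finite X" using matroidD(1) finite_subset by blast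
  obtain B where "basis_in (indeps M) X B" "rank_of M X = card B"
    using basis_exists[of "{}" M X] matroidD(4) by (metis empty_subsetI)
  then have "B \<in> indeps M" "B \<subseteq> X" "card B = card X" using X by (auto simp: basis_in_def)
  then show "X \<in> indeps M" using card_subset_eq[OF fin] by metis
qed

lemma matroid_rank_eqI:
  assumes "ground M = ground N" "\<And>X. X \<subseteq> ground M \<Longrightarrow> rank_of M X = rank_of N X"
  shows "M = N"
  using assms by (intro matroid_eqI) (auto simp: indep_iff_rank)

text \<open>Extend a basis \<open>B\<close> of \<open>A\<close> to a basis \<open>B'\<close> of
  \<open>X \<union> A\<close>; then \<open>B' - B\<close> is a basis of \<open>X\<close> in the
  contraction. The additive form avoids truncated subtraction.\<close>

lemma rank_of_contraction:
  assumes X: "X \<subseteq> ground M - A"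
  shows "rank_of (contraction M A) X + rank_of M A = rank_of M (X \<union> A)"
proof -
  obtain B where B: "basis_in (indeps M) A B" "rank_of M A = card B"
    using basis_exists[of "{}" M A] matroidD(4) by (metis empty_subsetI)
  then have BI: "B \<in> indeps M" "B \<subseteq> A" by (auto simp: basis_in_def)
  obtain B' where B': "basis_in (indeps M) (X \<union> A) B'" "B \<subseteq> B'" "rank_of M (X \<union> A) = card B'"
    using basis_exists[of B M "X \<union> A"] BI by blast
  then have B'I: "B' \<in> indeps M" "B' \<subseteq> X \<union> A" by (auto simp: basis_in_def)
  define Y where "Y = B' - B"
  have BA: "y \<in> B" if "y \<in> B'" "y \<in> A" for y
  proof (rule ccontr)
    assume "y \<notin> B"
    then have "insert y B \<notin> indeps M" using B that by (auto simp: basis_in_def)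
    moreover have "insert y B \<subseteq> B'" using that B' by auto
    ultimately show False using matroidD(5)[OF B'I(1)] by blast
  qed
  have YX: "Y \<subseteq> X" using B'I BA by (auto simp: Y_def)
  have YB: "Y \<union> B = B'" using B' by (auto simp: Y_def)
  have finB': "finite B'" using matroidD(3)[OF B'I(1)] .
  have "basis_in (indeps (contraction M A)) X Y"
    unfolding basis_in_def
  proof (intro conjI ballI notI)
    show "Y \<in> indeps (contraction M A)"
      using YX X YB B B'I by (auto simp: indeps_contraction)
    fix x assume x: "x \<in> X - Y" "insert x Y \<in> indeps (contraction M A)"
    then obtain B2 where B2: "basis_in (indeps M) A B2" "insert x Y \<union> B2 \<in> indeps M"
      by (auto simp: indeps_contraction)
    have B2A: "B2 \<subseteq> A" using B2 by (auto simp: basis_in_def)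
    have fin: "finite (insert x Y)" "finite B2" using matroidD(3)[OF B2(2)] by auto
    have "card (insert x Y \<union> B2) \<le> card B'"
      using basis_in_card[OF matroid_axioms B'(1) B2(2)] x YX B2A by auto
    moreover have "card (insert x Y \<union> B2) = card (insert x Y) + card B2"
      using fin B2A x YX X by (intro card_Un_disjoint) auto
    moreover have "card (insert x Y) = Suc (card Y)" using fin x by auto
    moreover have "card B2 = card B" using rank_of_basis[OF B2(1)] B(2) by simp
    moreover have "card B' = card Y + card B"
      using card_Diff_subset[OF finite_subset[OF B'(2) finB'] B'(2)] card_mono[OF finB' B'(2)] by (simp add: Y_def)
    ultimately show False by simp
  qed (use YX in auto)
  then have "rank_of (contraction M A) X = card Y" by (rule rank_of_basis)
  moreover have "card B' = card Y + card B"
    using card_Diff_subset[OF finite_subset[OF B'(2) finB'] B'(2)] card_mono[OF finB' B'(2)] by (simp add: Y_def)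
  ultimately show ?thesis using B B' by simp
qed

lemma rk_contraction:
  assumes "A \<subseteq> ground M"
  shows "rk (contraction M A) + rank_of M A = rk M"
  using rank_of_contraction[of "ground M - A" M A] assms
  by (simp add: rk_def ground_contraction Un_absorb2)

lemma contraction_contraction:
  assumes "A \<subseteq> B" "B \<subseteq> ground M"
  shows "contraction (contraction M A) (B - A) = contraction M B"
proof (rule matroid_rank_eqI)
  show "ground (contraction (contraction M A) (B - A)) = ground (contraction M B)"
    using assms by (auto simp: ground_contraction)
  fix X assume X: "X \<subseteq> ground (contraction (contraction M A) (B - A))"
  then have X': "X \<subseteq> ground M - B" using assms by (auto simp: ground_contraction)
  have 1: "rank_of (contraction (contraction M A) (B - A)) X + rank_of (contraction M A) (B - A)
      = rank_of (contraction M A) (X \<union> (B - A))"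
    using X by (intro rank_of_contraction) (auto simp: ground_contraction)
  have 2: "rank_of (contraction M A) (B - A) + rank_of M A = rank_of M B"
    using rank_of_contraction[of "B - A" M A] assms by (simp add: Un_absorb2 Diff_mono)
  have "X \<union> (B - A) \<union> A = X \<union> B" using assms by auto
  then have 3: "rank_of (contraction M A) (X \<union> (B - A)) + rank_of M A = rank_of M (X \<union> B)"
    using rank_of_contraction[of "X \<union> (B - A)" M A] assms X' by auto
  have 4: "rank_of (contraction M B) X + rank_of M B = rank_of M (X \<union> B)"
    by (rule rank_of_contraction[OF X'])
  show "rank_of (contraction (contraction M A) (B - A)) X = rank_of (contraction M B) X"
    using 1 2 3 4 by linarith
qed

lemma contraction_empty: "contraction M {} = M"
proof (rule matroid_rank_eqI)
  fix X assume "X \<subseteq> ground (contraction M {})"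
  then show "rank_of (contraction M {}) X = rank_of M X"
    using rank_of_contraction[of X M "{}"] rank_of_le_card[of "{}" M] by (simp add: ground_contraction)
qed (simp add: ground_contraction)

section \<open>Flats and their behaviour under contraction\<close>

lemma flatD: "F \<in> flats M \<Longrightarrow> F \<subseteq> ground M" "F \<in> flats M \<Longrightarrow> x \<in> ground M \<Longrightarrow> x \<notin> F \<Longrightarrow> rank_of M F < rank_of M (insert x F)"
  by (auto simp: flats_def)

lemma finite_flats: "finite (flats M)"
proof -
  have "flats M \<subseteq> Pow (ground M)" by (auto simp: flats_def)
  then show ?thesis using matroidD(1)[of M] by (meson finite_Pow_iff finite_subset)
qed

lemma finite_flat: "F \<in> flats M \<Longrightarrow> finite F"
  using finite_subset[OF flatD(1) matroidD(1)] .

lemma ground_flat: "ground M \<in> flats M"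
  by (auto simp: flats_def)

lemma rank_of_flat_less:
  assumes "F \<in> flats M" "G \<subseteq> ground M" "F \<subset> G"
  shows "rank_of M F < rank_of M G"
proof -
  obtain x where "x \<in> G" "x \<notin> F" using assms by auto
  then have "rank_of M F < rank_of M (insert x F)" using assms(2) by (intro flatD(2)[OF assms(1)]) auto
  also have "\<dots> \<le> rank_of M G" using \<open>x \<in> G\<close> assms by (intro rank_of_mono) auto
  finally show ?thesis .
qed

lemma rank_of_le_rk: "A \<subseteq> ground M \<Longrightarrow> rank_of M A \<le> rk M"
  unfolding rk_def by (rule rank_of_mono)

lemma flats_contraction:
  assumes A: "A \<subseteq> ground M"
  shows "flats (contraction M A) = (\<lambda>G. G - A) ` {G \<in> flats M. A \<subseteq> G}"
proof -
  have iff: "X \<in> flats (contraction M A) \<longleftrightarrow> X \<union> A \<in> flats M" if X: "X \<subseteq> ground M - A" for X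
  proof -
    have r: "rank_of (contraction M A) X < rank_of (contraction M A) (insert x X)
        \<longleftrightarrow> rank_of M (X \<union> A) < rank_of M (insert x (X \<union> A))" if "x \<in> ground M - A" for x
    proof -
      have "insert x X \<subseteq> ground M - A" using X that by blast
      then show ?thesis
        using rank_of_contraction[OF X] rank_of_contraction[of "insert x X" M A]
        unfolding Un_insert_left by linarith
    qed
    have "X \<in> flats (contraction M A) \<longleftrightarrow> (\<forall>x\<in>ground M - A - X. rank_of (contraction M A) X < rank_of (contraction M A) (insert x X))"
      using X by (simp add: flats_def ground_contraction)
    also have "\<dots> \<longleftrightarrow> (\<forall>x\<in>ground M - A - X. rank_of M (X \<union> A) < rank_of M (insert x (X \<union> A)))"
      using r by (intro ball_cong) auto
    also have "\<dots> \<longleftrightarrow> X \<union> A \<in> flats M"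
    proof -
      have "ground M - A - X = ground M - (X \<union> A)" "X \<union> A \<subseteq> ground M" using X A by auto
      then show ?thesis by (simp add: flats_def)
    qed
    finally show ?thesis .
  qed
  show ?thesis
  proof (intro set_eqI iffI)
    fix X assume X: "X \<in> flats (contraction M A)"
    then have "X \<subseteq> ground M - A" using flatD(1)[OF X] by (simp add: ground_contraction)
    then show "X \<in> (\<lambda>G. G - A) ` {G \<in> flats M. A \<subseteq> G}"
      using iff[of X] X by (intro image_eqI[of _ _ "X \<union> A"]) auto
  next
    fix X assume "X \<in> (\<lambda>G. G - A) ` {G \<in> flats M. A \<subseteq> G}"
    then obtain G where G: "G \<in> flats M" "A \<subseteq> G" "X = G - A" by auto
    then have "X \<subseteq> ground M - A" "X \<union> A = G" using flatD(1)[OF G(1)] by auto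
    then show "X \<in> flats (contraction M A)" using iff[of X] G by simp
  qed
qed

section \<open>Loops and the minimum flat\<close>

definition loops :: "'a matroid \<Rightarrow> 'a set" where
  "loops M = {x \<in> ground M. {x} \<notin> indeps M}"

lemma rank_of_insert_loop:
  assumes "x \<in> loops M"
  shows "rank_of M (insert x A) = rank_of M A"
proof -
  obtain B where B: "basis_in (indeps M) A B" "rank_of M A = card B"
    using basis_exists[of "{}" M A] matroidD(4) by (metis empty_subsetI)
  have "insert x B \<notin> indeps M"
    using assms matroidD(5)[of "insert x B" M "{x}"] by (auto simp: loops_def)
  then have "basis_in (indeps M) (insert x A) B" using B by (auto simp: basis_in_def)
  then show ?thesis using B rank_of_basis by metis
qed

lemma rank_of_loops: "rank_of M (loops M) = 0"
proof -
  obtain B where B: "basis_in (indeps M) (loops M) B" "rank_of M (loops M) = card B"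
    using basis_exists[of "{}" M "loops M"] matroidD(4) by (metis empty_subsetI)
  have "B = {}"
  proof (rule ccontr)
    assume "B \<noteq> {}"
    then obtain x where "x \<in> B" by auto
    then have "{x} \<in> indeps M" "x \<in> loops M" using B matroidD(5)[of B M "{x}"] by (auto simp: basis_in_def)
    then show False by (simp add: loops_def)
  qed
  then show ?thesis using B by simp
qed

lemma loops_flat: "loops M \<in> flats M"
proof -
  have "0 < rank_of M (insert x (loops M))" if "x \<in> ground M" "x \<notin> loops M" for x
    using rank_of_ge[of "{x}" M "insert x (loops M)"] that by (auto simp: loops_def)
  then show ?thesis by (auto simp: flats_def rank_of_loops) (auto simp: loops_def)
qed

lemma loops_subset_flat: "F \<in> flats M \<Longrightarrow> loops M \<subseteq> F"
proof
  fix x assume F: "F \<in> flats M" and x: "x \<in> loops M"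
  then have "\<not> rank_of M F < rank_of M (insert x F)" "x \<in> ground M"
    using rank_of_insert_loop[OF x, of F] by (auto simp: loops_def)
  then show "x \<in> F" using flatD(2)[OF F] by blast
qed

lemma min_flat_eq: "min_flat M = loops M"
  unfolding min_flat_def using loops_flat loops_subset_flat by blast

lemma flat_rank_0: "F \<in> flats M \<Longrightarrow> rank_of M F = 0 \<longleftrightarrow> F = loops M"
  using rank_of_loops[of M] rank_of_flat_less[OF loops_flat flatD(1)[of F M]] loops_subset_flat[of F M]
  by (cases "F = loops M") auto

lemma loops_contraction_flat:
  assumes "F \<in> flats M"
  shows "loops (contraction M F) = {}"
proof -
  have F: "F \<subseteq> ground M" using flatD(1)[OF assms] .
  have "{} \<in> flats (contraction M F)" unfolding flats_contraction[OF F] using assms by auto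
  then show ?thesis using loops_subset_flat by blast
qed

section \<open>Existence and uniqueness of Kazhdan--Lusztig polynomials\<close>

text \<open>For \<open>d > 0\<close> this is the only polynomial of degree below
  \<open>d / 2\<close> whose sum with \<open>S\<close> has equal coefficients at \<open>i\<close>
  and \<open>d - i\<close> for all \<open>i \<le> d\<close>. The value 1 for \<open>d = 0\<close> is
  the normalization in rank 0.\<close>

definition half_part :: "nat \<Rightarrow> int poly \<Rightarrow> int poly" where
  "half_part d S = (if d = 0 then 1 else (\<Sum>i\<in>{i. 2 * i < d}. monom (coeff S (d - i) - coeff S i) i))"

lemma coeff_half_part:
  assumes "d > 0"
  shows "coeff (half_part d S) i = (if 2 * i < d then coeff S (d - i) - coeff S i else 0)"
proof -
  have fin: "finite {i. 2 * i < d}" by (rule finite_subset[of _ "{..<d}"]) auto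
  have "coeff (half_part d S) i = (\<Sum>j\<in>{i. 2 * i < d}. if j = i then coeff S (d - i) - coeff S i else 0)"
    unfolding half_part_def coeff_sum using assms by (simp add: coeff_sum) (intro sum.cong; auto)
  then show ?thesis using fin by (auto simp: sum.delta)
qed

text \<open>The recursion encodes palindromicity of the Z-polynomial and makes no reference to
  characteristic polynomials. Only flats of positive rank occur, so every contraction has smaller
  rank.\<close>

function kl :: "'a matroid \<Rightarrow> int poly" where
  "kl M = half_part (rk M) (\<Sum>F\<in>{F \<in> flats M. rank_of M F > 0}. monom 1 (rank_of M F) * kl (contraction M F))"
  by pat_completeness auto
termination
proof (relation "measure rk")
  fix M :: "'a matroid" and F
  assume "F \<in> {F \<in> flats M. 0 < rank_of M F}"
  then show "(contraction M F, M) \<in> measure rk"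
    using rk_contraction[of F M] flatD(1)[of F M] by auto
qed auto

declare kl.simps [simp del]

definition kl_rest :: "'a matroid \<Rightarrow> int poly" where
  "kl_rest M = (\<Sum>F\<in>{F \<in> flats M. rank_of M F > 0}. monom 1 (rank_of M F) * kl (contraction M F))"

lemma kl_eq: "kl M = half_part (rk M) (kl_rest M)"
  unfolding kl_rest_def by (rule kl.simps)

lemma kl_rank_0: "rk M = 0 \<Longrightarrow> kl M = 1"
  by (simp add: kl_eq half_part_def)

lemma coeff_kl_eq_0:
  assumes "rk M > 0" "rk M \<le> 2 * i"
  shows "coeff (kl M) i = 0"
  using assms by (simp add: kl_eq coeff_half_part)

lemma degree_kl: "rk M > 0 \<Longrightarrow> 2 * degree (kl M) < rk M"
  using coeff_kl_eq_0[of M "degree (kl M)"] by (cases "kl M = 0") (auto simp: not_less[symmetric])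

lemma degree_kl_le: "degree (kl M) \<le> rk M"
  using degree_kl[of M] kl_rank_0[of M] by (cases "rk M = 0") auto

lemma flats_pos_insert: "flats M = insert (loops M) {F \<in> flats M. rank_of M F > 0}"
  using loops_flat[of M] flat_rank_0[of _ M] by auto

lemma sum_flats_split:
  fixes f :: "'a set \<Rightarrow> 'b::comm_monoid_add"
  shows "(\<Sum>F\<in>flats M. f F) = f (loops M) + (\<Sum>F\<in>{F \<in> flats M. rank_of M F > 0}. f F)"
  by (subst flats_pos_insert, subst sum.insert) (auto simp: finite_flats rank_of_loops)

lemma sum_flats_contraction:
  fixes f :: "'a set \<Rightarrow> 'b::comm_monoid_add"
  assumes "A \<subseteq> ground M"
  shows "(\<Sum>F\<in>flats (contraction M A). f F) = (\<Sum>G\<in>{G \<in> flats M. A \<subseteq> G}. f (G - A))"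
proof -
  have "inj_on (\<lambda>G. G - A) {G \<in> flats M. A \<subseteq> G}" by (rule inj_onI) auto
  then show ?thesis unfolding flats_contraction[OF assms] by (simp add: sum.reindex)
qed

definition z_full :: "'a matroid \<Rightarrow> int poly" where
  "z_full M = (\<Sum>F\<in>flats M. monom 1 (rank_of M F) * kl (contraction M F))"

lemma z_full_contraction:
  assumes A: "A \<in> flats M"
  shows "z_full (contraction M A) = (\<Sum>G\<in>{G \<in> flats M. A \<subseteq> G}. monom 1 (rank_of M G - rank_of M A) * kl (contraction M G))"
proof -
  have AE: "A \<subseteq> ground M" using flatD(1)[OF A] .
  have "rank_of (contraction M A) (G - A) = rank_of M G - rank_of M A"
    "contraction (contraction M A) (G - A) = contraction M G"
    if "G \<in> flats M" "A \<subseteq> G" for G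
  proof -
    have G: "G \<subseteq> ground M" using flatD(1) that by blast
    show "contraction (contraction M A) (G - A) = contraction M G"
      by (rule contraction_contraction[OF that(2) G])
    show "rank_of (contraction M A) (G - A) = rank_of M G - rank_of M A"
      using rank_of_contraction[of "G - A" M A] G that(2) by (simp add: Un_absorb2 Diff_mono)
  qed
  then show ?thesis unfolding z_full_def sum_flats_contraction[OF AE] by (intro sum.cong) auto
qed

lemma z_full_split: "z_full M = kl (contraction M (loops M)) + kl_rest M"
  unfolding z_full_def kl_rest_def by (subst sum_flats_split) (simp add: rank_of_loops)

text \<open>Contracting the loops, to a matroid \<open>N\<close>, preserves the Z-sum, and in both
  \<open>z_full N\<close> and \<open>z_full M\<close> the term of the minimum flat is
  \<open>kl N\<close>. So the remaining parts agree, and they determine \<open>kl\<close>.\<close>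

lemma kl_contraction_loops: "kl (contraction M (loops M)) = kl M"
proof -
  let ?N = "contraction M (loops M)"
  have "z_full ?N = z_full M"
    unfolding z_full_contraction[OF loops_flat] z_full_def[of M]
    by (intro sum.cong) (auto simp: rank_of_loops dest: loops_subset_flat[THEN subsetD])
  moreover have "loops ?N = {}" by (rule loops_contraction_flat[OF loops_flat])
  ultimately have "kl_rest ?N = kl_rest M"
    using z_full_split[of ?N] z_full_split[of M] by (simp add: contraction_empty)
  moreover have "rk ?N = rk M"
    using rk_contraction[of "loops M" M] flatD(1)[OF loops_flat[of M]] by (simp add: rank_of_loops)
  ultimately show ?thesis by (simp add: kl_eq)
qed

lemma z_full_eq: "z_full M = kl M + kl_rest M"
  by (simp add: z_full_split kl_contraction_loops)

lemma degree_kl_rest: "degree (kl_rest M) \<le> rk M"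
  unfolding kl_rest_def
proof (rule degree_sum_le)
  show "finite {F \<in> flats M. 0 < rank_of M F}" using finite_flats[of M] by auto
  fix F assume "F \<in> {F \<in> flats M. 0 < rank_of M F}"
  then have F: "F \<subseteq> ground M" using flatD(1) by blast
  have "degree (monom 1 (rank_of M F) * kl (contraction M F)) \<le> rank_of M F + rk (contraction M F)"
    using degree_mult_le[of "monom 1 (rank_of M F)" "kl (contraction M F)"] degree_kl_le[of "contraction M F"]
      degree_monom_le[of "1::int" "rank_of M F"] by linarith
  then show "degree (monom 1 (rank_of M F) * kl (contraction M F)) \<le> rk M"
    using rk_contraction[OF F] by simp
qed

lemma z_full_palindromic:
  assumes "t \<le> rk M"
  shows "coeff (z_full M) (rk M - t) = coeff (z_full M) t"
proof (cases "rk M = 0")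
  case False
  then have d: "rk M > 0" by simp
  have c: "coeff (kl M) i = (if 2 * i < rk M then coeff (kl_rest M) (rk M - i) - coeff (kl_rest M) i else 0)" for i
    by (simp add: kl_eq coeff_half_part[OF d])
  consider "2 * t < rk M" | "2 * t = rk M" | "2 * t > rk M" by linarith
  then show ?thesis
  proof cases
    case 2
    then have "rk M - t = t" by simp
    then show ?thesis by simp
  qed (use assms in \<open>auto simp: z_full_eq c\<close>)
qed (use assms in auto)

lemma degree_z_full: "degree (z_full M) \<le> rk M"
  unfolding z_full_eq using degree_kl_le[of M] degree_kl_rest[of M] by (rule degree_add_le)

section \<open>Moebius inversion and the defining equation\<close>

lemma coeff_reverse_poly:
  assumes "degree p \<le> d"
  shows "coeff (reverse_poly d p) t = (if t \<le> d then coeff p (d - t) else 0)"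
  using assms unfolding reverse_poly_def
  by (auto simp: coeff_monom_mult coeff_reflect_poly coeff_eq_0 intro!: arg_cong[of _ _ "coeff p"])

lemma moebius_sum:
  assumes H: "H \<in> flats M"
  shows "(\<Sum>G\<in>{G \<in> flats M. G \<subseteq> H}. moebius (flats M) (loops M) G) = (if H = loops M then 1 else 0)"
proof (cases "H = loops M")
  case True
  have "{G \<in> flats M. G \<subseteq> H} = {loops M}" using True loops_subset_flat loops_flat by blast
  then show ?thesis using True by (simp add: moebius.simps)
next
  case False
  have sub: "loops M \<subset> H" using False loops_subset_flat[OF H] by auto
  have "{G \<in> flats M. G \<subseteq> H} = insert H {Z \<in> flats M. loops M \<subseteq> Z \<and> Z \<subset> H}"
    using H loops_subset_flat by blast
  then have "(\<Sum>G\<in>{G \<in> flats M. G \<subseteq> H}. moebius (flats M) (loops M) G)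
      = moebius (flats M) (loops M) H + (\<Sum>Z\<in>{Z \<in> flats M. loops M \<subseteq> Z \<and> Z \<subset> H}. moebius (flats M) (loops M) Z)"
    using finite_flats[of M] by simp
  also have "\<dots> = 0"
    using sub finite_flat[OF H] by (subst moebius.simps) auto
  finally show ?thesis using False by simp
qed

definition kl_rev :: "'a matroid \<Rightarrow> 'a set \<Rightarrow> int poly" where
  "kl_rev M F = reverse_poly (rk M - rank_of M F) (kl (contraction M F))"

text \<open>Palindromicity of \<open>z_full (contraction M G)\<close>: reversing each summand with
  respect to the rank of that contraction absorbs the power of \<open>x\<close> and reverses the
  Kazhdan-Lusztig polynomial.\<close>

lemma sum_kl_rev:
  assumes G: "G \<in> flats M"
  shows "(\<Sum>H\<in>{H \<in> flats M. G \<subseteq> H}. kl_rev M H)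
       = (\<Sum>H\<in>{H \<in> flats M. G \<subseteq> H}. monom 1 (rank_of M H - rank_of M G) * kl (contraction M H))"
proof (rule poly_eqI)
  fix t
  let ?N = "contraction M G" and ?r = "rank_of M"
  have GE: "G \<subseteq> ground M" using flatD(1)[OF G] .
  have rN: "rk ?N = rk M - ?r G" using rk_contraction[OF GE] by simp
  have H: "coeff (kl_rev M H) t = (if t \<le> rk ?N then coeff (monom 1 (?r H - ?r G) * kl (contraction M H)) (rk ?N - t) else 0)"
    if "H \<in> flats M" "G \<subseteq> H" for H
  proof -
    have HE: "H \<subseteq> ground M" using flatD(1) that by blast
    have rH: "rk (contraction M H) = rk M - ?r H" "?r H \<le> rk M" using rk_contraction[OF HE] by auto
    have rG: "?r G \<le> ?r H" using that by (intro rank_of_mono)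
    have "degree (kl (contraction M H)) \<le> rk M - ?r H" using degree_kl_le[of "contraction M H"] rH by simp
    then have "coeff (kl_rev M H) t = (if t \<le> rk M - ?r H then coeff (kl (contraction M H)) (rk M - ?r H - t) else 0)"
      unfolding kl_rev_def by (rule coeff_reverse_poly)
    moreover have "?r H - ?r G \<le> rk ?N - t \<longleftrightarrow> t \<le> rk M - ?r H \<or> ?r H = ?r G" if "t \<le> rk ?N"
      using that rH rG rN by auto
    moreover have "rk ?N - t - (?r H - ?r G) = rk M - ?r H - t" using rH rG rN by simp
    ultimately show ?thesis using rH rG rN by (auto simp: coeff_monom_mult)
  qed
  have "coeff (\<Sum>H\<in>{H \<in> flats M. G \<subseteq> H}. kl_rev M H) t = (if t \<le> rk ?N then coeff (z_full ?N) (rk ?N - t) else 0)"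
    unfolding coeff_sum z_full_contraction[OF G] using H by (auto intro!: sum.cong sum.neutral)
  also have "\<dots> = coeff (z_full ?N) t"
    using z_full_palindromic[of t ?N] degree_z_full[of ?N] by (auto simp: coeff_eq_0)
  finally show "coeff (\<Sum>H\<in>{H \<in> flats M. G \<subseteq> H}. kl_rev M H) t
    = coeff (\<Sum>H\<in>{H \<in> flats M. G \<subseteq> H}. monom 1 (?r H - ?r G) * kl (contraction M H)) t"
    unfolding z_full_contraction[OF G] .
qed

lemma sum_flats_swap:
  fixes f :: "'a set \<Rightarrow> 'a set \<Rightarrow> int poly"
  shows "(\<Sum>G\<in>flats M. \<Sum>H\<in>{H \<in> flats M. G \<subseteq> H}. f G H) = (\<Sum>H\<in>flats M. \<Sum>G\<in>{G \<in> flats M. G \<subseteq> H}. f G H)"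
proof -
  have "(\<Sum>G\<in>flats M. \<Sum>H\<in>{H \<in> flats M. G \<subseteq> H}. f G H) = (\<Sum>G\<in>flats M. \<Sum>H\<in>flats M. if G \<subseteq> H then f G H else 0)"
    by (rule sum.cong[OF refl]) (simp only: sum.inter_filter[OF finite_flats])
  also have "\<dots> = (\<Sum>H\<in>flats M. \<Sum>G\<in>flats M. if G \<subseteq> H then f G H else 0)" by (rule sum.swap)
  also have "\<dots> = (\<Sum>H\<in>flats M. \<Sum>G\<in>{G \<in> flats M. G \<subseteq> H}. f G H)"
    by (rule sum.cong[OF refl]) (simp only: sum.inter_filter[OF finite_flats])
  finally show ?thesis .
qed

text \<open>Weight the identities \<open>sum_kl_rev\<close> by the Moebius function and sum over all
  \<open>G\<close>. On one side everything cancels except the minimum flat; on the other the inner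
  sums form the characteristic polynomials.\<close>

lemma reverse_kl:
  "reverse_poly (rk M) (kl M) = (\<Sum>F\<in>flats M. char_poly_restr M F * kl (contraction M F))"
proof -
  let ?mu = "moebius (flats M) (loops M)" and ?r = "rank_of M"
  have "(\<Sum>G\<in>flats M. \<Sum>H\<in>{H \<in> flats M. G \<subseteq> H}. smult (?mu G) (kl_rev M H))
      = (\<Sum>H\<in>flats M. smult (\<Sum>G\<in>{G \<in> flats M. G \<subseteq> H}. ?mu G) (kl_rev M H))"
    by (simp add: sum_flats_swap smult_sum)
  also have "\<dots> = (\<Sum>H\<in>flats M. if H = loops M then kl_rev M (loops M) else 0)"
    by (intro sum.cong refl) (simp add: moebius_sum)
  also have "\<dots> = kl_rev M (loops M)" by (subst sum.delta) (simp_all add: finite_flats loops_flat)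
  also have "\<dots> = reverse_poly (rk M) (kl M)" by (simp add: kl_rev_def rank_of_loops kl_contraction_loops)
  finally have "reverse_poly (rk M) (kl M) = (\<Sum>G\<in>flats M. \<Sum>H\<in>{H \<in> flats M. G \<subseteq> H}. smult (?mu G) (kl_rev M H))" ..
  also have "\<dots> = (\<Sum>G\<in>flats M. [:?mu G:] * (\<Sum>H\<in>{H \<in> flats M. G \<subseteq> H}. kl_rev M H))"
    by (simp add: sum_distrib_left)
  also have "\<dots> = (\<Sum>G\<in>flats M. [:?mu G:] * (\<Sum>H\<in>{H \<in> flats M. G \<subseteq> H}. monom 1 (?r H - ?r G) * kl (contraction M H)))"
    by (intro sum.cong refl) (simp only: sum_kl_rev)
  also have "\<dots> = (\<Sum>G\<in>flats M. \<Sum>H\<in>{H \<in> flats M. G \<subseteq> H}. monom (?mu G) (?r H - ?r G) * kl (contraction M H))"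
    unfolding sum_distrib_left by (intro sum.cong refl) (simp add: smult_monom flip: mult_smult_left)
  also have "\<dots> = (\<Sum>H\<in>flats M. \<Sum>G\<in>{G \<in> flats M. G \<subseteq> H}. monom (?mu G) (?r H - ?r G) * kl (contraction M H))"
    by (rule sum_flats_swap)
  also have "\<dots> = (\<Sum>H\<in>flats M. char_poly_restr M H * kl (contraction M H))"
    by (simp add: char_poly_restr_def min_flat_eq sum_distrib_right)
  finally show ?thesis .
qed

lemma is_KL_kl: "is_KL kl"
  unfolding is_KL_def
proof (intro allI conjI impI)
  fix M :: "'a matroid" assume "0 < rk M"
  then have "real (2 * degree (kl M)) < real (rk M)" using degree_kl[of M] by (simp only: of_nat_less_iff)
  then show "real (degree (kl M)) < real (rk M) / 2" by simp
qed (simp_all add: kl_rank_0 reverse_kl)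

text \<open>If \<open>M\<close> has loops, the defining equation also involves the contraction by
  the loops, a different matroid of the same rank, which induction on the rank does not reach. That
  contraction is treated first.\<close>

lemma is_KL_unique:
  assumes P: "is_KL P" and Q: "is_KL Q"
  shows "P M = Q M"
proof (induction "rk M" arbitrary: M rule: less_induct)
  case (less M)
  show ?case
  proof (cases "rk M = 0")
    case True
    then show ?thesis using P Q by (simp add: is_KL_def)
  next
    case False
    have deg: "2 * degree (R N) < rk N" if "is_KL R" "rk N > 0" for R :: "'a matroid \<Rightarrow> int poly" and N
    proof -
      have "real (degree (R N)) < real (rk N) / 2" using that by (simp add: is_KL_def)
      then show ?thesis by linarith
    qed
    have char0: "char_poly_restr N (loops N) = 1" for N :: "'a matroid"
    proof -
      have "{G \<in> flats N. G \<subseteq> loops N} = {loops N}" using loops_subset_flat loops_flat by blast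
      then show ?thesis by (simp add: char_poly_restr_def min_flat_eq moebius.simps monom_eq_1)
    qed
    have eq: "reverse_poly (rk N) (P N) - P (contraction N (loops N)) = reverse_poly (rk N) (Q N) - Q (contraction N (loops N))"
      if N: "rk N = rk M" for N
    proof -
      have IH: "P (contraction N F) = Q (contraction N F)" if "F \<in> flats N" "rank_of N F > 0" for F
        using less[of "contraction N F"] rk_contraction[OF flatD(1)[OF that(1)]] that N by simp
      have "reverse_poly (rk N) (R N) - R (contraction N (loops N))
          = (\<Sum>F\<in>{F \<in> flats N. rank_of N F > 0}. char_poly_restr N F * R (contraction N F))" if "is_KL R" for R :: "'a matroid \<Rightarrow> int poly"
      proof -
        have "reverse_poly (rk N) (R N) = (\<Sum>F\<in>flats N. char_poly_restr N F * R (contraction N F))"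
          using that by (simp add: is_KL_def)
        then show ?thesis by (simp add: sum_flats_split char0)
      qed
      then show ?thesis using P Q IH by (auto intro!: sum.cong)
    qed
    let ?N = "contraction M (loops M)"
    have rN: "rk ?N = rk M"
      using rk_contraction[of "loops M" M] flatD(1)[OF loops_flat[of M]] by (simp add: rank_of_loops)
    have N0: "loops ?N = {}" by (rule loops_contraction_flat[OF loops_flat])
    have rev: "coeff (reverse_poly (rk M) (R N)) t = (if t \<le> rk M then coeff (R N) (rk M - t) else 0)"
      if "is_KL R" "rk N = rk M" for R :: "'a matroid \<Rightarrow> int poly" and N t
      using deg[OF that(1), of N] that False by (intro coeff_reverse_poly) auto
    have zero: "coeff (R N) t = 0" if "is_KL R" "rk N = rk M" "rk M \<le> 2 * t" for R :: "'a matroid \<Rightarrow> int poly" and N t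
      using deg[OF that(1), of N] that False by (intro coeff_eq_0) auto
    \<comment> \<open>In \<open>?N\<close> the minimum flat is empty, so its term is
      \<open>P ?N\<close> itself. The equation then determines the difference of \<open>P ?N\<close>
      and its reversal, and the degree bound keeps the two from overlapping.\<close>
    have PN: "P ?N = Q ?N"
    proof (rule poly_eqI)
      fix t
      have "coeff (reverse_poly (rk M) (P ?N)) t - coeff (P ?N) t = coeff (reverse_poly (rk M) (Q ?N)) t - coeff (Q ?N) t"
        using arg_cong[OF eq[OF rN], of "\<lambda>p. coeff p t"] rN N0 by (simp add: contraction_empty)
      then show "coeff (P ?N) t = coeff (Q ?N) t"
      proof (cases "rk M \<le> 2 * t")
        case True
        then show ?thesis using zero[OF P rN True] zero[OF Q rN True] by simp
      next
        case F: False
        then have "rk M \<le> 2 * (rk M - t)" by simp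
        then have "coeff (P ?N) (rk M - t) = 0" "coeff (Q ?N) (rk M - t) = 0"
          using zero[OF P rN] zero[OF Q rN] by auto
        then show ?thesis
          using \<open>coeff (reverse_poly (rk M) (P ?N)) t - coeff (P ?N) t = coeff (reverse_poly (rk M) (Q ?N)) t - coeff (Q ?N) t\<close>
          by (auto simp: rev[OF P rN] rev[OF Q rN] split: if_splits)
      qed
    qed
    have r: "reverse_poly (rk M) (P M) = reverse_poly (rk M) (Q M)" using eq[of M] PN by simp
    show ?thesis
    proof (rule poly_eqI)
      fix t
      show "coeff (P M) t = coeff (Q M) t"
      proof (cases "t \<le> rk M")
        case True
        then show ?thesis
          using arg_cong[OF r, of "\<lambda>p. coeff p (rk M - t)"] by (simp add: rev[OF P] rev[OF Q])
      next
        case F: False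
        then have "rk M \<le> 2 * t" by simp
        then show ?thesis using zero[OF P refl] zero[OF Q refl] by simp
      qed
    qed
  qed
qed

lemma KL_poly_eq: "KL_poly = kl"
  unfolding KL_poly_def using is_KL_kl is_KL_unique by (intro the_equality) (auto intro!: ext)

lemma Z_poly_eq: "Z_poly M = z_full M"
  by (simp add: Z_poly_def z_full_def KL_poly_eq)

section \<open>Sparse paving matroids\<close>

text \<open>\<open>H\<close> is the set of circuit-hyperplanes. Carrying it explicitly gives a
  description that passes to contractions by sets of fewer than \<open>k\<close> elements, with the
  members of \<open>H\<close> containing the set surviving.\<close>

definition sp_matroid :: "'a matroid \<Rightarrow> nat \<Rightarrow> 'a set set \<Rightarrow> bool" where
  "sp_matroid M k H \<longleftrightarrow> rk M = k \<and> H \<subseteq> {C. C \<subseteq> ground M \<and> card C = k} \<and>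
     (\<forall>C\<in>H. \<forall>C'\<in>H. C \<noteq> C' \<longrightarrow> card (C \<inter> C') + 2 \<le> k) \<and>
     indeps M = {X. X \<subseteq> ground M \<and> card X \<le> k \<and> X \<notin> H}"

lemma sp_matroidD:
  assumes "sp_matroid M k H"
  shows "rk M = k" "\<And>C. C \<in> H \<Longrightarrow> C \<subseteq> ground M" "\<And>C. C \<in> H \<Longrightarrow> card C = k"
    "\<And>C C'. C \<in> H \<Longrightarrow> C' \<in> H \<Longrightarrow> C \<noteq> C' \<Longrightarrow> card (C \<inter> C') + 2 \<le> k"
    "\<And>X. X \<in> indeps M \<longleftrightarrow> X \<subseteq> ground M \<and> card X \<le> k \<and> X \<notin> H"
  using assms unfolding sp_matroid_def by auto

lemma paving_indep:
  assumes "paving M" "X \<subseteq> ground M" "card X < rk M"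
  shows "X \<in> indeps M"
proof (rule ccontr)
  assume X: "X \<notin> indeps M"
  let ?P = "\<lambda>C. C \<subseteq> X \<and> C \<notin> indeps M"
  have "?P X" using X by simp
  then obtain C where C: "?P C" "\<And>D. ?P D \<Longrightarrow> card C \<le> card D"
    using ex_has_least_nat[of ?P X card] by blast
  have finX: "finite X" using assms(2) matroidD(1) finite_subset by blast
  have "D \<in> indeps M" if "D \<subset> C" for D
  proof (rule ccontr)
    assume "D \<notin> indeps M"
    then have "card C \<le> card D" using C that by blast
    moreover have "card D < card C" using that C finX by (meson finite_subset psubset_card_mono)
    ultimately show False by simp
  qed
  then have "circuit M C" using C(1) assms(2) by (auto simp: circuit_def)
  then have "rk M \<le> card C" using assms(1) by (simp add: paving_def)
  moreover have "card C \<le> card X" using C(1) finX by (simp add: card_mono)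
  ultimately show False using assms(3) by simp
qed

lemma indep_card_le_rk: "X \<in> indeps M \<Longrightarrow> card X \<le> rk M"
  unfolding rk_def by (rule rank_of_ge) (auto simp: matroidD(2))

lemma rk_dual_ge: "card (ground M) \<le> rk (dual M) + rk M"
proof -
  obtain B where B: "basis_in (indeps M) (ground M) B" "rank_of M (ground M) = card B"
    using basis_exists[of "{}" M "ground M"] matroidD(4) by (metis empty_subsetI)
  have BE: "B \<subseteq> ground M" using B by (auto simp: basis_in_def)
  have "ground M - B \<in> indeps (dual M)" using B by (auto simp: indeps_dual)
  then have "card (ground M - B) \<le> rk (dual M)" by (rule indep_card_le_rk)
  moreover have "card (ground M - B) = card (ground M) - card B"
    using BE matroidD(1)[of M] by (simp add: card_Diff_subset finite_subset)
  ultimately show ?thesis using B(2) by (simp add: rk_def)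
qed

text \<open>Suppose two dependent \<open>k\<close>-sets met in \<open>k - 1\<close> elements. Their
  union \<open>U\<close> has \<open>k + 1\<close> elements, and \<open>C \<inter> C'\<close> is
  maximal independent in it, since adding an element gives \<open>C\<close> or \<open>C'\<close>.
  But the complement of \<open>U\<close> is smaller than the rank of the dual, so it is
  coindependent by paving, and some basis of size \<open>k\<close> lies in \<open>U\<close>.\<close>

lemma sparse_paving_sp_matroid:
  assumes "sparse_paving M"
  shows "sp_matroid M (rk M) {C. C \<subseteq> ground M \<and> card C = rk M \<and> C \<notin> indeps M}"
proof -
  have pav: "paving M" "paving (dual M)" using assms by (auto simp: sparse_paving_def)
  let ?k = "rk M" and ?E = "ground M"
  have finE: "finite ?E" by (rule matroidD(1))
  have "card (C \<inter> C') + 2 \<le> ?k"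
    if C: "C \<subseteq> ?E" "card C = ?k" "C \<notin> indeps M" and C': "C' \<subseteq> ?E" "card C' = ?k" "C' \<notin> indeps M"
      and ne: "C \<noteq> C'" for C C'
  proof (rule ccontr)
    assume no: "\<not> card (C \<inter> C') + 2 \<le> ?k"
    have fin: "finite C" "finite C'" using C C' finE finite_subset by blast+
    have lt: "card (C \<inter> C') < ?k"
    proof -
      have "C \<inter> C' \<noteq> C" using ne C C' fin card_subset_eq[of C' C] by auto
      then have "C \<inter> C' \<subset> C" by auto
      then show ?thesis using psubset_card_mono[OF fin(1)] C(2) by metis
    qed
    then have c: "card (C \<inter> C') + 1 = ?k" using no by simp
    have I0: "C \<inter> C' \<in> indeps M" using paving_indep[OF pav(1) _ lt] C by blast
    define U where "U = C \<union> C'"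
    have UE: "U \<subseteq> ?E" using C C' by (auto simp: U_def)
    have cU: "card U = ?k + 1" using card_Un_Int[OF fin] C C' c by (simp add: U_def)
    have finU: "finite U" using UE finE finite_subset by blast
    have "card (?E - U) = card ?E - (?k + 1)" using UE finU cU by (simp add: card_Diff_subset)
    moreover have "card U \<le> card ?E" using UE finE by (simp add: card_mono)
    ultimately have "card (?E - U) < rk (dual M)" using rk_dual_ge[of M] cU by simp
    then have "?E - U \<in> indeps (dual M)" using paving_indep[OF pav(2)] by (simp add: ground_dual)
    then obtain B where B: "basis_in (indeps M) ?E B" "B \<inter> (?E - U) = {}" by (auto simp: indeps_dual)
    then have BI: "B \<in> indeps M" "B \<subseteq> U" by (auto simp: basis_in_def)
    have cB: "card B = ?k" using rank_of_basis[OF B(1)] by (simp add: rk_def)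
    have "basis_in (indeps M) U (C \<inter> C')"
      unfolding basis_in_def
    proof (intro conjI ballI notI)
      fix x assume x: "x \<in> U - C \<inter> C'" "insert x (C \<inter> C') \<in> indeps M"
      have cx: "card (insert x (C \<inter> C')) = ?k" using x(1) fin c by simp
      have "x \<in> C \<or> x \<in> C'" using x(1) by (auto simp: U_def)
      then have "insert x (C \<inter> C') \<subseteq> C \<or> insert x (C \<inter> C') \<subseteq> C'" by auto
      then have "insert x (C \<inter> C') = C \<or> insert x (C \<inter> C') = C'"
        using cx C C' fin card_subset_eq[of C "insert x (C \<inter> C')"] card_subset_eq[of C' "insert x (C \<inter> C')"] by auto
      then show False using x(2) C C' by auto
    qed (use I0 in \<open>auto simp: U_def\<close>)
    then have "card B \<le> card (C \<inter> C')" using basis_in_card[OF matroid_axioms _ BI] by blast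
    then show False using cB c by simp
  qed
  moreover have "X \<in> indeps M \<longleftrightarrow> X \<subseteq> ?E \<and> card X \<le> ?k \<and> \<not> (X \<subseteq> ?E \<and> card X = ?k \<and> X \<notin> indeps M)" for X
    using paving_indep[OF pav(1), of X] indep_card_le_rk[of X M] matroidD(2)[of X M] by (metis le_neq_implies_less)
  ultimately show ?thesis unfolding sp_matroid_def by (intro conjI) auto
qed

lemma sp_matroid_contraction:
  assumes S: "sp_matroid M k H" and F: "F \<subseteq> ground M" "card F < k"
  shows "sp_matroid (contraction M F) (k - card F) ((\<lambda>C. C - F) ` {C \<in> H. F \<subseteq> C})"
    and "rank_of M F = card F"
proof -
  note SD = sp_matroidD[OF S]
  have finE: "finite (ground M)" by (rule matroidD(1))
  have finF: "finite F" using F finE finite_subset by blast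
  have "F \<notin> H" using SD(3)[of F] F by auto
  then have FI: "F \<in> indeps M" using F by (simp add: SD(5))
  then show rF: "rank_of M F = card F" by (simp add: indep_iff_rank)
  let ?H = "(\<lambda>C. C - F) ` {C \<in> H. F \<subseteq> C}"
  have basis: "basis_in (indeps M) F B \<longleftrightarrow> B = F" for B
  proof
    assume B: "basis_in (indeps M) F B"
    show "B = F"
    proof (rule ccontr)
      assume "B \<noteq> F"
      then obtain x where "x \<in> F - B" "B \<subseteq> F" using B by (auto simp: basis_in_def)
      moreover from this have "insert x B \<in> indeps M" using matroidD(5)[OF FI] by auto
      ultimately show False using B by (auto simp: basis_in_def)
    qed
  qed (use FI in \<open>auto simp: basis_in_def\<close>)
  have HX: "X \<union> F \<in> H \<longleftrightarrow> X \<in> ?H" if "X \<subseteq> ground M - F" for X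
  proof
    assume "X \<union> F \<in> H"
    moreover have "X \<union> F - F = X" using that by auto
    ultimately show "X \<in> ?H" by (intro image_eqI[of _ _ "X \<union> F"]) auto
  next
    assume "X \<in> ?H"
    then obtain C where C: "C \<in> H" "F \<subseteq> C" "X = C - F" by auto
    then have "X \<union> F = C" by auto
    then show "X \<union> F \<in> H" using C by simp
  qed
  have cX: "card (X \<union> F) = card X + card F" if "X \<subseteq> ground M - F" for X
    using that finE finF by (intro card_Un_disjoint) (auto intro: finite_subset)
  have i1: "X \<in> indeps (contraction M F) \<longleftrightarrow> X \<subseteq> ground M - F \<and> card X \<le> k - card F \<and> X \<notin> ?H" for X
  proof (cases "X \<subseteq> ground M - F")
    case True
    have "X \<in> indeps (contraction M F) \<longleftrightarrow> X \<union> F \<in> indeps M"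
      using True by (simp add: indeps_contraction basis)
    also have "\<dots> \<longleftrightarrow> X \<union> F \<subseteq> ground M \<and> card (X \<union> F) \<le> k \<and> X \<union> F \<notin> H" by (rule SD(5))
    also have "\<dots> \<longleftrightarrow> card X \<le> k - card F \<and> X \<notin> ?H"
      unfolding HX[OF True] cX[OF True] using True F by auto
    finally show ?thesis using True by simp
  next
    case False
    then show ?thesis by (simp add: indeps_contraction)
  qed
  have i2: "rk (contraction M F) = k - card F"
    using rk_contraction[OF F(1)] rF SD(1) by simp
  have i3: "card (D \<inter> D') + 2 \<le> k - card F" if "D \<in> ?H" "D' \<in> ?H" "D \<noteq> D'" for D D'
  proof -
    obtain C C' where C: "C \<in> H" "F \<subseteq> C" "D = C - F" "C' \<in> H" "F \<subseteq> C'" "D' = C' - F"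
      using \<open>D \<in> ?H\<close> \<open>D' \<in> ?H\<close> by auto
    have fin: "finite (C \<inter> C')" using SD(2)[OF C(1)] finE finite_subset by blast
    have "D \<inter> D' = C \<inter> C' - F" using C by auto
    then have "card (D \<inter> D') = card (C \<inter> C') - card F" using C finF by (simp add: card_Diff_subset)
    moreover have "card F \<le> card (C \<inter> C')" using C fin by (intro card_mono) auto
    moreover have "card (C \<inter> C') + 2 \<le> k" using SD(4)[OF C(1,4)] C that(3) by auto
    ultimately show ?thesis by simp
  qed
  have i4: "D \<subseteq> ground M - F \<and> card D = k - card F" if D: "D \<in> ?H" for D
  proof -
    obtain C where C: "C \<in> H" "F \<subseteq> C" "D = C - F" using D by auto
    have "card D = k - card F" unfolding C(3) using card_Diff_subset[OF finF C(2)] SD(3)[OF C(1)] by simp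
    then show ?thesis using SD(2)[OF C(1)] C(3) by blast
  qed
  show "sp_matroid (contraction M F) (k - card F) ?H"
    unfolding sp_matroid_def ground_contraction
  proof (intro conjI)
    show "?H \<subseteq> {C. C \<subseteq> ground M - F \<and> card C = k - card F}" using i4 by (intro subsetI CollectI)
    show "\<forall>C\<in>?H. \<forall>C'\<in>?H. C \<noteq> C' \<longrightarrow> card (C \<inter> C') + 2 \<le> k - card F"
      using i3 by (intro ballI impI)
    show "indeps (contraction M F) = {X. X \<subseteq> ground M - F \<and> card X \<le> k - card F \<and> X \<notin> ?H}"
      using i1 by (intro set_eqI) (simp only: mem_Collect_eq)
  qed (rule i2)
qed

lemma sp_matroid_superset_unique:
  assumes S: "sp_matroid M k H" and "C \<in> H" "C' \<in> H" "C \<subseteq> U" "C' \<subseteq> U" "finite U" "card U = k + 1"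
  shows "C = C'"
proof (rule ccontr)
  assume "C \<noteq> C'"
  then have "card (C \<inter> C') + 2 \<le> k" using sp_matroidD(4)[OF S] assms by blast
  moreover have "card (C \<union> C') \<le> k + 1" using assms card_mono[of U "C \<union> C'"] by auto
  moreover have "finite C" "finite C'" using assms finite_subset by blast+
  then have "card C + card C' = card (C \<union> C') + card (C \<inter> C')" by (rule card_Un_Int)
  ultimately show False using sp_matroidD(3)[OF S] assms by simp
qed

lemma sp_matroid_subset_unique:
  assumes S: "sp_matroid M k H" and "C \<in> H" "C' \<in> H" "F \<subseteq> C" "F \<subseteq> C'" "card F + 1 = k"
  shows "C = C'"
proof (rule ccontr)
  assume "C \<noteq> C'"
  then have "card (C \<inter> C') + 2 \<le> k" using sp_matroidD(4)[OF S] assms by blast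
  moreover have "finite (C \<inter> C')"
    using sp_matroidD(2)[OF S assms(2)] matroidD(1)[of M] finite_subset by blast
  then have "card F \<le> card (C \<inter> C')" using assms by (intro card_mono) auto
  ultimately show False using assms by simp
qed

lemma rank_of_sp_matroid:
  assumes S: "sp_matroid M k H" and A: "A \<subseteq> ground M"
  shows "A \<in> H \<Longrightarrow> rank_of M A = k - 1"
    and "card A \<ge> k \<Longrightarrow> A \<notin> H \<Longrightarrow> rank_of M A = k"
proof -
  note SD = sp_matroidD[OF S]
  have finA: "finite A" using A matroidD(1) finite_subset by blast
  have le: "rank_of M A \<le> k" using rank_of_le_rk[OF A] SD(1) by simp
  show "rank_of M A = k - 1" if AH: "A \<in> H"
  proof -
    have cA: "card A = k" using SD(3) AH by simp
    have "A \<notin> indeps M" using SD(5) AH by simp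
    then have "rank_of M A \<noteq> k" using A cA by (simp add: indep_iff_rank)
    moreover have "k - 1 \<le> rank_of M A" if kp: "k > 0"
    proof -
      obtain x where "x \<in> A" using cA kp by fastforce
      then have c: "card (A - {x}) = k - 1" using cA finA by simp
      have "A - {x} \<notin> H" using SD(3)[of "A - {x}"] c kp by auto
      then have "A - {x} \<in> indeps M" using c A by (auto simp: SD(5))
      then show ?thesis using rank_of_ge[of "A - {x}" M A] c by auto
    qed
    ultimately show ?thesis using le by (cases "k = 0") auto
  qed
  show "rank_of M A = k" if cA: "card A \<ge> k" and AH: "A \<notin> H"
  proof -
    have "\<exists>B\<subseteq>A. card B = k \<and> B \<notin> H"
    proof (cases "card A = k")
      case False
      then obtain U where U: "U \<subseteq> A" "card U = k + 1" "finite U"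
        using cA obtain_subset_with_card_n[of "k + 1" A] by (metis Suc_eq_plus1 Suc_leI le_neq_implies_less)
      show ?thesis
      proof (cases "k = 0")
        case True
        have "{} \<notin> H" using matroidD(4)[of M] by (simp add: SD(5))
        then show ?thesis using True by (intro exI[of _ "{}"]) auto
      next
        case k: False
        obtain x where x: "x \<in> U" using U(2) by fastforce
        have cx: "card (U - {x}) = k" using U x by simp
        then obtain y where y: "y \<in> U" "y \<noteq> x" using k by (metis Diff_iff card.empty equals0I singletonI)
        have cy: "card (U - {y}) = k" using U y by simp
        have "U - {x} \<noteq> U - {y}" using x y by auto
        \<comment> \<open>A set of size \<open>k + 1\<close> contains at most one member of
          \<open>H\<close>, so one of two distinct \<open>k\<close>-subsets is independent.\<close>
        then have "\<not> (U - {x} \<in> H \<and> U - {y} \<in> H)"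
          using sp_matroid_superset_unique[OF S, of "U - {x}" "U - {y}" U] U by auto
        then show ?thesis using cx cy U(1) by (metis Diff_subset subset_trans)
      qed
    qed (use AH in auto)
    then obtain B where B: "B \<subseteq> A" "card B = k" "B \<notin> H" by auto
    then have "B \<in> indeps M" using A by (auto simp: SD(5))
    then show ?thesis using rank_of_ge[of B M A] B le by simp
  qed
qed

text \<open>A set of size \<open>k - 1\<close> inside a circuit-hyperplane \<open>C\<close> has the
  same rank as \<open>C\<close>, so it is not closed; otherwise the flats are as in a uniform
  matroid, with the members of \<open>H\<close> added.\<close>

lemma flats_sp_matroid:
  assumes S: "sp_matroid M k H" and k: "k \<ge> 2"
  shows "flats M = {F. F \<subseteq> ground M \<and> card F + 2 \<le> k}
     \<union> {F. F \<subseteq> ground M \<and> card F + 1 = k \<and> (\<forall>C\<in>H. \<not> F \<subseteq> C)} \<union> H \<union> {ground M}" (is "_ = ?R")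
proof (intro set_eqI iffI)
  note SD = sp_matroidD[OF S]
  fix F assume F: "F \<in> flats M"
  have FE: "F \<subseteq> ground M" using flatD(1)[OF F] .
  have finF: "finite F" by (rule finite_flat[OF F])
  consider "card F + 2 \<le> k" | "card F + 1 = k" | "card F \<ge> k" by linarith
  then show "F \<in> ?R"
  proof cases
    case 2
    have "\<not> F \<subseteq> C" if C: "C \<in> H" for C
    proof
      assume FC: "F \<subseteq> C"
      have "F \<noteq> C" using 2 SD(3)[OF C] by auto
      then have "rank_of M F < rank_of M C" using rank_of_flat_less[OF F SD(2)[OF C]] FC by auto
      moreover have "rank_of M C = k - 1" using rank_of_sp_matroid(1)[OF S SD(2)[OF C] C] .
      moreover have "rank_of M F = card F" using sp_matroid_contraction(2)[OF S FE] 2 by simp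
      ultimately show False using 2 by simp
    qed
    then show ?thesis using 2 FE by auto
  next
    case 3
    show ?thesis
    proof (cases "F \<in> H")
      case False
      then have "rank_of M F = k" using rank_of_sp_matroid(2)[OF S FE 3] by simp
      moreover have "F \<noteq> ground M \<Longrightarrow> rank_of M F < rk M"
        unfolding rk_def using rank_of_flat_less[OF F order_refl] FE by blast
      ultimately show ?thesis using SD(1) by auto
    qed simp
  qed (use FE in simp)
next
  note SD = sp_matroidD[OF S]
  have finE: "finite (ground M)" by (rule matroidD(1))
  fix F assume R: "F \<in> ?R"
  then have FE: "F \<subseteq> ground M" using SD(2) by auto
  have finF: "finite F" using FE finE finite_subset by blast
  have "rank_of M F < rank_of M (insert x F)" if x: "x \<in> ground M - F" for x
  proof -
    have xE: "insert x F \<subseteq> ground M" using FE x by auto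
    have cx: "card (insert x F) = card F + 1" using x finF by simp
    consider "card F + 2 \<le> k" | "card F + 1 = k" "\<forall>C\<in>H. \<not> F \<subseteq> C" | "F \<in> H" | "F = ground M" using R by auto
    then show ?thesis
    proof cases
      case 1
      then have "card F < k" "card (insert x F) < k" using cx by auto
      then have "rank_of M F = card F" "rank_of M (insert x F) = card (insert x F)"
        using sp_matroid_contraction(2)[OF S FE] sp_matroid_contraction(2)[OF S xE] by auto
      then show ?thesis using cx by simp
    next
      case 2
      then have "insert x F \<notin> H" by blast
      then have "rank_of M (insert x F) = k" using rank_of_sp_matroid(2)[OF S xE] 2 cx by simp
      moreover have "rank_of M F = card F" using sp_matroid_contraction(2)[OF S FE] 2 by simp
      ultimately show ?thesis using 2 by simp
    next
      case 3
      then have "insert x F \<notin> H" using SD(3)[of F] SD(3)[of "insert x F"] cx by auto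
      then have "rank_of M (insert x F) = k" using rank_of_sp_matroid(2)[OF S xE] SD(3)[OF 3] cx by simp
      then show ?thesis using rank_of_sp_matroid(1)[OF S FE 3] k by simp
    qed (use x in auto)
  qed
  then show "F \<in> flats M" using FE by (simp add: flats_def)
qed

section \<open>Counting circuit-hyperplanes\<close>

lemma card_filter_sum: "finite A \<Longrightarrow> card {x \<in> A. P x} = (\<Sum>x\<in>A. if P x then 1 else 0)"
  by (simp only: card_eq_sum sum.inter_filter)

lemma sum_card_containing:
  assumes E: "finite E" and H: "\<And>C. C \<in> H \<Longrightarrow> C \<subseteq> E \<and> card C = k"
  shows "(\<Sum>F\<in>{F. F \<subseteq> E \<and> card F = r}. card {C \<in> H. F \<subseteq> C}) = card H * (k choose r)"
proof -
  have "H \<subseteq> Pow E" using H by blast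
  then have finH: "finite H" by (rule finite_subset) (simp add: E)
  have "{F. F \<subseteq> E \<and> card F = r} \<subseteq> Pow E" by blast
  then have finF: "finite {F. F \<subseteq> E \<and> card F = r}" by (rule finite_subset) (simp add: E)
  have "(\<Sum>F\<in>{F. F \<subseteq> E \<and> card F = r}. card {C \<in> H. F \<subseteq> C})
      = (\<Sum>F\<in>{F. F \<subseteq> E \<and> card F = r}. \<Sum>C\<in>H. if F \<subseteq> C then 1 else 0)"
    by (rule sum.cong[OF refl]) (rule card_filter_sum[OF finH])
  also have "\<dots> = (\<Sum>C\<in>H. \<Sum>F\<in>{F. F \<subseteq> E \<and> card F = r}. if F \<subseteq> C then 1 else 0)" by (rule sum.swap)
  also have "\<dots> = (\<Sum>C\<in>H. k choose r)"
  proof (rule sum.cong[OF refl])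
    fix C assume C: "C \<in> H"
    have CE: "C \<subseteq> E" "card C = k" using H[OF C] by simp_all
    have finC: "finite C" by (rule finite_subset[OF CE(1) E])
    have "(\<Sum>F\<in>{F. F \<subseteq> E \<and> card F = r}. if F \<subseteq> C then 1 else 0) = card {F \<in> {F. F \<subseteq> E \<and> card F = r}. F \<subseteq> C}"
      by (rule card_filter_sum[OF finF, symmetric])
    also have "{F \<in> {F. F \<subseteq> E \<and> card F = r}. F \<subseteq> C} = {F. F \<subseteq> C \<and> card F = r}" using CE(1) by blast
    also have "card \<dots> = card C choose r" by (rule n_subsets[OF finC])
    finally show "(\<Sum>F\<in>{F. F \<subseteq> E \<and> card F = r}. if F \<subseteq> C then 1 else 0) = k choose r" unfolding CE(2) .
  qed
  finally show ?thesis by simp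
qed

lemma Suc_times_choose_Suc: "Suc k * (n choose Suc k) = (n - k) * (n choose k)"
  by (simp only: binomial_absorb_comp binomial_absorption)

text \<open>Each \<open>(k - 1)\<close>-set lies in at most one member of \<open>H\<close>, so the
  subsets obtained by deleting one element are all distinct:
  \<open>card H * k \<le> C(k + m, k - 1)\<close>. Absorption converts this to the stated
  form.\<close>

lemma sp_matroid_bound_below:
  assumes S: "sp_matroid M k H" and n: "card (ground M) = k + m" and k: "k > 0"
  shows "card H * (m + 1) \<le> (m + k choose k)"
proof -
  note SD = sp_matroidD[OF S]
  let ?E = "ground M"
  have finE: "finite ?E" by (rule matroidD(1))
  have finC: "finite C" if "C \<in> H" for C by (rule finite_subset[OF SD(2)[OF that] finE])
  have "H \<subseteq> Pow ?E" using SD(2) by blast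
  then have finH: "finite H" by (rule finite_subset) (simp add: finE)
  have "card (SIGMA C:H. C) = (\<Sum>C\<in>H. card C)" by (rule card_SigmaI) (use finH finC in blast)+
  also have "\<dots> = (\<Sum>C\<in>H. k)" by (rule sum.cong[OF refl]) (rule SD(3))
  also have "\<dots> = card H * k" by simp
  finally have c: "card (SIGMA C:H. C) = card H * k" .
  have cx: "card (C - {x}) + 1 = k" if "C \<in> H" "x \<in> C" for C x
    using card_Suc_Diff1[OF finC[OF that(1)] that(2)] SD(3)[OF that(1)] by simp
  have inj: "inj_on (\<lambda>p. fst p - {snd p}) (SIGMA C:H. C)"
  proof (rule inj_onI)
    fix p q assume p: "p \<in> (SIGMA C:H. C)" and q: "q \<in> (SIGMA C:H. C)" and eq: "fst p - {snd p} = fst q - {snd q}"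
    obtain C x where px: "p = (C, x)" "C \<in> H" "x \<in> C" using p by blast
    obtain C' x' where qx: "q = (C', x')" "C' \<in> H" "x' \<in> C'" using q by blast
    have e: "C - {x} = C' - {x'}" using eq px qx by simp
    have "C - {x} \<subseteq> C" "C - {x} \<subseteq> C'" using e by blast+
    then have "C = C'" by (rule sp_matroid_subset_unique[OF S px(2) qx(2) _ _ cx[OF px(2,3)]])
    moreover from this have "x = x'" using e px qx by blast
    ultimately show "p = q" using px qx by simp
  qed
  have "(\<lambda>p. fst p - {snd p}) ` (SIGMA C:H. C) \<subseteq> {F. F \<subseteq> ?E \<and> card F = k - 1}"
  proof
    fix F assume "F \<in> (\<lambda>p. fst p - {snd p}) ` (SIGMA C:H. C)"
    then obtain C x where C: "C \<in> H" "x \<in> C" "F = C - {x}" by force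
    then show "F \<in> {F. F \<subseteq> ?E \<and> card F = k - 1}" using SD(2)[OF C(1)] cx[OF C(1,2)] by auto
  qed
  moreover have "finite {F. F \<subseteq> ?E \<and> card F = k - 1}"
    by (rule finite_subset[of _ "Pow ?E"]) (auto simp: finE)
  ultimately have "card (SIGMA C:H. C) \<le> card {F. F \<subseteq> ?E \<and> card F = k - 1}"
    by (rule card_inj_on_le[OF inj])
  also have "\<dots> = (k + m choose (k - 1))" unfolding n_subsets[OF finE] n ..
  finally have "card H * k \<le> (k + m choose (k - 1))" unfolding c .
  then have "card H * k * (m + 1) \<le> (k + m choose (k - 1)) * (m + 1)" by (rule mult_right_mono) simp
  also have "\<dots> = (m + k choose k) * k"
  proof -
    have "Suc (k - 1) * (k + m choose Suc (k - 1)) = (k + m - (k - 1)) * (k + m choose (k - 1))"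
      by (rule Suc_times_choose_Suc)
    moreover have "Suc (k - 1) = k" "k + m - (k - 1) = m + 1" using k by simp_all
    ultimately show ?thesis by (simp only: mult.commute add.commute[of k m])
  qed
  finally have "k * (card H * (m + 1)) \<le> k * (m + k choose k)" by (simp only: mult_ac)
  then show ?thesis using k by simp
qed

text \<open>The same count upwards: the sets obtained by adding one element are all distinct, so
  \<open>card H * m \<le> C(k + m, k + 1)\<close>.\<close>

lemma sp_matroid_bound_above:
  assumes S: "sp_matroid M k H" and n: "card (ground M) = k + m" and m: "m > 0"
  shows "card H * (k + 1) \<le> (m + k choose k)"
proof -
  note SD = sp_matroidD[OF S]
  let ?E = "ground M"
  have finE: "finite ?E" by (rule matroidD(1))
  have finC: "finite C" if "C \<in> H" for C by (rule finite_subset[OF SD(2)[OF that] finE])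
  have "H \<subseteq> Pow ?E" using SD(2) by blast
  then have finH: "finite H" by (rule finite_subset) (simp add: finE)
  have cc: "card (?E - C) = m" if "C \<in> H" for C
    using card_Diff_subset[OF finC[OF that] SD(2)[OF that]] SD(3)[OF that] n by simp
  have "card (SIGMA C:H. ?E - C) = (\<Sum>C\<in>H. card (?E - C))"
    by (rule card_SigmaI) (use finH finE in blast)+
  also have "\<dots> = (\<Sum>C\<in>H. m)" by (rule sum.cong[OF refl]) (rule cc)
  also have "\<dots> = card H * m" by simp
  finally have c: "card (SIGMA C:H. ?E - C) = card H * m" .
  have cx: "card (insert x C) = k + 1" if "C \<in> H" "x \<notin> C" for C x
    using card_insert_disjoint[OF finC[OF that(1)] that(2)] SD(3)[OF that(1)] by simp
  have inj: "inj_on (\<lambda>p. insert (snd p) (fst p)) (SIGMA C:H. ?E - C)"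
  proof (rule inj_onI)
    fix p q assume p: "p \<in> (SIGMA C:H. ?E - C)" and q: "q \<in> (SIGMA C:H. ?E - C)"
      and eq: "insert (snd p) (fst p) = insert (snd q) (fst q)"
    obtain C x where px: "p = (C, x)" "C \<in> H" "x \<notin> C" using p by blast
    obtain C' x' where qx: "q = (C', x')" "C' \<in> H" "x' \<notin> C'" using q by blast
    have e: "insert x C = insert x' C'" using eq px qx by simp
    have "C \<subseteq> insert x C" "C' \<subseteq> insert x C" using e by blast+
    moreover have "finite (insert x C)" using finC[OF px(2)] by simp
    ultimately have "C = C'" by (rule sp_matroid_superset_unique[OF S px(2) qx(2) _ _ _ cx[OF px(2,3)]])
    moreover from this have "x = x'" using e px qx by blast
    ultimately show "p = q" using px qx by simp
  qed
  have "(\<lambda>p. insert (snd p) (fst p)) ` (SIGMA C:H. ?E - C) \<subseteq> {F. F \<subseteq> ?E \<and> card F = k + 1}"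
  proof
    fix F assume "F \<in> (\<lambda>p. insert (snd p) (fst p)) ` (SIGMA C:H. ?E - C)"
    then obtain C x where C: "C \<in> H" "x \<in> ?E" "x \<notin> C" "F = insert x C" by force
    then show "F \<in> {F. F \<subseteq> ?E \<and> card F = k + 1}" using SD(2)[OF C(1)] cx[OF C(1,3)] by auto
  qed
  moreover have "finite {F. F \<subseteq> ?E \<and> card F = k + 1}"
    by (rule finite_subset[of _ "Pow ?E"]) (auto simp: finE)
  ultimately have "card (SIGMA C:H. ?E - C) \<le> card {F. F \<subseteq> ?E \<and> card F = k + 1}"
    by (rule card_inj_on_le[OF inj])
  also have "\<dots> = (k + m choose (k + 1))" unfolding n_subsets[OF finE] n ..
  finally have "card H * m \<le> (k + m choose (k + 1))" unfolding c .
  then have "card H * m * (k + 1) \<le> (k + m choose (k + 1)) * (k + 1)" by (rule mult_right_mono) simp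
  also have "\<dots> = (m + k choose k) * m"
  proof -
    have "Suc k * (k + m choose Suc k) = (k + m - k) * (k + m choose k)"
      by (rule Suc_times_choose_Suc)
    moreover have "Suc k = k + 1" "k + m - k = m" by simp_all
    ultimately show ?thesis by (simp only: mult.commute add.commute[of k m])
  qed
  finally have "m * (card H * (k + 1)) \<le> m * (m + k choose k)" by (simp only: mult_ac)
  then show ?thesis using m by simp
qed

lemma sp_matroid_no_circuit_hyperplanes:
  assumes S: "sp_matroid M k H" and n: "card (ground M) = k" and k: "k > 0"
  shows "H = {}"
proof (rule ccontr)
  assume "H \<noteq> {}"
  then obtain C where C: "C \<in> H" by blast
  have "C = ground M"
    using sp_matroidD(2,3)[OF S C] n by (intro card_subset_eq matroidD(1)) simp_all
  then have "rk M = k - 1"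
    using rank_of_sp_matroid(1)[OF S _ C] sp_matroidD(2)[OF S C] by (simp add: rk_def)
  then show False using sp_matroidD(1)[OF S] k by simp
qed

section \<open>Kazhdan--Lusztig polynomials of sparse paving matroids\<close>

abbreviation real_poly :: "int poly \<Rightarrow> real poly" where
  "real_poly \<equiv> map_poly real_of_int"

lemma real_poly_sum: "real_poly (sum f A) = (\<Sum>x\<in>A. real_poly (f x))"
  by (rule poly_eqI) (simp add: coeff_map_poly coeff_sum)

lemma real_poly_add: "real_poly (p + q) = real_poly p + real_poly q"
  by (rule poly_eqI) (simp add: coeff_map_poly)

lemma real_poly_mult: "real_poly (p * q) = real_poly p * real_poly q"
  by (rule poly_eqI) (simp add: coeff_map_poly coeff_mult)

lemma real_poly_monom: "real_poly (monom c n) = monom (real_of_int c) n"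
  by (rule poly_eqI) (simp add: coeff_map_poly)

lemma real_poly_1: "real_poly 1 = 1"
  by (rule poly_eqI) (simp add: coeff_map_poly)

lemma kl_rank_1:
  assumes "rk M = 1"
  shows "kl M = 1" "kl_rest M = monom 1 1"
proof -
  have "{F \<in> flats M. rank_of M F > 0} = {ground M}"
  proof (intro equalityI subsetI)
    fix F assume F: "F \<in> {F \<in> flats M. rank_of M F > 0}"
    show "F \<in> {ground M}"
    proof (rule ccontr)
      assume "F \<notin> {ground M}"
      then have "rank_of M F < rk M"
        unfolding rk_def using F flatD(1)[of F M] by (intro rank_of_flat_less) auto
      then show False using F assms by simp
    qed
  next
    fix F assume "F \<in> {ground M}"
    then show "F \<in> {F \<in> flats M. rank_of M F > 0}" using ground_flat assms by (simp add: rk_def)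
  qed
  moreover have "kl (contraction M (ground M)) = 1"
    using rk_contraction[of "ground M" M] by (intro kl_rank_0) (simp add: rk_def)
  ultimately show r: "kl_rest M = monom 1 1" using assms by (simp add: kl_rest_def rk_def)
  have "coeff (kl M) i = coeff 1 i" for i
    using assms by (simp add: kl_eq coeff_half_part r)
  then show "kl M = 1" by (intro poly_eqI)
qed

text \<open>The verification principle for closed formulas: if adding \<open>q\<close> to
  \<open>kl_rest M\<close> gives a gamma expansion, which is palindromic, and \<open>q\<close> has
  degree below \<open>k / 2\<close>, then \<open>q\<close> is the Kazhdan-Lusztig
  polynomial.\<close>

lemma coeff_eq_gamma_expand:
  assumes "k \<ge> 1" "rk M = k" and z: "real_poly (kl_rest M) = gamma_expand k g - q"
    and q: "\<And>i. k \<le> 2 * i \<Longrightarrow> coeff q i = 0"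
  shows "real_poly (kl M) = q"
proof (rule poly_eqI)
  fix i
  have r: "real_of_int (coeff (kl_rest M) j) = coeff (gamma_expand k g) j - coeff q j" for j
    using arg_cong[OF z, of "\<lambda>p. coeff p j"] by (simp add: coeff_map_poly)
  show "coeff (real_poly (kl M)) i = coeff q i"
  proof (cases "2 * i < k")
    case True
    then have "coeff (real_poly (kl M)) i = real_of_int (coeff (kl_rest M) (k - i)) - real_of_int (coeff (kl_rest M) i)"
      using assms(1,2) by (simp add: coeff_map_poly kl_eq coeff_half_part)
    also have "\<dots> = coeff q i"
      unfolding r using True q[of "k - i"] gamma_expand_palindromic[of i k g] by simp
    finally show ?thesis .
  next
    case False
    then show ?thesis using assms(1,2) q[of i] by (simp add: coeff_map_poly coeff_kl_eq_0)
  qed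
qed

lemma card_image_diff: "card ((\<lambda>C. C - F) ` {C \<in> H. F \<subseteq> C}) = card {C \<in> H. F \<subseteq> C}"
  by (rule card_image) (rule inj_onI, auto)

text \<open>By induction a contraction by \<open>F\<close> depends only on the size of
  \<open>F\<close> and, linearly, on the number \<open>N F\<close> of circuit-hyperplanes containing
  it. So only the sums of \<open>N F\<close> over sets of one size enter, and these come from double
  counting.\<close>

lemma kl_sp_matroid:
  assumes "sp_matroid M k H" "k \<ge> 1" "card (ground M) = k + m"
  shows "real_poly (kl M) = kl_sp k m (real (card H)) \<and>
    (k \<ge> 2 \<longrightarrow> real_poly (z_full M) = gamma_expand k (gamma_coeff k m (real (card H))))"
  using assms
proof (induction k arbitrary: M H rule: less_induct)
  case (less k)
  note S = less.prems(1)
  note SD = sp_matroidD[OF S]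
  show ?case
  proof (cases "k = 1")
    case True
    then show ?thesis using SD(1) kl_rank_1(1)[of M] kl_sp_1 by (simp add: real_poly_1)
  next
    case False
    then have k: "k \<ge> 2" using less.prems by simp
    let ?E = "ground M" and ?l = "real (card H)"
    have finE: "finite ?E" by (rule matroidD(1))
    have "H \<subseteq> Pow ?E" using SD(2) by blast
    then have finH: "finite H" by (rule finite_subset) (simp add: finE)
    define A where "A r = {F. F \<subseteq> ?E \<and> card F = r}" for r
    have finA: "finite (A r)" for r
    proof -
      have "A r \<subseteq> Pow ?E" by (auto simp: A_def)
      then show ?thesis by (rule finite_subset) (simp add: finE)
    qed
    have cA: "card (A r) = (k + m choose r)" for r
      unfolding A_def using n_subsets[OF finE] less.prems(3) by simp
    define B where "B = {F \<in> A (k - 1). \<forall>C\<in>H. \<not> F \<subseteq> C}"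
    have finB: "finite B" using finA[of "k - 1"] by (simp add: B_def)
    define N where "N F = card {C \<in> H. F \<subseteq> C}" for F
    have sumN: "(\<Sum>F\<in>A r. real (N F)) = ?l * real (k choose r)" for r
    proof -
      have "(\<Sum>F\<in>A r. N F) = card H * (k choose r)"
        unfolding A_def N_def by (rule sum_card_containing[OF finE]) (use SD(2,3) in blast)
      then show ?thesis by (simp flip: of_nat_sum of_nat_mult)
    qed
    define f where "f F = monom 1 (rank_of M F) * real_poly (kl (contraction M F))" for F
    have rF: "rank_of M F = r" if "F \<in> A r" "r < k" for F r
      using sp_matroid_contraction(2)[OF S, of F] that by (simp add: A_def)
    have EH: "?E \<notin> H"
    proof
      assume "?E \<in> H"
      then have "rank_of M ?E = k - 1" using rank_of_sp_matroid(1)[OF S order_refl] by simp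
      then show False using SD(1) k by (simp add: rk_def)
    qed
    have rE: "rank_of M ?E = k" using SD(1) by (simp add: rk_def)
    have cE: "card ?E \<ge> k" using less.prems(3) by simp
    have rH: "rank_of M C = k - 1" if "C \<in> H" for C
      using rank_of_sp_matroid(1)[OF S SD(2)[OF that] that] .
    have fr: "f F = monom 1 r * kl_sp (k - r) m (real (N F))" if F: "F \<in> A r" and r: "1 \<le> r" "r < k" for F r
    proof -
      have FE: "F \<subseteq> ?E" "card F = r" using F by (auto simp: A_def)
      have "card (?E - F) = card ?E - card F"
        by (rule card_Diff_subset) (use FE finE finite_subset in auto)
      then have "card (ground (contraction M F)) = (k - r) + m"
        using FE r less.prems(3) by (simp add: ground_contraction)
      then have "real_poly (kl (contraction M F)) = kl_sp (k - r) m (real (N F))"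
        using less.IH[of "k - r" "contraction M F" "(\<lambda>C. C - F) ` {C \<in> H. F \<subseteq> C}"]
          sp_matroid_contraction(1)[OF S FE(1)] FE(2) r
        by (simp add: card_image_diff N_def)
      then show ?thesis using rF[OF F] r by (simp add: f_def)
    qed
    have f1: "f F = monom 1 (k - 1)" if "F \<subseteq> ?E" "rank_of M F = k - 1" for F
      using rk_contraction[OF that(1)] that(2) SD(1) k kl_rank_1(1)[of "contraction M F"]
      by (simp add: f_def real_poly_1)
    have fE: "f ?E = monom 1 k"
      using rk_contraction[of ?E M] rE SD(1) kl_rank_0[of "contraction M ?E"]
      by (simp add: f_def real_poly_1)
    have flats_pos: "{F \<in> flats M. rank_of M F > 0} = (\<Union>r\<in>{1..k - 2}. A r) \<union> B \<union> H \<union> {?E}"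
    proof (intro equalityI subsetI)
      fix F assume F: "F \<in> {F \<in> flats M. rank_of M F > 0}"
      then have "F \<in> {F. F \<subseteq> ?E \<and> card F + 2 \<le> k} \<or> F \<in> B \<or> F \<in> H \<or> F = ?E"
        using flats_sp_matroid[OF S k] k by (auto simp: A_def B_def)
      moreover have "F \<in> (\<Union>r\<in>{1..k - 2}. A r)" if F2: "F \<in> {F. F \<subseteq> ?E \<and> card F + 2 \<le> k}"
      proof -
        have "F \<in> A (card F)" using F2 by (simp add: A_def)
        moreover have "card F < k" using F2 k by auto
        ultimately have "card F > 0" using rF[of F "card F"] F by simp
        then show ?thesis using F2 \<open>F \<in> A (card F)\<close> by (intro UN_I[of "card F"]) auto
      qed
      ultimately show "F \<in> (\<Union>r\<in>{1..k - 2}. A r) \<union> B \<union> H \<union> {?E}" by blast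
    next
      fix F assume "F \<in> (\<Union>r\<in>{1..k - 2}. A r) \<union> B \<union> H \<union> {?E}"
      then consider r where "r \<in> {1..k - 2}" "F \<in> A r" | "F \<in> B" | "F \<in> H" | "F = ?E" by blast
      then show "F \<in> {F \<in> flats M. rank_of M F > 0}"
      proof cases
        case 1
        then have "F \<subseteq> ?E \<and> card F + 2 \<le> k" using k by (auto simp: A_def)
        then have "F \<in> flats M" using flats_sp_matroid[OF S k] by auto
        then show ?thesis using rF[OF 1(2)] 1(1) k by auto
      next
        case 2
        then have "F \<subseteq> ?E \<and> card F + 1 = k \<and> (\<forall>C\<in>H. \<not> F \<subseteq> C)" using k by (auto simp: A_def B_def)
        then have "F \<in> flats M" using flats_sp_matroid[OF S k] by auto
        then show ?thesis using rF[of F "k - 1"] 2 k by (simp add: B_def)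
      next
        case 3
        then show ?thesis using flats_sp_matroid[OF S k] rH[OF 3] k by auto
      next
        case 4
        then show ?thesis using ground_flat rE k by simp
      qed
    qed
    have cardA: "F \<in> A r \<Longrightarrow> card F = r" for F r by (simp add: A_def)
    have cB: "card F = k - 1" if "F \<in> B" for F using that by (simp add: B_def A_def)
    have disj1: "((\<Union>r\<in>{1..k - 2}. A r) \<union> B \<union> H) \<inter> {?E} = {}"
    proof -
      have "card F < k" if "F \<in> (\<Union>r\<in>{1..k - 2}. A r) \<union> B" for F
        using that cardA cB k by fastforce
      then show ?thesis using cE EH by (metis (no_types, lifting) Int_insert_right_if0 UnE inf_bot_right not_le)
    qed
    have disj2: "((\<Union>r\<in>{1..k - 2}. A r) \<union> B) \<inter> H = {}"
    proof -
      have "card F < k" if "F \<in> (\<Union>r\<in>{1..k - 2}. A r) \<union> B" for F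
        using that cardA cB k by fastforce
      then show ?thesis using SD(3) by fastforce
    qed
    have disj3: "(\<Union>r\<in>{1..k - 2}. A r) \<inter> B = {}"
    proof -
      have "card F < k - 1" if "F \<in> (\<Union>r\<in>{1..k - 2}. A r)" for F
        using that cardA k by fastforce
      then show ?thesis using cB by fastforce
    qed
    have finU: "finite (\<Union>r\<in>{1..k - 2}. A r)" using finA by blast
    have "real_poly (kl_rest M) = (\<Sum>F\<in>{F \<in> flats M. rank_of M F > 0}. f F)"
      unfolding kl_rest_def f_def by (simp add: real_poly_sum real_poly_mult real_poly_monom)
    also have "\<dots> = (\<Sum>F\<in>(\<Union>r\<in>{1..k - 2}. A r). f F) + (\<Sum>F\<in>B. f F) + (\<Sum>F\<in>H. f F) + f ?E"
      unfolding flats_pos using finU finB finH disj1 disj2 disj3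
      by (simp only: sum.union_disjoint finite_UnI finite.emptyI finite_insert sum.insert sum.empty) simp
    also have "(\<Sum>F\<in>(\<Union>r\<in>{1..k - 2}. A r). f F) = (\<Sum>r\<in>{1..k - 2}. \<Sum>F\<in>A r. f F)"
      by (rule sum.UNION_disjoint) (auto simp: finA dest: cardA)
    also have "\<dots> = (\<Sum>r\<in>{1..k - 2}. monom (real (k + m choose r)) r * kl_unif (k - r) m
        - smult ?l (monom (real (k choose r)) r * kl_circ (k - r)))"
    proof (rule sum.cong[OF refl])
      fix r assume r: "r \<in> {1..k - 2}"
      have "(\<Sum>F\<in>A r. f F) = (\<Sum>F\<in>A r. monom 1 r * kl_unif (k - r) m - smult (real (N F)) (monom 1 r * kl_circ (k - r)))"
        using r k by (intro sum.cong) (auto simp: fr kl_sp_def right_diff_distrib)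
      also have "\<dots> = smult (real (card (A r))) (monom 1 r * kl_unif (k - r) m)
          - smult (\<Sum>F\<in>A r. real (N F)) (monom 1 r * kl_circ (k - r))"
        by (simp add: sum_subtractf smult_sum of_nat_poly)
      also have "\<dots> = monom (real (k + m choose r)) r * kl_unif (k - r) m
        - smult ?l (monom (real (k choose r)) r * kl_circ (k - r))"
        unfolding sumN cA by (simp add: smult_monom flip: mult_smult_left)
      finally show "(\<Sum>F\<in>A r. f F) = monom (real (k + m choose r)) r * kl_unif (k - r) m
        - smult ?l (monom (real (k choose r)) r * kl_circ (k - r))" .
    qed
    also have "(\<Sum>F\<in>B. f F) = (\<Sum>F\<in>A (k - 1). monom (1 - real (N F)) (k - 1))"
    proof -
      \<comment> \<open>A \<open>(k - 1)\<close>-set lies in at most one member of \<open>H\<close>,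
        so \<open>1 - N F\<close> is the indicator of being a flat.\<close>
      have N1: "N F = (if F \<in> B then 0 else 1)" if F: "F \<in> A (k - 1)" for F
      proof (cases "F \<in> B")
        case True
        then have e: "{C \<in> H. F \<subseteq> C} = {}" by (auto simp: B_def)
        show ?thesis unfolding N_def e using True by simp
      next
        case False
        then obtain C where C: "C \<in> H" "F \<subseteq> C" using F by (auto simp: B_def)
        have "card F + 1 = k" using F k by (simp add: A_def)
        then have "{C \<in> H. F \<subseteq> C} = {C}"
          using C sp_matroid_subset_unique[OF S _ C(1) _ C(2)] by blast
        then show ?thesis using False by (simp add: N_def)
      qed
      have fB: "f F = monom 1 (k - 1)" if "F \<in> B" for F
        using that rF[of F "k - 1"] k by (intro f1) (auto simp: B_def A_def)
      have "(\<Sum>F\<in>A (k - 1). monom (1 - real (N F)) (k - 1)) = (\<Sum>F\<in>B. f F)"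
        by (rule sum.mono_neutral_cong_right) (use finA N1 fB in \<open>auto simp: B_def\<close>)
      then show ?thesis ..
    qed
    also have "\<dots> = monom (real (k + m choose (k - 1)) - ?l * real k) (k - 1)"
    proof -
      have "(\<Sum>F\<in>A (k - 1). monom (1 - real (N F)) (k - 1)) = monom (\<Sum>F\<in>A (k - 1). 1 - real (N F)) (k - 1)"
        by (rule poly_eqI) (simp add: coeff_sum)
      also have "(\<Sum>F\<in>A (k - 1). 1 - real (N F)) = real (k + m choose (k - 1)) - ?l * real (k choose (k - 1))"
        by (simp add: sum_subtractf sumN cA)
      also have "k choose (k - 1) = k" using k binomial_symmetric[of 1 k] by simp
      finally show ?thesis .
    qed
    also have "(\<Sum>F\<in>H. f F) = monom ?l (k - 1)"
    proof -
      have "(\<Sum>F\<in>H. f F) = (\<Sum>F\<in>H. monom 1 (k - 1))"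
        by (rule sum.cong[OF refl]) (rule f1, use SD(2) rH in auto)
      also have "\<dots> = monom ?l (k - 1)" by (simp add: of_nat_poly smult_monom)
      finally show ?thesis .
    qed
    also note fE
    finally have rest: "real_poly (kl_rest M) = (\<Sum>r\<in>{1..k - 2}. monom (real (k + m choose r)) r * kl_unif (k - r) m
        - smult ?l (monom (real (k choose r)) r * kl_circ (k - r)))
        + monom (real (k + m choose (k - 1)) - ?l * real k) (k - 1) + monom ?l (k - 1) + monom 1 k" .
    define T where "T j = monom (real (k + m choose j)) j * kl_unif (k - j) m - smult ?l (monom (real (k choose j)) j * kl_circ (k - j))" for j
    have Tk: "T (k - 1) = monom (real (k + m choose (k - 1))) (k - 1)"
    proof -
      have e: "k - (k - 1) = 1" using k by simp
      show ?thesis unfolding T_def e kl_unif_1 by (simp add: kl_circ_def)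
    qed
    have T0: "T 0 = kl_sp k m ?l" by (simp add: T_def kl_sp_def monom_0)
    have "{..<k} = insert 0 (insert (k - 1) {1..k - 2})" using k by auto
    then have "(\<Sum>j<k. T j) = kl_sp k m ?l + monom (real (k + m choose (k - 1))) (k - 1) + (\<Sum>j\<in>{1..k - 2}. T j)"
    proof -
      have "k - 1 \<notin> {1..k - 2}" "0 \<notin> insert (k - 1) {1..k - 2}" using k by auto
      moreover assume "{..<k} = insert 0 (insert (k - 1) {1..k - 2})"
      ultimately show ?thesis using T0 Tk by (simp add: add.assoc)
    qed
    then have zs: "kl_sp k m ?l + monom (real (k + m choose (k - 1))) (k - 1) + (\<Sum>j\<in>{1..k - 2}. T j)
       - monom (?l * (real k - 1)) (k - 1) + monom 1 k = gamma_expand k (gamma_coeff k m ?l)"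
      using z_sp[OF k, of m ?l] by (simp add: T_def)
    \<comment> \<open>Each circuit-hyperplane removes \<open>k\<close> flats of size
      \<open>k - 1\<close> and adds itself, a net loss of \<open>k - 1\<close>.\<close>
    have "monom (real (k + m choose (k - 1)) - ?l * real k) (k - 1) + monom ?l (k - 1)
        = monom (real (k + m choose (k - 1))) (k - 1) - monom (?l * (real k - 1)) (k - 1)"
      by (simp add: add_monom diff_monom algebra_simps)
    then have rest': "real_poly (kl_rest M) = gamma_expand k (gamma_coeff k m ?l) - kl_sp k m ?l"
      unfolding rest zs[symmetric] T_def[symmetric] by (simp add: algebra_simps)
    have "real_poly (kl M) = kl_sp k m ?l"
      by (rule coeff_eq_gamma_expand[OF less.prems(2) SD(1) rest']) (use k coeff_kl_sp_eq_0 in auto)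
    moreover from this have "real_poly (z_full M) = gamma_expand k (gamma_coeff k m ?l)"
      by (simp add: z_full_eq real_poly_add rest')
    ultimately show ?thesis by simp
  qed
qed

section \<open>From the closed formula to the zeros\<close>

lemma gamma_subst_inj: "inj_on (\<lambda>n::nat. real n / (1 + real n)\<^sup>2) {1..}"
proof (rule inj_onI)
  fix a b :: nat
  assume ab: "a \<in> {1..}" "b \<in> {1..}" "real a / (1 + real a)\<^sup>2 = real b / (1 + real b)\<^sup>2"
  then have "real a * (1 + real b)\<^sup>2 = real b * (1 + real a)\<^sup>2"
    by (simp add: frac_eq_eq)
  \<comment> \<open>The second factor reflects the symmetry of \<open>x / (1 + x)^2\<close> under
    \<open>x\<close> and \<open>1 / x\<close>; restricting to arguments from 1 on removes the
    ambiguity.\<close>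
  then have "(real a - real b) * (1 - real a * real b) = 0"
    by (simp add: power2_eq_square algebra_simps)
  then consider "real a = real b" | "real a * real b = 1" by auto
  then show "a = b"
  proof cases
    case 2
    then have "a * b = 1" by (simp flip: of_nat_mult)
    then show ?thesis by simp
  qed simp
qed

lemma is_gamma_poly_unique:
  assumes "is_gamma_poly M G" "is_gamma_poly M G'"
  shows "G = G'"
proof -
  let ?D = "real_poly G - real_poly G'"
  have "poly ?D (real n / (1 + real n)\<^sup>2) = 0" for n
  proof -
    have "real n \<noteq> -1" "1 + real n \<noteq> 0" by linarith+
    then show ?thesis using assms by (simp add: is_gamma_poly_def)
  qed
  then have "(\<lambda>n::nat. real n / (1 + real n)\<^sup>2) ` {1..} \<subseteq> {x. poly ?D x = 0}" by auto
  moreover have "infinite ((\<lambda>n::nat. real n / (1 + real n)\<^sup>2) ` {1..})"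
    using finite_imageD[OF _ gamma_subst_inj] infinite_Ici by blast
  ultimately have "infinite {x. poly ?D x = 0}" using finite_subset by blast
  then have "?D = 0" using poly_roots_finite by blast
  then have "real_poly G = real_poly G'" by simp
  then show ?thesis
    by (intro poly_eqI) (metis coeff_map_poly of_int_0 of_int_eq_iff)
qed

lemma real_rooted_conclusion:
  assumes Z: "real_poly (Z_poly M) = gamma_expand (rk M) g"
    and rr: "real_rooted (\<Sum>i\<le>rk M div 2. monom (g i) i)"
    and g: "\<And>i. i \<le> rk M div 2 \<Longrightarrow> g i \<ge> 0" and g0: "g 0 > 0"
  shows "only_negative_real_zeros (gamma_poly M) \<and> only_negative_real_zeros (Z_poly M)"
proof -
  let ?k = "rk M"
  \<comment> \<open>The floor only converts the type: \<open>gamma_expand_integral\<close> shows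
    that each \<open>g i\<close> is an integer.\<close>
  define G :: "int poly" where "G = (\<Sum>i\<le>?k div 2. monom \<lfloor>g i\<rfloor> i)"
  have gi: "real_of_int \<lfloor>g i\<rfloor> = g i" if "i \<le> ?k div 2" for i
    using gamma_expand_integral[OF Z that] by (simp add: of_int_floor_cancel)
  have RG: "poly (real_poly G) x = (\<Sum>i\<le>?k div 2. g i * x ^ i)" for x
    unfolding G_def by (simp add: real_poly_sum real_poly_monom poly_sum poly_monom gi)
  have "is_gamma_poly M G"
    unfolding is_gamma_poly_def
  proof (intro conjI allI impI)
    show "degree G \<le> ?k div 2"
      unfolding G_def by (intro degree_sum_le) (auto intro: order.trans[OF degree_monom_le])
    fix x :: real assume "x \<noteq> -1"
    then have x: "1 + x \<noteq> 0" by (simp add: add_eq_0_iff2)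
    show "poly (real_poly (Z_poly M)) x = (1 + x) ^ ?k * poly (real_poly G) (x / (1 + x)\<^sup>2)"
      unfolding Z poly_gamma_expand RG sum_distrib_left
      by (intro sum.cong refl) (use x in \<open>auto simp: gamma_subst\<close>)
  qed
  then have gp: "gamma_poly M = G"
    unfolding gamma_poly_def using is_gamma_poly_unique by (intro the_equality) auto
  note neg = gamma_negative_zeros[OF rr g g0]
  have conv: "map_poly of_int p = (map_poly of_real (real_poly p) :: complex poly)" for p
    by (rule poly_eqI) (simp add: coeff_map_poly)
  have "z \<in> \<real> \<and> Re z < 0" if z: "poly (map_poly of_int G) z = 0" for z :: complex
  proof -
    have "real_poly G = (\<Sum>i\<le>?k div 2. monom (g i) i)"
      unfolding G_def real_poly_sum real_poly_monom by (intro sum.cong) (auto simp: gi)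
    then have "map_poly of_int G = (\<Sum>i\<le>?k div 2. monom (of_real (g i)) i :: complex poly)"
      unfolding conv by (intro poly_eqI) (simp add: coeff_map_poly coeff_sum)
    then have "(\<Sum>i\<le>?k div 2. of_real (g i) * z ^ i) = 0" using z by (simp add: poly_sum poly_monom)
    then show ?thesis using neg(1) by (simp add: complex_is_Real_iff)
  qed
  moreover have "z \<in> \<real> \<and> Re z < 0" if z: "poly (map_poly of_int (Z_poly M)) z = 0" for z :: complex
    using neg(2)[of z] z unfolding conv Z by (simp add: complex_is_Real_iff)
  ultimately show ?thesis unfolding only_negative_real_zeros_def gp by blast
qed

theorem theorem1p1:
  fixes M :: "'a matroid"
  assumes "sparse_paving M"
  shows "only_negative_real_zeros (gamma_poly M) \<and> only_negative_real_zeros (Z_poly M)"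
proof -
  define k where "k = rk M"
  define H where "H = {C. C \<subseteq> ground M \<and> card C = rk M \<and> C \<notin> indeps M}"
  have S: "sp_matroid M k H" unfolding k_def H_def by (rule sparse_paving_sp_matroid[OF assms])
  \<comment> \<open>Rank at most 1 and corank 0: there the gamma polynomial is 1 and the
    Z-polynomial is \<open>(1 + x)^k\<close>.\<close>
  have trivial: "only_negative_real_zeros (gamma_poly M) \<and> only_negative_real_zeros (Z_poly M)"
    if Z: "real_poly (Z_poly M) = gamma_expand k g" and g: "\<And>i. i \<le> k div 2 \<Longrightarrow> g i = (if i = 0 then 1 else 0)" for g
  proof (rule real_rooted_conclusion[OF Z[unfolded k_def]])
    have "(\<Sum>i\<le>rk M div 2. monom (g i) i) = [:1, 0:]"
      by (rule poly_eqI) (auto simp: coeff_sum g k_def sum.delta coeff_pCons split: nat.split)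
    then show "real_rooted (\<Sum>i\<le>rk M div 2. monom (g i) i)" using real_rooted_linear[of 0] by simp
  qed (use g in \<open>auto simp: k_def\<close>)
  have ge: "gamma_expand k (\<lambda>i. if i = 0 then 1 else 0) = [:1, 1:] ^ k"
    unfolding gamma_expand_def by (subst sum.remove[of _ 0]) (auto simp: sum.neutral)
  consider "k = 0" | "k = 1" | "k \<ge> 2" by linarith
  then show ?thesis
  proof cases
    case 1
    have e: "{F \<in> flats M. rank_of M F > 0} = {}"
      using rank_of_le_rk[of _ M] flatD(1)[of _ M] 1 by (auto simp: k_def)
    have "Z_poly M = 1" using 1 kl_rank_0[of M] unfolding Z_poly_eq z_full_eq kl_rest_def k_def e by simp
    then have "real_poly (Z_poly M) = gamma_expand k (\<lambda>i. if i = 0 then 1 else 0)"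
      unfolding ge using 1 by (simp add: real_poly_1)
    then show ?thesis by (rule trivial) simp
  next
    case 2
    then have "Z_poly M = 1 + monom 1 1"
      using kl_rank_1[of M] by (simp add: Z_poly_eq z_full_eq k_def)
    then have "real_poly (Z_poly M) = gamma_expand k (\<lambda>i. if i = 0 then 1 else 0)"
      unfolding ge using 2 by (simp add: real_poly_add real_poly_1 real_poly_monom monom_Suc one_pCons map_poly_pCons)
    then show ?thesis by (rule trivial) simp
  next
    case 3
    have "k \<le> card (ground M)"
      using rank_of_le_card[OF matroidD(1), of M] by (simp add: k_def rk_def)
    then obtain m where m: "card (ground M) = k + m" using le_Suc_ex by blast
    let ?l = "real (card H)"
    have Z: "real_poly (Z_poly M) = gamma_expand k (gamma_coeff k m ?l)"
      using kl_sp_matroid[OF S _ m] 3 by (simp add: Z_poly_eq)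
    have k0: "k > 0" using 3 by simp
    show ?thesis
    proof (cases "m = 0")
      case True
      \<comment> \<open>With \<open>k\<close> elements and rank \<open>k\<close> there are no
        circuit-hyperplanes, and the sum over coranks in \<open>gamma_rat\<close> is empty.\<close>
      then have "?l = 0" using sp_matroid_no_circuit_hyperplanes[OF S _ k0] m by simp
      then show ?thesis using Z True by (intro trivial[OF Z]) (simp add: gamma_coeff_def gamma_rat_def)
    next
      case False
      have l: "?l * (real m + 1) \<le> real (m + k choose k)" "?l * (real k + 1) \<le> real (m + k choose k)"
      proof -
        have "real (card H * (m + 1)) \<le> real (m + k choose k)" "real (card H * (k + 1)) \<le> real (m + k choose k)"
          using sp_matroid_bound_below[OF S m k0] sp_matroid_bound_above[OF S m] False
          by (simp_all only: of_nat_le_iff)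
        then show "?l * (real m + 1) \<le> real (m + k choose k)" "?l * (real k + 1) \<le> real (m + k choose k)"
          by (simp_all only: of_nat_mult of_nat_add of_nat_1)
      qed
      have m1: "m \<ge> 1" using False by simp
      note gs = gamma_sp_real_rooted[OF 3 m1 of_nat_0_le_iff l]
      show ?thesis
        by (rule real_rooted_conclusion[OF Z[unfolded k_def]])
          (use gs in \<open>auto simp: gamma_sp_def k_def gamma_coeff_def[of _ _ _ 0]\<close>)
    qed
  qed
qed

end
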